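(* Let $E$ be a Banach space with a tensor norm $\|\cdot\|_\otimes$ on $E\otimes_a E$ satisfying $\|x\otimes y\|_\otimes\le\|x\|\,\|y\|$ and $\|x\otimes y\|_\otimes=\|y\otimes x\|_\otimes$ for all $x,y\in E$, with completion $E\otimes E$. Let $G^2(E)$, $d$, $d_\beta$ and the Carnot–Carathéodory metric $\rho$ be as defined in the context. Write $$M_{cc}=\{\mathbf{z}\in G^2(E):\rho(1,\mathbf{z})<\infty\},$$ and $C([0,T],M_{cc})$ for the space of continuous curves in $M_{cc}$ with respect to $\rho$. Let $\alpha\in(\frac13,\frac12)$ be given and let $\beta\in(\frac13,\alpha)$ be arbitrary. Assume that the following conditions are satisfied. (I) For some $C>0$ and any $\mathbf{z}\in G^2(E)$, we have $d(1,\mathbf{z})\le C\rho(1,\mathbf{z})$. (II) The metric space $(M_{cc},\rho)$ is a complete, geodesic space. (III) The set $C^\alpha([0,T],G^2(E))\cap C([0,T],M_{cc})$ is dense in $C^\alpha([0,T],G^2(E))$ relative to the metric $d_\beta$. Then for any $\mathbf{x}\in C^\alpha([0,T],G^2(E))$ there exists a sequence of bounded variation paths $x^n:[0,T]\to E$ such that $$\mathbf{x}^n=S^2(x^n)\to\mathbf{x}\quad\text{in }\mathscr{C}^\beta([0,T],E).$$ In particular, we have the inclusions $$\mathscr{C}^\alpha_g([0,T],E)\subset C^\alpha([0,T],G^2(E))\subset\mathscr{C}^\beta_g([0,T],E).$$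
   Context: Group: $1+E\oplus(E\otimes E)$ is a group under $(1+x+x^{(2)})(1+y+y^{(2)})=1+(x+y)+(x^{(2)}+x\otimes y+y^{(2)})$. Let $\mathcal{P}^2(E)$ be the closure in $E\oplus(E\otimes E)$ of $E\oplus\mathrm{span}\{x\otimes y-y\otimes x:x,y\in E\}$. Then $G^2(E)=\exp(\mathcal{P}^2(E))$, where $\exp(x+x^{(2)})=1+x+x^{(2)}+\frac12x\otimes x$; it is a closed subgroup. Distances: for $\mathbf{x}=1+x+x^{(2)}$ put $|\mathbf{x}|=\max\{\|x\|,\|x^{(2)}\|_\otimes^{1/2}\}$ and $d(\mathbf{x},\mathbf{y})=|\mathbf{x}^{-1}\mathbf{y}|$. For curves $\mathbf{x}_t,\mathbf{y}_t$ write $\mathbf{x}_{st}=\mathbf{x}_s^{-1}\mathbf{x}_t$ and, for an exponent $\beta$, $d_\beta(\mathbf{x},\mathbf{y})=\sup_{0\le s<t\le T}d(\mathbf{x}_{st},\mathbf{y}_{st})/|t-s|^\beta$. Rough paths: $\mathscr{C}^\alpha([0,T],E)$ is the set of $\alpha$-rough paths, i.e. pairs $x:[0,T]\to E$, $x^{(2)}:[0,T]^2\to E\otimes E$ with $\|x_t-x_s\|\lesssim|t-s|^\alpha$, $\|x^{(2)}_{st}\|_\otimes\lesssim|t-s|^{2\alpha}$ and $x^{(2)}_{st}-x^{(2)}_{su}-x^{(2)}_{ut}=(x_u-x_s)\otimes(x_t-x_u)$, with distance $d_\alpha$. With $\mathbf{x}_{st}=1+(x_t-x_s)+x^{(2)}_{st}$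 and $\mathbf{x}_t:=\mathbf{x}_{0t}$ (so $\mathbf{x}_0=1$) they are identified with $\alpha$-Hölder curves (for $d$) in $1+E\oplus(E\otimes E)$. $C^\alpha([0,T],G^2(E))$ denotes those taking values in $G^2(E)$ (weakly geometric rough paths). $\mathscr{C}^\alpha_g([0,T],E)$ (geometric rough paths) is the $d_\alpha$-closure of the set of canonical lifts $\mathbf{x}_{st}=1+x_t-x_s+\int_s^t(x_r-x_s)\otimes dx_r$ of smooth paths $x$. The same definitions apply with $\beta$ in place of $\alpha$. For a bounded variation path $x$, $S^2(x)$ is its lift $S^2(x)_{st}=1+x_t-x_s+\int_s^t(x_r-x_s)\otimes dx_r$, and $S^2(x)_t=S^2(x)_{0t}$. Carnot–Carathéodory metric: $\rho(\mathbf{y},\mathbf{z})=\rho(1,\mathbf{y}^{-1}\mathbf{z})\in[0,\infty]$, where $\rho(1,\mathbf{y})$ is the infimum of the lengths $\int_0^T\|\dot x_t\|\,dt$ (total variation) over all continuous bounded variation paths $x:[0,T]\to E$ with $x_0=0$ and $\mathbf{y}=S^2(x)_T=1+x_T+\int_0^Tx_t\otimes dx_t$; the infimum of the empty set is $\infty$. Geodesic space: a metric space $(M,\rho)$ is geodesic if any two points are joined by a curve $\gamma:[0,1]\to M$ with $\mathrm{Length}(\gamma|_{[s,t]})=\rho(\gamma(s),\gamma(t))=|t-s|\rho(\gamma(0),\gamma(1))$ for all $0\le s\le t\le1$. *)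

theory Defs
  imports "HOL-Analysis.Analysis"
begin

section \<open>The completed tensor square\<close>

text \<open>
  The completion \<open>E \<otimes> E\<close> is a Banach space \<^typ>\<open>'b\<close> with a map \<open>tens :: 'a \<Rightarrow> 'a \<Rightarrow> 'b\<close>.
  The pair \<open>(span {tens x y}, tens)\<close> is the algebraic tensor product, given by its universal
  property, the tensor norm is the restriction to this span of the norm of \<^typ>\<open>'b\<close>, and the
  span is dense. In the universal property, bilinear forms with real values are enough: the
  lemma \<open>algebraic_tensor_universal\<close> below gives the factorisation for all real vector spaces.
  The factor is stated on all of \<^typ>\<open>'b\<close> because a linear map on a subspace always extends;
  only its values on the span are unique.
\<close>

definition algebraic_tensor :: "('a::real_vector \<Rightarrow> 'a \<Rightarrow> 'b::real_vector) \<Rightarrow> bool" where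
  "algebraic_tensor tens \<longleftrightarrow>
     bilinear tens \<and>
     (\<forall>B :: 'a \<Rightarrow> 'a \<Rightarrow> real. bilinear B \<longrightarrow>
        (\<exists>L :: 'b \<Rightarrow> real. linear L \<and> (\<forall>x y. B x y = L (tens x y))))"

definition tensor_square :: "('a::banach \<Rightarrow> 'a \<Rightarrow> 'b::banach) \<Rightarrow> bool" where
  "tensor_square tens \<longleftrightarrow>
     algebraic_tensor tens \<and>
     closure (span {tens x y | x y. True}) = UNIV \<and>
     (\<forall>x y. norm (tens x y) \<le> norm x * norm y) \<and>
     (\<forall>x y. norm (tens x y) = norm (tens y x))"


section \<open>The group \<open>1 + E \<oplus> (E \<otimes> E)\<close> and its subgroup \<open>G\<^sup>2(E)\<close>\<close>

text \<open>The pair \<open>(x, x2)\<close> stands for the element \<open>1 + x + x2\<close>.\<close>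

definition gone :: "'a::real_vector \<times> 'b::real_vector" where
  "gone = (0, 0)"

definition gmult :: "('a::real_vector \<Rightarrow> 'a \<Rightarrow> 'b::real_vector) \<Rightarrow> 'a \<times> 'b \<Rightarrow> 'a \<times> 'b \<Rightarrow> 'a \<times> 'b"
  where "gmult tens p q = (fst p + fst q, snd p + tens (fst p) (fst q) + snd q)"

definition ginv :: "('a::real_vector \<Rightarrow> 'a \<Rightarrow> 'b::real_vector) \<Rightarrow> 'a \<times> 'b \<Rightarrow> 'a \<times> 'b" where
  "ginv tens p = (- fst p, tens (fst p) (fst p) - snd p)"

definition P2 :: "('a::real_normed_vector \<Rightarrow> 'a \<Rightarrow> 'b::real_normed_vector) \<Rightarrow> ('a \<times> 'b) set" where
  "P2 tens = closure (UNIV \<times> span {tens x y - tens y x | x y. True})"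

definition gexp :: "('a::real_vector \<Rightarrow> 'a \<Rightarrow> 'b::real_vector) \<Rightarrow> 'a \<times> 'b \<Rightarrow> 'a \<times> 'b" where
  "gexp tens p = (fst p, snd p + (1 / 2) *\<^sub>R tens (fst p) (fst p))"

definition G2 :: "('a::real_normed_vector \<Rightarrow> 'a \<Rightarrow> 'b::real_normed_vector) \<Rightarrow> ('a \<times> 'b) set" where
  "G2 tens = gexp tens ` P2 tens"

definition gnorm :: "'a::real_normed_vector \<times> 'b::real_normed_vector \<Rightarrow> real" where
  "gnorm p = max (norm (fst p)) (sqrt (norm (snd p)))"

definition gdist ::
  "('a::real_normed_vector \<Rightarrow> 'a \<Rightarrow> 'b::real_normed_vector) \<Rightarrow> 'a \<times> 'b \<Rightarrow> 'a \<times> 'b \<Rightarrow> real" where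
  "gdist tens p q = gnorm (gmult tens (ginv tens p) q)"


section \<open>Rough paths\<close>

definition ginc ::
  "('a::real_vector \<Rightarrow> 'a \<Rightarrow> 'b::real_vector) \<Rightarrow> (real \<Rightarrow> 'a \<times> 'b) \<Rightarrow> real \<Rightarrow> real \<Rightarrow> 'a \<times> 'b" where
  "ginc tens X s t = gmult tens (ginv tens (X s)) (X t)"

definition holder_dist ::
  "('a::real_normed_vector \<Rightarrow> 'a \<Rightarrow> 'b::real_normed_vector) \<Rightarrow> real \<Rightarrow> real \<Rightarrow>
   (real \<Rightarrow> 'a \<times> 'b) \<Rightarrow> (real \<Rightarrow> 'a \<times> 'b) \<Rightarrow> ereal" where
  "holder_dist tens T \<beta> X Y =
     (SUP (s, t) \<in> {(s, t). 0 \<le> s \<and> s < t \<and> t \<le> T}.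
        ereal (gdist tens (ginc tens X s t) (ginc tens Y s t) / \<bar>t - s\<bar> powr \<beta>))"

definition is_rough_path ::
  "('a::real_normed_vector \<Rightarrow> 'a \<Rightarrow> 'b::real_normed_vector) \<Rightarrow> real \<Rightarrow> real \<Rightarrow>
   (real \<Rightarrow> 'a) \<Rightarrow> (real \<Rightarrow> real \<Rightarrow> 'b) \<Rightarrow> bool" where
  "is_rough_path tens T \<alpha> x x2 \<longleftrightarrow>
     (\<exists>C. \<forall>s\<in>{0..T}. \<forall>t\<in>{0..T}. norm (x t - x s) \<le> C * \<bar>t - s\<bar> powr \<alpha>) \<and>
     (\<exists>C. \<forall>s\<in>{0..T}. \<forall>t\<in>{0..T}. norm (x2 s t) \<le> C * \<bar>t - s\<bar> powr (2 * \<alpha>)) \<and>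
     (\<forall>s\<in>{0..T}. \<forall>u\<in>{0..T}. \<forall>t\<in>{0..T}.
        x2 s t - x2 s u - x2 u t = tens (x u - x s) (x t - x u))"

text \<open>
  Rough paths are identified with the curves \<open>t \<mapsto> 1 + (x t - x 0) + x2 0 t\<close>. Only the values of
  a curve on \<open>[0,T]\<close> are relevant, here and in all sets of curves below.
\<close>

definition rough_paths ::
  "('a::real_normed_vector \<Rightarrow> 'a \<Rightarrow> 'b::real_normed_vector) \<Rightarrow> real \<Rightarrow> real \<Rightarrow>
   (real \<Rightarrow> 'a \<times> 'b) set" where
  "rough_paths tens T \<alpha> =
     {X. \<exists>x x2. is_rough_path tens T \<alpha> x x2 \<and> (\<forall>t\<in>{0..T}. X t = (x t - x 0, x2 0 t))}"

definition weakly_geometric ::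
  "('a::real_normed_vector \<Rightarrow> 'a \<Rightarrow> 'b::real_normed_vector) \<Rightarrow> real \<Rightarrow> real \<Rightarrow>
   (real \<Rightarrow> 'a \<times> 'b) set" where
  "weakly_geometric tens T \<alpha> = {X \<in> rough_paths tens T \<alpha>. \<forall>t\<in>{0..T}. X t \<in> G2 tens}"


section \<open>Canonical lifts\<close>

text \<open>
  The length of a curve on \<open>[s,t]\<close>, \<open>s \<le> t\<close>, with respect to a distance \<open>d\<close>. For
  \<open>d = dist\<close> this is the total variation.
\<close>

definition curve_length :: "('c \<Rightarrow> 'c \<Rightarrow> real) \<Rightarrow> (real \<Rightarrow> 'c) \<Rightarrow> real \<Rightarrow> real \<Rightarrow> ereal" where
  "curve_length d \<gamma> s t =
     (SUP \<D> \<in> {\<D>. \<D> division_of {s..t}}. ereal (\<Sum>K\<in>\<D>. d (\<gamma> (Inf K)) (\<gamma> (Sup K))))"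

definition bv_path :: "real \<Rightarrow> (real \<Rightarrow> 'a::real_normed_vector) \<Rightarrow> bool" where
  "bv_path T x \<longleftrightarrow> continuous_on {0..T} x \<and> curve_length dist x 0 T < \<infinity>"

text \<open>
  The Riemann--Stieltjes integral \<open>\<integral>\<^sub>s\<^sup>t f \<otimes> dg\<close>. The mesh condition is expressed by fineness
  with respect to a gauge of constant radius.
\<close>

definition has_stieltjes_integral ::
  "('a::real_normed_vector \<Rightarrow> 'a \<Rightarrow> 'b::real_normed_vector) \<Rightarrow>
   (real \<Rightarrow> 'a) \<Rightarrow> (real \<Rightarrow> 'a) \<Rightarrow> real \<Rightarrow> real \<Rightarrow> 'b \<Rightarrow> bool" where
  "has_stieltjes_integral tens f g s t I \<longleftrightarrow>
     (\<forall>\<epsilon>>0. \<exists>\<delta>>0. \<forall>\<D>. \<D> tagged_division_of {s..t} \<and> (\<lambda>\<xi>. ball \<xi> \<delta>) fine \<D> \<longrightarrow>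
        norm ((\<Sum>(\<xi>, K)\<in>\<D>. tens (f \<xi>) (g (Sup K) - g (Inf K))) - I) < \<epsilon>)"

definition stieltjes_integral ::
  "('a::real_normed_vector \<Rightarrow> 'a \<Rightarrow> 'b::real_normed_vector) \<Rightarrow>
   (real \<Rightarrow> 'a) \<Rightarrow> (real \<Rightarrow> 'a) \<Rightarrow> real \<Rightarrow> real \<Rightarrow> 'b" where
  "stieltjes_integral tens f g s t = (THE I. has_stieltjes_integral tens f g s t I)"

definition S2 ::
  "('a::real_normed_vector \<Rightarrow> 'a \<Rightarrow> 'b::real_normed_vector) \<Rightarrow> (real \<Rightarrow> 'a) \<Rightarrow>
   real \<Rightarrow> real \<Rightarrow> 'a \<times> 'b" where
  "S2 tens x s t = (x t - x s, stieltjes_integral tens (\<lambda>r. x r - x s) x s t)"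

text \<open>At the end points of \<open>[0,T]\<close> the derivatives are one-sided.\<close>

definition smooth_path :: "real \<Rightarrow> (real \<Rightarrow> 'a::real_normed_vector) \<Rightarrow> bool" where
  "smooth_path T x \<longleftrightarrow>
     (\<exists>D :: nat \<Rightarrow> real \<Rightarrow> 'a. (\<forall>t\<in>{0..T}. D 0 t = x t) \<and>
        (\<forall>n. \<forall>t\<in>{0..T}. (D n has_vector_derivative D (Suc n) t) (at t within {0..T})))"

definition geometric ::
  "('a::real_normed_vector \<Rightarrow> 'a \<Rightarrow> 'b::real_normed_vector) \<Rightarrow> real \<Rightarrow> real \<Rightarrow>
   (real \<Rightarrow> 'a \<times> 'b) set" where
  "geometric tens T \<alpha> =
     {X \<in> rough_paths tens T \<alpha>.
        \<forall>\<epsilon>>0. \<exists>x. smooth_path T x \<and> holder_dist tens T \<alpha> X (S2 tens x 0) < ereal \<epsilon>}"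


section \<open>The Carnot--Caratheodory metric\<close>

text \<open>
  The infimum is taken in the extended reals, where \<open>Inf {} = \<infinity>\<close>.
\<close>

definition cc_dist ::
  "('a::real_normed_vector \<Rightarrow> 'a \<Rightarrow> 'b::real_normed_vector) \<Rightarrow> real \<Rightarrow>
   'a \<times> 'b \<Rightarrow> 'a \<times> 'b \<Rightarrow> ereal" where
  "cc_dist tens T y z =
     (INF x \<in> {x. bv_path T x \<and> x 0 = 0 \<and> gmult tens (ginv tens y) z = S2 tens x 0 T}.
        curve_length dist x 0 T)"

definition Mcc ::
  "('a::real_normed_vector \<Rightarrow> 'a \<Rightarrow> 'b::real_normed_vector) \<Rightarrow> real \<Rightarrow> ('a \<times> 'b) set" where
  "Mcc tens T = {z \<in> G2 tens. cc_dist tens T gone z < \<infinity>}"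

text \<open>On \<^const>\<open>Mcc\<close> the metric is finite, and there the real-valued version is used.\<close>

definition cc_rdist ::
  "('a::real_normed_vector \<Rightarrow> 'a \<Rightarrow> 'b::real_normed_vector) \<Rightarrow> real \<Rightarrow>
   'a \<times> 'b \<Rightarrow> 'a \<times> 'b \<Rightarrow> real" where
  "cc_rdist tens T y z = real_of_ereal (cc_dist tens T y z)"

definition cc_continuous ::
  "('a::real_normed_vector \<Rightarrow> 'a \<Rightarrow> 'b::real_normed_vector) \<Rightarrow> real \<Rightarrow>
   (real \<Rightarrow> 'a \<times> 'b) set" where
  "cc_continuous tens T =
     {X. continuous_map (top_of_set {0..T})
           (Metric_space.mtopology (Mcc tens T) (cc_rdist tens T)) X}"

definition geodesic_space :: "'c set \<Rightarrow> ('c \<Rightarrow> 'c \<Rightarrow> real) \<Rightarrow> bool" where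
  "geodesic_space M d \<longleftrightarrow>
     Metric_space M d \<and>
     (\<forall>p\<in>M. \<forall>q\<in>M. \<exists>\<gamma> :: real \<Rightarrow> 'c. \<gamma> 0 = p \<and> \<gamma> 1 = q \<and> (\<forall>t\<in>{0..1}. \<gamma> t \<in> M) \<and>
        (\<forall>s t. 0 \<le> s \<and> s \<le> t \<and> t \<le> 1 \<longrightarrow>
           curve_length d \<gamma> s t = ereal (d (\<gamma> s) (\<gamma> t)) \<and>
           d (\<gamma> s) (\<gamma> t) = \<bar>t - s\<bar> * d (\<gamma> 0) (\<gamma> 1)))"


section \<open>Consistency of the definitions\<close>

lemma gmult_assoc:
  assumes "bilinear tens"
  shows "gmult tens (gmult tens p q) r = gmult tens p (gmult tens q r)"
  using assms by (simp add: gmult_def bilinear_ladd bilinear_radd)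

lemma gmult_gone:
  assumes "bilinear tens"
  shows "gmult tens gone p = p" "gmult tens p gone = p"
  using assms by (simp_all add: gmult_def gone_def bilinear_lzero bilinear_rzero)

lemma gmult_ginv:
  assumes "bilinear tens"
  shows "gmult tens (ginv tens p) p = gone" "gmult tens p (ginv tens p) = gone"
  using assms by (simp_all add: gmult_def ginv_def gone_def bilinear_lneg bilinear_rneg)

lemma real_linear_separates:
  fixes w :: "'w::real_vector"
  assumes "w \<noteq> 0"
  obtains f :: "'w \<Rightarrow> real" where "linear f" "f w = 1"
proof -
  have "independent {w}"
    using assms by (simp add: independent_insert)
  from linear_independent_extend[OF this, of "\<lambda>_. 1"] that show thesis
    by auto
qed

lemma algebraic_tensor_universal:
  fixes tens :: "'a::real_vector \<Rightarrow> 'a \<Rightarrow> 'b::real_vector"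
    and B :: "'a \<Rightarrow> 'a \<Rightarrow> 'w::real_vector"
  assumes tens: "algebraic_tensor tens" and B: "bilinear B"
  shows "\<exists>L. linear L \<and> (\<forall>x y. B x y = L (tens x y))"
proof -
  define S where "S = (\<lambda>p. tens (fst p) (snd p)) ` UNIV"
  obtain b where b: "b \<subseteq> S" "independent b" "S \<subseteq> span b"
    using maximal_independent_subset by blast
  have "\<exists>h. \<forall>v\<in>b. v = tens (fst (h v)) (snd (h v))"
  proof (intro bchoice ballI)
    fix v assume "v \<in> b"
    then obtain p where "v = tens (fst p) (snd p)" using b(1) unfolding S_def by blast
    then show "\<exists>p. v = tens (fst p) (snd p)" ..
  qed
  then obtain h where h: "\<And>v. v \<in> b \<Longrightarrow> v = tens (fst (h v)) (snd (h v))" by blast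
  obtain L :: "'b \<Rightarrow> 'w" where L: "linear L" "\<And>v. v \<in> b \<Longrightarrow> L v = B (fst (h v)) (snd (h v))"
    using linear_independent_extend[OF b(2), of "\<lambda>v. B (fst (h v)) (snd (h v))"] by blast
  have "B x y = L (tens x y)" for x y
  proof (rule ccontr)
    assume "B x y \<noteq> L (tens x y)"
    then obtain f :: "'w \<Rightarrow> real" where f: "linear f" "f (B x y - L (tens x y)) = 1"
      using real_linear_separates[of "B x y - L (tens x y)"] by auto
    have "bilinear (\<lambda>x y. f (B x y))"
      using B f(1) unfolding bilinear_def
      by (auto intro: linear_compose[unfolded o_def])
    then obtain M where M: "linear M" "\<And>x y. f (B x y) = M (tens x y)"
      using tens unfolding algebraic_tensor_def by blast
    have fL: "linear (\<lambda>v. f (L v))"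
      using L(1) f(1) by (auto intro: linear_compose[unfolded o_def])
    have "M v = f (L v)" if "v \<in> b" for v
      using h[OF that] L(2)[OF that] M(2) by metis
    moreover have "tens x y \<in> span b"
      using b(3) rangeI[of "\<lambda>p. tens (fst p) (snd p)" "(x, y)"] unfolding S_def by auto
    ultimately have "M (tens x y) = f (L (tens x y))"
      using linear_eq_on_span[OF M(1) fL] by blast
    then show False
      using f M(2) by (simp add: linear_diff)
  qed
  with L(1) show ?thesis by blast
qed

end

theory Submission
  imports Defs
begin

text \<open>
  A weakly geometric \<open>\<alpha>\<close>-rough path \<open>X\<close> is a curve in the group \<open>G2\<close> which is \<open>\<alpha>\<close>-Hoelder for the
  homogeneous norm. Geometric rough paths are weakly geometric because lifts of smooth paths stay
  in \<open>G2\<close> and \<open>G2\<close> is closed. All the rest follows from one statement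
  (\<open>smooth_lift_approximation\<close>): for \<open>\<beta> < \<alpha> < 1/2\<close>, the curve \<open>X\<close> is a limit of lifts of smooth
  paths for the \<open>\<beta>\<close>-Hoelder distance. Such paths have bounded variation. The smooth paths are found
  in two steps.

  First, \<open>X\<close> is averaged in logarithmic coordinates \<open>(x, a)\<close>, \<open>X = 1 + x + (a + 1/2 x \<otimes> x)\<close>, on a
  small time scale \<open>h\<close> (\<open>smoothing\<close>). The average is smooth. It solves a left invariant equation
  \<open>dY = Y \<otimes> (v + c) dt\<close> with a velocity \<open>v\<close> of the first level and an additional drift \<open>c\<close> of the
  second level, a finite combination of brackets \<open>u \<otimes> w - w \<otimes> u\<close>. Velocity and drift have the size
  that the Hoelder regularity of \<open>X\<close> predicts on the scale \<open>h\<close>, and \<open>Y\<close> stays at distance of order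
  \<open>h powr \<alpha>\<close> from \<open>X\<close>. Therefore \<open>Y\<close> is \<open>\<alpha>\<close>-Hoelder uniformly in \<open>h\<close>
  (\<open>shadowing_path_estimates\<close>), and it converges to \<open>X\<close> uniformly. Interpolation gives convergence
  for every exponent below \<open>\<alpha>\<close>.

  Second, the drift is generated by the path itself (\<open>area_drift_approximation\<close>): a small loop of
  diameter \<open>1/N\<close> in the plane of \<open>u\<close> and \<open>w\<close>, run with frequency \<open>N\<^sup>2\<close>, sweeps area at a rate of
  order one. The increments of the perturbed path converge to those of \<open>Y\<close> uniformly, and their
  distance on \<open>[s, t]\<close> is of order \<open>(t - s) powr (1/2)\<close> uniformly in \<open>N\<close>. As \<open>\<beta> < 1/2\<close>, interpolation
  applies again. The exponent 1/2 is the Hoelder regularity of the straight lines in the centre of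
  the group, which these oscillations follow.
\<close>


section \<open>The homogeneous norm and the group distance\<close>

locale tensor_group = bounded_bilinear tens
  for tens :: "'a::real_normed_vector \<Rightarrow> 'a \<Rightarrow> 'b::banach" +
  assumes norm_tens_le: "norm (tens x y) \<le> norm x * norm y"
begin

lemma bilinear_tens: "bilinear tens"
  unfolding bilinear_def
  by (blast intro: bounded_linear.linear bounded_linear_left bounded_linear_right)

lemmas tens_algebra =
  add_left add_right diff_left diff_right minus_left minus_right scaleR_left scaleR_right

lemma norm_tens_bound: "norm x \<le> r \<Longrightarrow> norm y \<le> q \<Longrightarrow> norm (tens x y) \<le> r * q"
  by (rule order_trans[OF norm_tens_le]) (auto intro!: mult_mono intro: order_trans[OF norm_ge_zero])

end

lemma gnorm_nonneg [simp]: "0 \<le> gnorm p"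
  by (simp add: gnorm_def le_max_iff_disj)

lemma gnorm_le_iff: "0 \<le> r \<Longrightarrow> gnorm p \<le> r \<longleftrightarrow> norm (fst p) \<le> r \<and> norm (snd p) \<le> r\<^sup>2"
  using real_sqrt_le_iff[of "norm (snd p)" "r\<^sup>2"] by (auto simp: gnorm_def)

lemma norm_fst_le_gnorm: "norm (fst p) \<le> gnorm p"
  and norm_snd_le_gnorm: "norm (snd p) \<le> (gnorm p)\<^sup>2"
  using gnorm_le_iff[of "gnorm p" p] by simp_all

lemma gnorm_gone [simp]: "gnorm gone = 0"
  by (simp add: gnorm_def gone_def)

lemma gnorm_le_sqrt:
  assumes "(norm (fst p))\<^sup>2 \<le> r" "norm (snd p) \<le> r"
  shows "gnorm p \<le> sqrt r"
  using assms by (auto simp: gnorm_def real_le_rsqrt)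

context tensor_group
begin

lemma gmult_inverse_simps [simp]:
  "gmult tens (ginv tens p) p = gone" "gmult tens p (ginv tens p) = gone"
  "gmult tens gone p = p" "gmult tens p gone = p"
  by (simp_all add: gmult_ginv gmult_gone bilinear_tens)

lemma ginv_gmult: "ginv tens (gmult tens p q) = gmult tens (ginv tens q) (ginv tens p)"
  by (simp add: ginv_def gmult_def tens_algebra)

lemma ginv_ginv [simp]: "ginv tens (ginv tens p) = p"
  by (simp add: ginv_def tens_algebra)

lemma ginv_gone [simp]: "ginv tens gone = gone"
  by (simp add: ginv_def gone_def zero_left)

lemma gmult_cancel_left [simp]:
  "gmult tens p (gmult tens (ginv tens p) q) = q"
  "gmult tens (ginv tens p) (gmult tens p q) = q"
  by (simp_all flip: gmult_assoc[OF bilinear_tens])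

lemma gnorm_gmult_le: "gnorm (gmult tens p q) \<le> gnorm p + gnorm q"
proof -
  have "norm (snd p + tens (fst p) (fst q) + snd q)
      \<le> (gnorm p)\<^sup>2 + gnorm p * gnorm q + (gnorm q)\<^sup>2"
    by (intro norm_triangle_mono norm_tens_bound norm_fst_le_gnorm norm_snd_le_gnorm)
  also have "\<dots> \<le> (gnorm p + gnorm q)\<^sup>2"
    by (simp add: power2_sum)
  finally show ?thesis
    by (subst gnorm_le_iff)
      (auto simp: gmult_def intro!: norm_triangle_mono norm_fst_le_gnorm)
qed

lemma gnorm_ginv_le: "gnorm (ginv tens p) \<le> 2 * gnorm p"
proof -
  have "norm (tens (fst p) (fst p) - snd p) \<le> gnorm p * gnorm p + (gnorm p)\<^sup>2"
    by (intro norm_triangle_le_diff add_mono norm_tens_bound norm_fst_le_gnorm norm_snd_le_gnorm)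
  then show ?thesis
    using norm_fst_le_gnorm[of p]
    by (subst gnorm_le_iff)
      (auto simp: ginv_def power_mult_distrib power2_eq_square
        intro: order_trans[OF _ mult_right_mono[of 1 2]] order_trans[OF _ mult_right_mono[of 2 4]])
qed

text \<open>
  Conjugation changes the second level by a commutator only, which is bilinear in the two first
  levels. Hence a small element stays small, but its size may grow to a square root.
\<close>

lemma gnorm_conjugate_le:
  assumes "gnorm w \<le> r" "gnorm p \<le> M"
  shows "gnorm (gmult tens (ginv tens p) (gmult tens w p)) \<le> sqrt (r\<^sup>2 + 2 * M * r)"
proof (rule gnorm_le_sqrt)
  have nn: "0 \<le> r" "0 \<le> M"
    using assms gnorm_nonneg by (meson order_trans)+
  have eq: "gmult tens (ginv tens p) (gmult tens w p)
      = (fst w, snd w + (tens (fst w) (fst p) - tens (fst p) (fst w)))"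
    by (simp add: gmult_def ginv_def tens_algebra)
  have w: "norm (fst w) \<le> r" "norm (snd w) \<le> r\<^sup>2" and p: "norm (fst p) \<le> M"
    using assms nn by (auto simp: gnorm_le_iff)
  show "(norm (fst (gmult tens (ginv tens p) (gmult tens w p))))\<^sup>2 \<le> r\<^sup>2 + 2 * M * r"
    using power_mono[OF w(1), of 2] nn by (simp add: eq add_increasing2)
  have "norm (snd w + (tens (fst w) (fst p) - tens (fst p) (fst w))) \<le> r\<^sup>2 + (r * M + M * r)"
    by (intro norm_triangle_mono norm_triangle_le_diff add_mono norm_tens_bound w p)
  then show "norm (snd (gmult tens (ginv tens p) (gmult tens w p))) \<le> r\<^sup>2 + 2 * M * r"
    by (simp add: eq algebra_simps)
qed

lemma gdist_nonneg [simp]: "0 \<le> gdist tens p q"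
  by (simp add: gdist_def)

lemma gdist_apply:
  "gdist tens p q = gnorm (fst q - fst p, snd q - snd p - tens (fst p) (fst q - fst p))"
  by (simp add: gdist_def gmult_def ginv_def tens_algebra algebra_simps)

lemma gdist_le_gnorm: "gdist tens p q \<le> 2 * gnorm p + gnorm q"
  using gnorm_gmult_le[of "ginv tens p" q] gnorm_ginv_le[of p] by (simp add: gdist_def)

lemma gdist_triangle: "gdist tens p r \<le> gdist tens p q + gdist tens q r"
  using gnorm_gmult_le[of "gmult tens (ginv tens p) q" "gmult tens (ginv tens q) r"]
  by (simp add: gdist_def gmult_assoc[OF bilinear_tens])

lemma gdist_commute_le: "gdist tens q p \<le> 2 * gdist tens p q"
  using gnorm_ginv_le[of "gmult tens (ginv tens p) q"] by (simp add: gdist_def ginv_gmult)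

lemma gdist_self [simp]: "gdist tens p p = 0"
  by (simp add: gdist_def)

lemma ginc_apply:
  "ginc tens X s t = (fst (X t) - fst (X s),
     snd (X t) - snd (X s) - tens (fst (X s)) (fst (X t) - fst (X s)))"
  by (simp add: ginc_def gmult_def ginv_def tens_algebra)

lemma ginc_swap: "ginc tens X t s = ginv tens (ginc tens X s t)"
  by (simp add: ginc_def ginv_gmult)

lemma ginc_gone: "X 0 = gone \<Longrightarrow> ginc tens X 0 t = X t"
  by (simp add: ginc_def)


section \<open>Hoelder distances\<close>

lemma holder_dist_le:
  assumes "\<And>s t. 0 \<le> s \<Longrightarrow> s < t \<Longrightarrow> t \<le> T \<Longrightarrow>
      gdist tens (ginc tens X s t) (ginc tens Y s t) \<le> K * (t - s) powr \<beta>"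
  shows "holder_dist tens T \<beta> X Y \<le> ereal K"
  unfolding holder_dist_def using assms by (auto intro!: SUP_least simp: divide_le_eq)

lemma gdist_le_holder_dist:
  assumes "holder_dist tens T \<beta> X Y \<le> ereal K" "0 \<le> s" "s < t" "t \<le> T"
  shows "gdist tens (ginc tens X s t) (ginc tens Y s t) \<le> K * (t - s) powr \<beta>"
proof -
  have "ereal (gdist tens (ginc tens X s t) (ginc tens Y s t) / \<bar>t - s\<bar> powr \<beta>)
      \<le> holder_dist tens T \<beta> X Y"
    unfolding holder_dist_def using assms by (auto intro!: SUP_upper2[where i = "(s, t)"])
  also note assms(1)
  finally show ?thesis
    using assms by (simp add: divide_le_eq)
qed

lemma holder_dist_nonneg:
  assumes "T > 0"
  shows "0 \<le> holder_dist tens T \<beta> X Y"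
  unfolding holder_dist_def using assms
  by (auto intro!: SUP_upper2[where i = "(0, T)"])

lemma holder_dist_triangle:
  assumes "holder_dist tens T \<beta> X Y \<le> ereal K" "holder_dist tens T \<beta> Y Z \<le> ereal L"
  shows "holder_dist tens T \<beta> X Z \<le> ereal (K + L)"
proof (rule holder_dist_le)
  fix s t :: real assume "0 \<le> s" "s < t" "t \<le> T"
  then show "gdist tens (ginc tens X s t) (ginc tens Z s t) \<le> (K + L) * (t - s) powr \<beta>"
    using order_trans[OF gdist_triangle add_mono[OF
        gdist_le_holder_dist[OF assms(1), of s t] gdist_le_holder_dist[OF assms(2), of s t]]]
    by (simp add: distrib_right)
qed

lemma holder_dist_commute_le:
  assumes "holder_dist tens T \<beta> X Y \<le> ereal K"
  shows "holder_dist tens T \<beta> Y X \<le> ereal (2 * K)"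
proof (rule holder_dist_le)
  fix s t :: real assume "0 \<le> s" "s < t" "t \<le> T"
  then show "gdist tens (ginc tens Y s t) (ginc tens X s t) \<le> 2 * K * (t - s) powr \<beta>"
    using order_trans[OF gdist_commute_le mult_left_mono[OF gdist_le_holder_dist[OF assms, of s t]]]
    by simp
qed

text \<open>
  Interpolation: the minimum of two quantities is at most any weighted geometric mean of them.
  So a bound of order \<open>\<gamma> > \<beta>\<close> together with uniform smallness gives smallness of order \<open>\<beta>\<close>.
\<close>

lemma holder_dist_interpolate:
  assumes "0 < \<beta>" "\<beta> < \<gamma>" "0 \<le> K"
    and holder: "\<And>s t. 0 \<le> s \<Longrightarrow> s < t \<Longrightarrow> t \<le> T \<Longrightarrow>
      gdist tens (ginc tens X s t) (ginc tens Y s t) \<le> K * (t - s) powr \<gamma>"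
    and unif: "\<And>s t. 0 \<le> s \<Longrightarrow> s < t \<Longrightarrow> t \<le> T \<Longrightarrow>
      gdist tens (ginc tens X s t) (ginc tens Y s t) \<le> \<eta>"
  shows "holder_dist tens T \<beta> X Y \<le> ereal (K powr (\<beta> / \<gamma>) * \<eta> powr (1 - \<beta> / \<gamma>))"
proof (rule holder_dist_le)
  fix s t :: real assume st: "0 \<le> s" "s < t" "t \<le> T"
  let ?d = "gdist tens (ginc tens X s t) (ginc tens Y s t)"
  have "?d = ?d powr (\<beta> / \<gamma>) * ?d powr (1 - \<beta> / \<gamma>)"
    by (simp flip: powr_add)
  also have "\<dots> \<le> (K * (t - s) powr \<gamma>) powr (\<beta> / \<gamma>) * \<eta> powr (1 - \<beta> / \<gamma>)"
    using assms st by (intro mult_mono powr_mono2) auto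
  also have "\<dots> = K powr (\<beta> / \<gamma>) * \<eta> powr (1 - \<beta> / \<gamma>) * (t - s) powr \<beta>"
    using assms st by (simp add: powr_mult powr_powr)
  finally show "?d \<le> K powr (\<beta> / \<gamma>) * \<eta> powr (1 - \<beta> / \<gamma>) * (t - s) powr \<beta>" .
qed


section \<open>Rough paths as Hoelder curves in the group\<close>

lemma powr_double: "(x :: real) powr (2 * a) = (x powr a)\<^sup>2"
  unfolding mult_2 powr_add power2_eq_square by (rule refl)

text \<open>
  Chen's relation says exactly that the pair \<open>(x t - x s, x2 s t)\<close> is the group increment of the
  curve, and the two analytic conditions say that this increment has size of order
  \<open>\<bar>t - s\<bar> powr \<alpha>\<close> in the homogeneous norm.
\<close>

lemma rough_paths_iff:
  assumes T: "0 \<le> T"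
  shows "X \<in> rough_paths tens T \<alpha> \<longleftrightarrow>
    X 0 = gone \<and> (\<exists>K. \<forall>s\<in>{0..T}. \<forall>t\<in>{0..T}. gnorm (ginc tens X s t) \<le> K * \<bar>t - s\<bar> powr \<alpha>)"
proof
  assume "X \<in> rough_paths tens T \<alpha>"
  then obtain x x2 where rp: "is_rough_path tens T \<alpha> x x2"
    and X: "\<And>t. t \<in> {0..T} \<Longrightarrow> X t = (x t - x 0, x2 0 t)"
    by (auto simp: rough_paths_def)
  obtain A B where A: "\<And>s t. s \<in> {0..T} \<Longrightarrow> t \<in> {0..T} \<Longrightarrow> norm (x t - x s) \<le> A * \<bar>t - s\<bar> powr \<alpha>"
    and B: "\<And>s t. s \<in> {0..T} \<Longrightarrow> t \<in> {0..T} \<Longrightarrow> norm (x2 s t) \<le> B * \<bar>t - s\<bar> powr (2 * \<alpha>)"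
    and chen: "\<And>s u t. s \<in> {0..T} \<Longrightarrow> u \<in> {0..T} \<Longrightarrow> t \<in> {0..T} \<Longrightarrow>
        x2 s t - x2 s u - x2 u t = tens (x u - x s) (x t - x u)"
    using rp unfolding is_rough_path_def by blast
  have "X 0 = gone"
    using T X[of 0] chen[of 0 0 0] by (simp add: gone_def zero_left)
  moreover have "gnorm (ginc tens X s t) \<le> (\<bar>A\<bar> + sqrt \<bar>B\<bar>) * \<bar>t - s\<bar> powr \<alpha>"
    if st: "s \<in> {0..T}" "t \<in> {0..T}" for s t
  proof -
    have eq: "ginc tens X s t = (x t - x s, x2 s t)"
      using chen[of 0 s t] st T X[of s] X[of t] by (simp add: ginc_apply algebra_simps)
    let ?r = "\<bar>t - s\<bar> powr \<alpha>"
    have "norm (x t - x s) \<le> \<bar>A\<bar> * ?r"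
      by (rule order_trans[OF A[OF st]]) (simp add: mult_right_mono)
    moreover have "norm (x2 s t) \<le> \<bar>B\<bar> * ?r\<^sup>2"
      by (rule order_trans[OF B[OF st]])
        (simp add: mult_right_mono powr_double)
    then have "sqrt (norm (x2 s t)) \<le> sqrt (\<bar>B\<bar> * ?r\<^sup>2)"
      by (rule real_sqrt_le_mono)
    then have "sqrt (norm (x2 s t)) \<le> sqrt \<bar>B\<bar> * ?r"
      by (simp add: real_sqrt_mult)
    ultimately show ?thesis
      by (simp add: eq gnorm_def distrib_right add_increasing add_increasing2)
  qed
  ultimately show "X 0 = gone \<and>
      (\<exists>K. \<forall>s\<in>{0..T}. \<forall>t\<in>{0..T}. gnorm (ginc tens X s t) \<le> K * \<bar>t - s\<bar> powr \<alpha>)"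
    by blast
next
  assume "X 0 = gone \<and>
      (\<exists>K. \<forall>s\<in>{0..T}. \<forall>t\<in>{0..T}. gnorm (ginc tens X s t) \<le> K * \<bar>t - s\<bar> powr \<alpha>)"
  then obtain K where X0: "X 0 = gone"
    and K: "\<And>s t. s \<in> {0..T} \<Longrightarrow> t \<in> {0..T} \<Longrightarrow> gnorm (ginc tens X s t) \<le> K * \<bar>t - s\<bar> powr \<alpha>"
    by blast
  define x where "x t = fst (X t)" for t
  define x2 where "x2 s t = snd (ginc tens X s t)" for s t
  have "norm (x t - x s) \<le> K * \<bar>t - s\<bar> powr \<alpha>" if "s \<in> {0..T}" "t \<in> {0..T}" for s t
    using norm_fst_le_gnorm[of "ginc tens X s t"] K[OF that] by (simp add: x_def ginc_apply)
  moreover have "norm (x2 s t) \<le> K\<^sup>2 * \<bar>t - s\<bar> powr (2 * \<alpha>)"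
    if "s \<in> {0..T}" "t \<in> {0..T}" for s t
  proof -
    have "norm (x2 s t) \<le> (gnorm (ginc tens X s t))\<^sup>2"
      unfolding x2_def by (rule norm_snd_le_gnorm)
    also have "\<dots> \<le> (K * \<bar>t - s\<bar> powr \<alpha>)\<^sup>2"
      by (intro power_mono K that gnorm_nonneg)
    finally show ?thesis
      by (simp add: power_mult_distrib powr_double)
  qed
  moreover have "x2 s t - x2 s u - x2 u t = tens (x u - x s) (x t - x u)" for s u t
    by (simp add: x2_def x_def ginc_apply tens_algebra)
  ultimately have "is_rough_path tens T \<alpha> x x2"
    unfolding is_rough_path_def by blast
  moreover have "X t = (x t - x 0, x2 0 t)" for t
    using X0 by (simp add: x_def x2_def ginc_gone) (simp add: gone_def)
  ultimately show "X \<in> rough_paths tens T \<alpha>"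
    unfolding rough_paths_def by blast
qed

text \<open>
  Exchanging the end points inverts the increment, which at most doubles the homogeneous norm.
\<close>

lemma rough_pathsI:
  assumes "0 \<le> T" "X 0 = gone" "0 \<le> K"
    and "\<And>s t. 0 \<le> s \<Longrightarrow> s \<le> t \<Longrightarrow> t \<le> T \<Longrightarrow> gnorm (ginc tens X s t) \<le> K * (t - s) powr \<alpha>"
  shows "X \<in> rough_paths tens T \<alpha>"
proof -
  have "gnorm (ginc tens X s t) \<le> 2 * K * \<bar>t - s\<bar> powr \<alpha>"
    if "s \<in> {0..T}" "t \<in> {0..T}" for s t
  proof (cases "s \<le> t")
    case True
    then have "gnorm (ginc tens X s t) \<le> K * \<bar>t - s\<bar> powr \<alpha>"
      using assms(4)[of s t] that by simp
    also have "\<dots> \<le> 2 * K * \<bar>t - s\<bar> powr \<alpha>"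
      using assms(3) by (intro mult_right_mono) auto
    finally show ?thesis .
  next
    case False
    then have "gnorm (ginc tens X t s) \<le> K * \<bar>t - s\<bar> powr \<alpha>"
      using assms(4)[of t s] that by (simp add: abs_minus_commute)
    then show ?thesis
      using gnorm_ginv_le[of "ginc tens X t s"] ginc_swap[of X s t] by simp
  qed
  then show ?thesis
    using rough_paths_iff[OF assms(1)] assms(2) by blast
qed

lemma rough_paths_mono:
  assumes "0 \<le> T" "\<beta> \<le> \<alpha>" "X \<in> rough_paths tens T \<alpha>"
  shows "X \<in> rough_paths tens T \<beta>"
proof -
  obtain K where X0: "X 0 = gone"
    and K: "\<And>s t. s \<in> {0..T} \<Longrightarrow> t \<in> {0..T} \<Longrightarrow> gnorm (ginc tens X s t) \<le> K * \<bar>t - s\<bar> powr \<alpha>"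
    using assms(3) rough_paths_iff[OF assms(1)] by blast
  have "gnorm (ginc tens X s t) \<le> \<bar>K\<bar> * T powr (\<alpha> - \<beta>) * (t - s) powr \<beta>"
    if "0 \<le> s" "s \<le> t" "t \<le> T" for s t
  proof -
    have "gnorm (ginc tens X s t) \<le> K * (t - s) powr \<alpha>"
      using K[of s t] that by simp
    also have "\<dots> \<le> \<bar>K\<bar> * (t - s) powr \<alpha>"
      by (simp add: mult_right_mono)
    also have "(t - s) powr \<alpha> = (t - s) powr (\<alpha> - \<beta>) * (t - s) powr \<beta>"
      by (simp flip: powr_add)
    also have "\<dots> \<le> T powr (\<alpha> - \<beta>) * (t - s) powr \<beta>"
      using that assms(2) by (intro mult_right_mono powr_mono2) auto
    finally show ?thesis
      by (simp add: mult_left_mono mult.assoc)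
  qed
  then show ?thesis
    using X0 assms(1) by (intro rough_pathsI[where K = "\<bar>K\<bar> * T powr (\<alpha> - \<beta>)"]) auto
qed

end

section \<open>Group valued paths with a given velocity and drift\<close>

lemma increment_le_derivative_bound:
  fixes F :: "real \<Rightarrow> 'c::real_normed_vector"
  assumes "s \<le> t"
    and "\<And>r. r \<in> {s..t} \<Longrightarrow> (F has_vector_derivative F' r) (at r within {s..t})"
    and "\<And>r. r \<in> {s..t} \<Longrightarrow> norm (F' r) \<le> B"
  shows "norm (F t - F s) \<le> B * (t - s)"
proof -
  have "norm (F t - F s) \<le> B * norm (t - s)"
  proof (rule differentiable_bound[where S = "{s..t}"])
    fix r assume r: "r \<in> {s..t}"
    show "(F has_derivative (\<lambda>h. h *\<^sub>R F' r)) (at r within {s..t})"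
      using assms(2)[OF r] by (simp add: has_vector_derivative_def)
    show "onorm (\<lambda>h. h *\<^sub>R F' r) \<le> B"
      using assms(3)[OF r] by (intro onorm_le) (simp add: mult.commute[of B] mult_left_mono)
  qed (use assms(1) in auto)
  then show ?thesis
    using assms(1) by simp
qed

lemma continuous_on_interval_bounded:
  fixes f :: "real \<Rightarrow> 'c::real_normed_vector"
  assumes "continuous_on {s..t} f"
  shows "\<exists>b. \<forall>r\<in>{s..t}. norm (f r) \<le> b"
proof -
  have "bounded (f ` {s..t})"
    by (intro compact_imp_bounded compact_continuous_image assms compact_Icc)
  then show ?thesis
    by (simp add: bounded_iff)
qed

text \<open>Riemann sums of \<open>f\<close> are linear combinations of values of \<open>f\<close>.\<close>

lemma has_integral_closed_subspace:
  fixes f :: "real \<Rightarrow> 'c::real_normed_vector"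
  assumes int: "(f has_integral I) {s..t}" and f: "\<And>r. r \<in> {s..t} \<Longrightarrow> f r \<in> S"
    and S: "subspace S" "closed S"
  shows "I \<in> S"
proof -
  have "\<exists>y\<in>S. dist y I < e" if "e > 0" for e
  proof -
    from int that obtain g where g: "gauge g"
      and close: "\<And>\<D>. \<D> tagged_division_of {s..t} \<Longrightarrow> g fine \<D> \<Longrightarrow>
        norm ((\<Sum>(x, K)\<in>\<D>. measure lborel K *\<^sub>R f x) - I) < e"
      unfolding has_integral_real by metis
    obtain \<D> where \<D>: "\<D> tagged_division_of {s..t}" "g fine \<D>"
      using fine_division_exists_real[OF g] .
    have "(case z of (x, K) \<Rightarrow> measure lborel K *\<^sub>R f x) \<in> S" if "z \<in> \<D>" for z
    proof -
      obtain x K where z: "z = (x, K)" by (cases z)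
      have "x \<in> {s..t}"
        using tag_in_interval[OF \<D>(1)[folded box_real(2)]] that z by simp
      then show ?thesis
        by (simp add: z subspace_scale[OF S(1)] f)
    qed
    then have "(\<Sum>(x, K)\<in>\<D>. measure lborel K *\<^sub>R f x) \<in> S"
      by (rule subspace_sum[OF S(1)])
    then show ?thesis
      using close[OF \<D>] by (intro bexI) (simp_all add: dist_norm)
  qed
  then have "I \<in> closure S"
    by (simp add: closure_approachable)
  then show ?thesis
    using S(2) by simp
qed

lemma subspace_closure:
  fixes S :: "'c::real_normed_vector set"
  assumes "subspace S"
  shows "subspace (closure S)"
proof (rule subspaceI)
  show "0 \<in> closure S"
    using subspace_0[OF assms] closure_subset by blast
next
  fix x y assume "x \<in> closure S" "y \<in> closure S"
  then obtain f g where "\<And>n. f n \<in> S" "f \<longlonglongrightarrow> x" "\<And>n. g n \<in> S" "g \<longlonglongrightarrow> y"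
    unfolding closure_sequential by metis
  then show "x + y \<in> closure S"
    unfolding closure_sequential
    by (intro exI[of _ "\<lambda>n. f n + g n"] conjI allI subspace_add[OF assms] tendsto_add)
next
  fix c x assume "x \<in> closure S"
  then obtain f where "\<And>n. f n \<in> S" "f \<longlonglongrightarrow> x"
    unfolding closure_sequential by metis
  then show "c *\<^sub>R x \<in> closure S"
    unfolding closure_sequential
    by (intro exI[of _ "\<lambda>n. c *\<^sub>R f n"] conjI allI subspace_scale[OF assms] tendsto_intros)
qed

context tensor_group
begin

text \<open>
  The curve \<open>Z\<close> solves the left invariant equation \<open>dZ = Z \<otimes> (v + c) dt\<close> in the group: its first
  level has velocity \<open>v\<close>, and \<open>c\<close> is a drift of the second level on top of the iterated integral.
  For \<open>c = 0\<close> these are the lifts of paths with velocity \<open>v\<close>.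
\<close>

definition driven :: "real \<Rightarrow> (real \<Rightarrow> 'a \<times> 'b) \<Rightarrow> (real \<Rightarrow> 'a) \<Rightarrow> (real \<Rightarrow> 'b) \<Rightarrow> bool" where
  "driven T Z v c \<longleftrightarrow> (\<forall>t\<in>{0..T}.
     ((\<lambda>t. fst (Z t)) has_vector_derivative v t) (at t within {0..T}) \<and>
     ((\<lambda>t. snd (Z t)) has_vector_derivative tens (fst (Z t)) (v t) + c t) (at t within {0..T}))"

lemma driven_fst:
  "driven T Z v c \<Longrightarrow> 0 \<le> s \<Longrightarrow> t \<le> T \<Longrightarrow> r \<in> {s..t} \<Longrightarrow>
    ((\<lambda>t. fst (Z t)) has_vector_derivative v r) (at r within {s..t})"
  unfolding driven_def by (rule has_vector_derivative_within_subset[of _ _ _ "{0..T}"]) auto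

lemma driven_snd:
  "driven T Z v c \<Longrightarrow> 0 \<le> s \<Longrightarrow> t \<le> T \<Longrightarrow> r \<in> {s..t} \<Longrightarrow>
    ((\<lambda>t. snd (Z t)) has_vector_derivative tens (fst (Z r)) (v r) + c r) (at r within {s..t})"
  unfolding driven_def by (rule has_vector_derivative_within_subset[of _ _ _ "{0..T}"]) auto

lemma tens_const_left_derivative:
  "(f has_vector_derivative f') F \<Longrightarrow> ((\<lambda>r. tens a (f r)) has_vector_derivative tens a f') F"
  by (rule bounded_linear.has_vector_derivative[OF bounded_linear_right])

text \<open>
  The equation is left invariant, so the increment from a fixed time \<open>s\<close> solves it again, now
  starting at the identity.
\<close>

lemma driven_ginc_snd:
  assumes "driven T Z v c" "0 \<le> s" "t \<le> T" "r \<in> {s..t}"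
  shows "((\<lambda>r. snd (ginc tens Z s r)) has_vector_derivative
      tens (fst (Z r) - fst (Z s)) (v r) + c r) (at r within {s..t})"
  unfolding ginc_apply snd_conv
  by (rule has_vector_derivative_eq_rhs)
    (rule derivative_intros tens_const_left_derivative driven_fst[OF assms]
      driven_snd[OF assms] | simp add: tens_algebra)+

lemma driven_gnorm_ginc_le:
  assumes Z: "driven T Z v c" and st: "0 \<le> s" "s \<le> t" "t \<le> T"
    and v: "\<And>r. r \<in> {0..T} \<Longrightarrow> norm (v r) \<le> V"
    and c: "\<And>r. r \<in> {0..T} \<Longrightarrow> norm (c r) \<le> W"
  shows "gnorm (ginc tens Z s t) \<le> sqrt ((V * (t - s))\<^sup>2 + W * (t - s))"
proof -
  have sub: "r \<in> {0..T}" if "r \<in> {s..t}" for r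
    using that st by auto
  have "norm (v s) \<le> V" "norm (c s) \<le> W"
    using v c st by auto
  then have V: "0 \<le> V" and W: "0 \<le> W"
    by (auto intro: order_trans[OF norm_ge_zero])
  have fst_le: "norm (fst (Z r) - fst (Z s)) \<le> V * (r - s)" if "r \<in> {s..t}" for r
    using that st by (intro increment_le_derivative_bound[where F' = v])
      (auto intro!: v driven_fst[OF Z])
  have "norm (snd (ginc tens Z s t) - snd (ginc tens Z s s)) \<le> (V * (t - s) * V + W) * (t - s)"
  proof (rule increment_le_derivative_bound)
    fix r assume r: "r \<in> {s..t}"
    then show "((\<lambda>r. snd (ginc tens Z s r)) has_vector_derivative
        tens (fst (Z r) - fst (Z s)) (v r) + c r) (at r within {s..t})"
      by (intro driven_ginc_snd[OF Z] st)
    have "norm (fst (Z r) - fst (Z s)) \<le> V * (t - s)"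
      using r V by (intro order_trans[OF fst_le[OF r]] mult_left_mono) auto
    then show "norm (tens (fst (Z r) - fst (Z s)) (v r) + c r) \<le> V * (t - s) * V + W"
      by (intro norm_triangle_mono norm_tens_bound v c sub[OF r])
  qed (rule st)
  then have "norm (snd (ginc tens Z s t)) \<le> (V * (t - s))\<^sup>2 + W * (t - s)"
    by (simp add: ginc_apply zero_right algebra_simps power2_eq_square)
  moreover have "(norm (fst (ginc tens Z s t)))\<^sup>2 \<le> (V * (t - s))\<^sup>2"
    using fst_le[of t] st by (intro power_mono) (auto simp: ginc_apply)
  ultimately show ?thesis
    using W st by (intro gnorm_le_sqrt) (auto intro: order_trans)
qed

lemma driven_ginc_unique:
  assumes Z: "driven T Z v c" and W: "driven T W v c" and st: "0 \<le> s" "s \<le> t" "t \<le> T"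
  shows "ginc tens Z s t = ginc tens W s t"
proof -
  have fst_eq: "fst (Z r) - fst (Z s) = fst (W r) - fst (W s)" if r: "r \<in> {s..t}" for r
  proof -
    have "norm ((fst (Z r) - fst (W r)) - (fst (Z s) - fst (W s))) \<le> 0 * (r - s)"
    proof (rule increment_le_derivative_bound)
      fix q assume "q \<in> {s..r}"
      then show "((\<lambda>r. fst (Z r) - fst (W r)) has_vector_derivative v q - v q) (at q within {s..r})"
        using st r by (intro has_vector_derivative_diff driven_fst[OF Z] driven_fst[OF W]) auto
    qed (use r in auto)
    then show ?thesis
      by (simp add: algebra_simps)
  qed
  have "norm ((snd (ginc tens Z s t) - snd (ginc tens W s t))
      - (snd (ginc tens Z s s) - snd (ginc tens W s s))) \<le> 0 * (t - s)"
  proof (rule increment_le_derivative_bound)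
    fix r assume r: "r \<in> {s..t}"
    show "((\<lambda>r. snd (ginc tens Z s r) - snd (ginc tens W s r)) has_vector_derivative
        (tens (fst (Z r) - fst (Z s)) (v r) + c r) - (tens (fst (W r) - fst (W s)) (v r) + c r))
        (at r within {s..t})"
      by (intro has_vector_derivative_diff driven_ginc_snd[OF Z] driven_ginc_snd[OF W] st r)
  qed (use st fst_eq in auto)
  then show ?thesis
    using fst_eq[of t] st by (simp add: ginc_apply zero_right)
qed

lemma driven_exists:
  assumes y: "\<And>t. t \<in> {0..T} \<Longrightarrow> (y has_vector_derivative v t) (at t within {0..T})"
    and v: "continuous_on {0..T} v" and c: "continuous_on {0..T} c"
  obtains Z where "driven T Z v c" "\<And>t. fst (Z t) = y t" "snd (Z 0) = 0"
proof
  have "continuous_on {0..T} y"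
    using y by (meson continuous_on_eq_continuous_within has_vector_derivative_continuous)
  then have "continuous_on {0..T} (\<lambda>r. tens (y r) (v r) + c r)"
    by (intro continuous_intros continuous_on v c)
  from integral_has_vector_derivative[OF this]
  show "driven T (\<lambda>t. (y t, integral {0..t} (\<lambda>r. tens (y r) (v r) + c r))) v c"
    using y by (simp add: driven_def)
qed auto


section \<open>Paths in the step-2 free group\<close>

abbreviation bracket :: "'a \<Rightarrow> 'a \<Rightarrow> 'b" where
  "bracket x y \<equiv> tens x y - tens y x"

abbreviation antisymmetric :: "'b set" where
  "antisymmetric \<equiv> span {tens x y - tens y x | x y. True}"

lemma bracket_in_antisymmetric: "bracket x y \<in> antisymmetric"
  by (rule span_base) blast

lemma subspace_closure_antisymmetric: "subspace (closure antisymmetric)"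
  by (intro subspace_closure subspace_span)

lemma G2_iff: "p \<in> G2 tens \<longleftrightarrow> snd p - (1 / 2) *\<^sub>R tens (fst p) (fst p) \<in> closure antisymmetric"
proof -
  have "p \<in> G2 tens \<longleftrightarrow> (\<exists>q. snd q \<in> closure antisymmetric \<and> p = gexp tens q)"
    by (auto simp: G2_def P2_def closure_Times)
  also have "\<dots> \<longleftrightarrow> snd p - (1 / 2) *\<^sub>R tens (fst p) (fst p) \<in> closure antisymmetric"
  proof
    assume "snd p - (1 / 2) *\<^sub>R tens (fst p) (fst p) \<in> closure antisymmetric"
    then show "\<exists>q. snd q \<in> closure antisymmetric \<and> p = gexp tens q"
      by (intro exI[of _ "(fst p, snd p - (1 / 2) *\<^sub>R tens (fst p) (fst p))"])
        (simp add: gexp_def)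
  qed (auto simp: gexp_def)
  finally show ?thesis .
qed

text \<open>
  The derivative of the antisymmetric part \<open>snd Z - 1/2 (fst Z \<otimes> fst Z)\<close> of a driven path is half a
  bracket plus the drift. So its increments are integrals of antisymmetric tensors.
\<close>

lemma driven_in_G2:
  assumes Z: "driven T Z v c" and t: "t \<in> {0..T}" and Z0: "Z 0 \<in> G2 tens"
    and c: "\<And>r. r \<in> {0..T} \<Longrightarrow> c r \<in> closure antisymmetric"
  shows "Z t \<in> G2 tens"
proof -
  define a where "a r = snd (Z r) - (1 / 2) *\<^sub>R tens (fst (Z r)) (fst (Z r))" for r
  have "((\<lambda>r. (1 / 2) *\<^sub>R bracket (fst (Z r)) (v r) + c r) has_integral a t - a 0) {0..t}"
  proof (rule fundamental_theorem_of_calculus)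
    fix r assume r: "r \<in> {0..t}"
    have z: "((\<lambda>t. fst (Z t)) has_vector_derivative v r) (at r within {0..t})"
      using t r by (intro driven_fst[OF Z]) auto
    have "(a has_vector_derivative tens (fst (Z r)) (v r) + c r
        - (1 / 2) *\<^sub>R (tens (fst (Z r)) (v r) + tens (v r) (fst (Z r)))) (at r within {0..t})"
      unfolding a_def using t r
      by (intro has_vector_derivative_diff driven_snd[OF Z] 
          bounded_linear.has_vector_derivative[OF bounded_linear_scaleR_right] has_vector_derivative[OF z z]) auto
    then show "(a has_vector_derivative (1 / 2) *\<^sub>R bracket (fst (Z r)) (v r) + c r)
        (at r within {0..t})"
    proof (rule has_vector_derivative_eq_rhs)
      have "tens (fst (Z r)) (v r)
          = (1 / 2) *\<^sub>R tens (fst (Z r)) (v r) + (1 / 2) *\<^sub>R tens (fst (Z r)) (v r)"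
        by (simp flip: scaleR_add_left)
      then show "tens (fst (Z r)) (v r) + c r
          - (1 / 2) *\<^sub>R (tens (fst (Z r)) (v r) + tens (v r) (fst (Z r)))
          = (1 / 2) *\<^sub>R bracket (fst (Z r)) (v r) + c r"
        by (simp add: algebra_simps)
    qed
  qed (use t in auto)
  then have "a t - a 0 \<in> closure antisymmetric"
  proof (rule has_integral_closed_subspace)
    fix r assume "r \<in> {0..t}"
    then show "(1 / 2) *\<^sub>R bracket (fst (Z r)) (v r) + c r \<in> closure antisymmetric"
      using t by (intro subspace_add subspace_scale subspace_closure_antisymmetric c
          subsetD[OF closure_subset bracket_in_antisymmetric]) auto
  qed (rule subspace_closure_antisymmetric closed_closure)+
  moreover have "a 0 \<in> closure antisymmetric"
    using Z0 by (simp add: G2_iff a_def)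
  ultimately have "a t \<in> closure antisymmetric"
    using subspace_add[OF subspace_closure_antisymmetric, of "a t - a 0" "a 0"] by simp
  then show ?thesis
    by (simp add: G2_iff a_def)
qed

lemma gone_in_G2: "gone \<in> G2 tens"
  using subspace_0[OF subspace_closure_antisymmetric] by (simp add: G2_iff gone_def zero_left)


section \<open>Lifts of smooth paths\<close>

lemma has_stieltjes_integral_unique:
  assumes I: "has_stieltjes_integral tens f g s t I" and J: "has_stieltjes_integral tens f g s t J"
  shows "I = J"
proof (rule ccontr)
  assume "I \<noteq> J"
  then have e: "norm (I - J) / 2 > 0" by simp
  define S where "S \<D> = (\<Sum>(\<xi>, K)\<in>\<D>. tens (f \<xi>) (g (Sup K) - g (Inf K)))" for \<D>
  obtain d1 where d1: "d1 > 0" "\<And>\<D>. \<D> tagged_division_of {s..t} \<Longrightarrow> (\<lambda>\<xi>. ball \<xi> d1) fine \<D> \<Longrightarrow>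
      norm (S \<D> - I) < norm (I - J) / 2"
    using I e unfolding has_stieltjes_integral_def S_def[symmetric] by metis
  obtain d2 where d2: "d2 > 0" "\<And>\<D>. \<D> tagged_division_of {s..t} \<Longrightarrow> (\<lambda>\<xi>. ball \<xi> d2) fine \<D> \<Longrightarrow>
      norm (S \<D> - J) < norm (I - J) / 2"
    using J e unfolding has_stieltjes_integral_def S_def[symmetric] by metis
  have "gauge (\<lambda>\<xi>::real. ball \<xi> d1 \<inter> ball \<xi> d2)"
    using d1(1) d2(1) by (intro gauge_Int gauge_ball)
  then obtain \<D> where \<D>: "\<D> tagged_division_of {s..t}" "(\<lambda>\<xi>. ball \<xi> d1 \<inter> ball \<xi> d2) fine \<D>"
    by (rule fine_division_exists_real)
  then have "(\<lambda>\<xi>. ball \<xi> d1) fine \<D>" "(\<lambda>\<xi>. ball \<xi> d2) fine \<D>"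
    by (simp_all add: fine_Int)
  with \<D>(1) have "norm (S \<D> - I) < norm (I - J) / 2" "norm (S \<D> - J) < norm (I - J) / 2"
    by (blast intro: d1(2), blast intro: d2(2))
  then show False
    using norm_triangle_ineq4[of "S \<D> - J" "S \<D> - I"] by simp
qed

text \<open>
  On an interval \<open>K\<close> with tag \<open>\<xi>\<close>, the error of the Riemann sum is the increment of
  \<open>r \<mapsto> f \<xi> \<otimes> g r - F r\<close>, whose derivative \<open>(f \<xi> - f r) \<otimes> g' r\<close> is uniformly small
  when \<open>K\<close> is short. The increments of \<open>F\<close> telescope.
\<close>

lemma has_stieltjes_integralI:
  assumes st: "s \<le> t" and f: "continuous_on {s..t} f"
    and g: "\<And>r. r \<in> {s..t} \<Longrightarrow> (g has_vector_derivative g' r) (at r within {s..t})"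
    and g': "\<And>r. r \<in> {s..t} \<Longrightarrow> norm (g' r) \<le> V"
    and F: "\<And>r. r \<in> {s..t} \<Longrightarrow> (F has_vector_derivative tens (f r) (g' r)) (at r within {s..t})"
  shows "has_stieltjes_integral tens f g s t (F t - F s)"
  unfolding has_stieltjes_integral_def
proof (intro allI impI)
  fix e :: real assume e: "e > 0"
  have V: "0 \<le> V"
    using g'[of s] st by (auto intro: order_trans[OF norm_ge_zero])
  define \<eta> where "\<eta> = e / ((V + 1) * (t - s + 1))"
  have \<eta>: "\<eta> > 0"
    using e V st by (simp add: \<eta>_def)
  have "uniformly_continuous_on {s..t} f"
    by (intro compact_uniformly_continuous f) auto
  then obtain d where d: "d > 0"
    "\<And>r q. r \<in> {s..t} \<Longrightarrow> q \<in> {s..t} \<Longrightarrow> dist r q < d \<Longrightarrow> dist (f r) (f q) < \<eta>"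
    unfolding uniformly_continuous_on_def using \<eta> by metis
  show "\<exists>\<delta>>0. \<forall>\<D>. \<D> tagged_division_of {s..t} \<and> (\<lambda>\<xi>. ball \<xi> \<delta>) fine \<D> \<longrightarrow>
      norm ((\<Sum>(\<xi>, K)\<in>\<D>. tens (f \<xi>) (g (Sup K) - g (Inf K))) - (F t - F s)) < e"
  proof (intro exI[of _ d] conjI d(1) allI impI)
    fix \<D> assume "\<D> tagged_division_of {s..t} \<and> (\<lambda>\<xi>. ball \<xi> d) fine \<D>"
    then have \<D>: "\<D> tagged_division_of {s..t}" and fine: "(\<lambda>\<xi>. ball \<xi> d) fine \<D>"
      by auto
    have cell: "norm (tens (f \<xi>) (g (Sup K) - g (Inf K)) - (F (Sup K) - F (Inf K)))
        \<le> \<eta> * V * measure lborel K" if K: "(\<xi>, K) \<in> \<D>" for \<xi> K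
    proof -
      obtain a b where ab: "K = {a..b}"
        using tagged_division_ofD(4)[OF \<D> K] by auto
      have "\<xi> \<in> K" "K \<subseteq> {s..t}"
        using tagged_division_ofD(2,3)[OF \<D> K] by auto
      have "K \<subseteq> ball \<xi> d"
        using fine K by (auto simp: fine_def)
      have "a \<le> b"
        using \<open>\<xi> \<in> K\<close> ab by auto
      have "norm ((tens (f \<xi>) (g b) - F b) - (tens (f \<xi>) (g a) - F a)) \<le> \<eta> * V * (b - a)"
      proof (rule increment_le_derivative_bound[OF \<open>a \<le> b\<close>])
        fix r assume r: "r \<in> {a..b}"
        then have r': "r \<in> {s..t}"
          using \<open>K \<subseteq> {s..t}\<close> ab by auto
        show "((\<lambda>r. tens (f \<xi>) (g r) - F r) has_vector_derivative
            tens (f \<xi>) (g' r) - tens (f r) (g' r)) (at r within {a..b})"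
          using \<open>K \<subseteq> {s..t}\<close> unfolding ab
          by (intro has_vector_derivative_diff tens_const_left_derivative
              has_vector_derivative_within_subset[OF g[OF r']]
              has_vector_derivative_within_subset[OF F[OF r']])
        have "norm (f \<xi> - f r) \<le> \<eta>"
          using d(2)[of \<xi> r] r r' \<open>\<xi> \<in> K\<close> \<open>K \<subseteq> {s..t}\<close> \<open>K \<subseteq> ball \<xi> d\<close> ab
          by (auto simp: dist_norm subset_iff intro: less_imp_le)
        then show "norm (tens (f \<xi>) (g' r) - tens (f r) (g' r)) \<le> \<eta> * V"
          unfolding diff_left[symmetric] by (intro norm_tens_bound g' r')
      qed
      moreover have "tens (f \<xi>) (g b - g a) - (F b - F a)
          = (tens (f \<xi>) (g b) - F b) - (tens (f \<xi>) (g a) - F a)"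
        by (simp add: tens_algebra)
      ultimately have "norm (tens (f \<xi>) (g b - g a) - (F b - F a)) \<le> \<eta> * V * (b - a)"
        by (simp only:)
      then show ?thesis
        using \<open>a \<le> b\<close> by (simp add: ab)
    qed
    have "(\<Sum>(\<xi>, K)\<in>\<D>. tens (f \<xi>) (g (Sup K) - g (Inf K))) - (F t - F s)
        = (\<Sum>(\<xi>, K)\<in>\<D>. tens (f \<xi>) (g (Sup K) - g (Inf K)) - (F (Sup K) - F (Inf K)))"
      unfolding additive_tagged_division_1[OF st \<D>, of F, symmetric] sum_subtractf[symmetric]
      by (intro sum.cong) auto
    also have "norm \<dots> \<le> (\<Sum>(\<xi>, K)\<in>\<D>. \<eta> * V * measure lborel K)"
      using cell by (intro sum_norm_le) auto
    also have "\<dots> = \<eta> * V * (t - s)"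
      using additive_content_tagged_division[OF \<D>[folded box_real(2)]] st
      by (simp add: sum_distrib_left[symmetric] split_def)
    also have "\<dots> < \<eta> * ((V + 1) * (t - s + 1))"
    proof -
      have "V * (t - s) \<le> (V + 1) * (t - s)"
        using st by (intro mult_right_mono) auto
      also have "\<dots> < (V + 1) * (t - s + 1)"
        using V by (intro mult_strict_left_mono) auto
      finally show ?thesis
        using \<eta> by (simp add: mult.assoc)
    qed
    also have "\<dots> = e"
      using V st by (simp add: \<eta>_def)
    finally show "norm ((\<Sum>(\<xi>, K)\<in>\<D>. tens (f \<xi>) (g (Sup K) - g (Inf K))) - (F t - F s)) < e" .
  qed
qed

lemma smooth_path_velocity:
  assumes "smooth_path T x"
  obtains v where "\<And>t. t \<in> {0..T} \<Longrightarrow> (x has_vector_derivative v t) (at t within {0..T})"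
    "continuous_on {0..T} v"
proof -
  obtain D where D0: "\<And>t. t \<in> {0..T} \<Longrightarrow> D 0 t = x t"
    and D: "\<And>n t. t \<in> {0..T} \<Longrightarrow> (D n has_vector_derivative D (Suc n) t) (at t within {0..T})"
    using assms unfolding smooth_path_def by metis
  show thesis
  proof
    fix t assume t: "t \<in> {0..T}"
    show "(x has_vector_derivative D 1 t) (at t within {0..T})"
      using D[OF t, of 0] D0 t by (subst has_vector_derivative_cong_ev[where g = "D 0"])
        (auto simp: eventually_nhds)
  next
    show "continuous_on {0..T} (D 1)"
      using D[of _ 1] by (meson continuous_on_eq_continuous_within has_vector_derivative_continuous)
  qed
qed

text \<open>The lift of a smooth path is the driven path without drift that starts at the identity.\<close>

lemma S2_driven:
  assumes T: "0 \<le> T"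
    and x: "\<And>t. t \<in> {0..T} \<Longrightarrow> (x has_vector_derivative v t) (at t within {0..T})"
    and v: "continuous_on {0..T} v"
  shows "driven T (S2 tens x 0) v (\<lambda>_. 0)" "S2 tens x 0 0 = gone"
proof -
  have x0: "((\<lambda>t. x t - x 0) has_vector_derivative v t) (at t within {0..T})"
    if "t \<in> {0..T}" for t
    using x[OF that] by (simp add: has_vector_derivative_diff_const)
  obtain Z where Z: "driven T Z v (\<lambda>_. 0)" "\<And>t. fst (Z t) = x t - x 0" "snd (Z 0) = 0"
    using driven_exists[OF x0 v, of "\<lambda>_. 0"] by auto
  obtain V where V: "\<And>t. t \<in> {0..T} \<Longrightarrow> norm (v t) \<le> V"
    using continuous_on_interval_bounded[OF v] by blast
  have eq: "S2 tens x 0 t = Z t" if t: "t \<in> {0..T}" for t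
  proof -
    have sub: "{0..t} \<subseteq> {0..T}"
      using t by auto
    have "has_stieltjes_integral tens (\<lambda>r. x r - x 0) x 0 t (snd (Z t) - snd (Z 0))"
    proof (rule has_stieltjes_integralI)
      show "continuous_on {0..t} (\<lambda>r. x r - x 0)"
        using x0 sub
        by (meson continuous_on_eq_continuous_within continuous_on_subset has_vector_derivative_continuous)
      fix r assume r: "r \<in> {0..t}"
      show "(x has_vector_derivative v r) (at r within {0..t})"
        using r sub by (intro has_vector_derivative_within_subset[OF x]) auto
      show "norm (v r) \<le> V"
        using V r sub by auto
      show "((\<lambda>r. snd (Z r)) has_vector_derivative tens (x r - x 0) (v r)) (at r within {0..t})"
        using driven_snd[OF Z(1), of 0 t r] Z(2) r t by simp
    qed (use t in auto)
    then have "stieltjes_integral tens (\<lambda>r. x r - x 0) x 0 t = snd (Z t)"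
      unfolding stieltjes_integral_def using Z(3) has_stieltjes_integral_unique
      by (intro the_equality) auto
    then show ?thesis
      using Z(2) by (simp add: S2_def prod_eq_iff)
  qed
  have ev: "\<forall>\<^sub>F r in nhds t. r \<in> {0..T} \<longrightarrow> S2 tens x 0 r = Z r" for t
    using eq by (simp add: always_eventually)
  show "driven T (S2 tens x 0) v (\<lambda>_. 0)"
    unfolding driven_def
  proof (intro ballI conjI)
    fix t assume t: "t \<in> {0..T}"
    show "((\<lambda>t. fst (S2 tens x 0 t)) has_vector_derivative v t) (at t within {0..T})"
      by (rule has_vector_derivative_transform[OF t _ driven_fst[OF Z(1) _ _ t]]) (auto simp: eq)
    show "((\<lambda>t. snd (S2 tens x 0 t)) has_vector_derivative
        tens (fst (S2 tens x 0 t)) (v t) + 0) (at t within {0..T})"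
      unfolding eq[OF t]
      by (rule has_vector_derivative_transform[OF t _ driven_snd[OF Z(1) _ _ t]]) (auto simp: eq)
  qed
  show "S2 tens x 0 0 = gone"
    using eq[of 0] T Z(2)[of 0] Z(3) by (simp add: gone_def prod_eq_iff)
qed

lemma smooth_path_lift:
  assumes T: "0 \<le> T" and x: "smooth_path T x"
  shows "t \<in> {0..T} \<Longrightarrow> S2 tens x 0 t \<in> G2 tens"
    and "\<alpha> \<le> 1 \<Longrightarrow> S2 tens x 0 \<in> rough_paths tens T \<alpha>"
    and "bv_path T x"
proof -
  obtain v where xv: "\<And>t. t \<in> {0..T} \<Longrightarrow> (x has_vector_derivative v t) (at t within {0..T})"
    and v: "continuous_on {0..T} v"
    using smooth_path_velocity[OF x] by blast
  have lift: "driven T (S2 tens x 0) v (\<lambda>_. 0)" "S2 tens x 0 0 = gone"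
    by (rule S2_driven[OF T _ v]; fact xv)+
  obtain V where V: "\<And>t. t \<in> {0..T} \<Longrightarrow> norm (v t) \<le> V"
    using continuous_on_interval_bounded[OF v] by blast
  have "0 \<le> V"
    using V[of 0] T by (auto intro: order_trans[OF norm_ge_zero])
  show "S2 tens x 0 t \<in> G2 tens" if "t \<in> {0..T}"
    using driven_in_G2[OF lift(1) that] lift(2) gone_in_G2 subspace_0[OF subspace_closure_antisymmetric]
    by simp
  have "S2 tens x 0 \<in> rough_paths tens T 1"
  proof (rule rough_pathsI[where K = V])
    fix s t assume "0 \<le> s" "s \<le> t" "t \<le> T"
    then show "gnorm (ginc tens (S2 tens x 0) s t) \<le> V * (t - s) powr 1"
      using driven_gnorm_ginc_le[OF lift(1), of s t V 0] V \<open>0 \<le> V\<close> by simp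
  qed (rule T lift(2) \<open>0 \<le> V\<close>)+
  then show "S2 tens x 0 \<in> rough_paths tens T \<alpha>" if "\<alpha> \<le> 1"
    by (rule rough_paths_mono[OF T that])
  have "curve_length dist x 0 T \<le> ereal (V * T)"
    unfolding curve_length_def
  proof (rule SUP_least)
    fix \<D> assume "\<D> \<in> {\<D>. \<D> division_of {0..T}}"
    then have \<D>: "\<D> division_of {0..T}" by simp
    have "dist (x (Inf K)) (x (Sup K)) \<le> V * measure lborel K" if K: "K \<in> \<D>" for K
    proof -
      obtain a b where ab: "K = {a..b}" and "K \<noteq> {}" "K \<subseteq> {0..T}"
        using division_ofD(2-4)[OF \<D> K] by auto
      then have "a \<le> b" "{a..b} \<subseteq> {0..T}"
        by auto
      then have "norm (x b - x a) \<le> V * (b - a)"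
        by (intro increment_le_derivative_bound[where F' = v])
          (auto intro!: V intro: has_vector_derivative_within_subset[OF xv])
      then show ?thesis
        using \<open>a \<le> b\<close> by (simp add: ab dist_norm norm_minus_commute)
    qed
    then have "(\<Sum>K\<in>\<D>. dist (x (Inf K)) (x (Sup K))) \<le> (\<Sum>K\<in>\<D>. V * measure lborel K)"
      by (intro sum_mono)
    also have "\<dots> = V * T"
      using additive_content_division[OF \<D>[folded box_real(2)]] T
      by (simp add: sum_distrib_left[symmetric])
    finally show "ereal (\<Sum>K\<in>\<D>. dist (x (Inf K)) (x (Sup K))) \<le> ereal (V * T)"
      by simp
  qed
  then have "curve_length dist x 0 T < \<infinity>"
    by (rule order.strict_trans1) simp
  moreover have "continuous_on {0..T} x"
    using xv by (meson continuous_on_eq_continuous_within has_vector_derivative_continuous)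
  ultimately show "bv_path T x"
    by (simp add: bv_path_def)
qed

end

section \<open>Smooth functions closed under differentiation\<close>

text \<open>
  All smooth paths below are combinations of polynomials and of rapidly oscillating sines and
  cosines. The algebra generated by these functions is closed under differentiation, so
  smoothness needs no Leibniz rule of higher order.
\<close>

inductive_set trig_polynomials :: "(real \<Rightarrow> real) set" where
  const: "(\<lambda>_. a) \<in> trig_polynomials"
| ident: "(\<lambda>t. t) \<in> trig_polynomials"
| sine: "(\<lambda>t. sin (a * t)) \<in> trig_polynomials"
| cosine: "(\<lambda>t. cos (a * t)) \<in> trig_polynomials"
| add: "f \<in> trig_polynomials \<Longrightarrow> g \<in> trig_polynomials \<Longrightarrow> (\<lambda>t. f t + g t) \<in> trig_polynomials"
| mult: "f \<in> trig_polynomials \<Longrightarrow> g \<in> trig_polynomials \<Longrightarrow> (\<lambda>t. f t * g t) \<in> trig_polynomials"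

lemma trig_polynomials_cmult:
  "f \<in> trig_polynomials \<Longrightarrow> (\<lambda>t. a * f t) \<in> trig_polynomials"
  using trig_polynomials.mult[OF trig_polynomials.const] .

lemma trig_polynomials_diff:
  "f \<in> trig_polynomials \<Longrightarrow> g \<in> trig_polynomials \<Longrightarrow> (\<lambda>t. f t - g t) \<in> trig_polynomials"
  using trig_polynomials.add[OF _ trig_polynomials_cmult[of g "- 1"]] by simp

lemma trig_polynomials_power:
  "f \<in> trig_polynomials \<Longrightarrow> (\<lambda>t. f t ^ n) \<in> trig_polynomials"
  by (induction n) (auto intro: trig_polynomials.intros)

lemma trig_polynomials_derivative:
  assumes "f \<in> trig_polynomials"
  shows "\<exists>f'\<in>trig_polynomials. \<forall>t. (f has_real_derivative f' t) (at t)"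
  using assms
proof induction
  case (const a)
  show ?case
    by (intro bexI[of _ "\<lambda>_. 0"] allI DERIV_const trig_polynomials.const)
next
  case ident
  show ?case
    by (intro bexI[of _ "\<lambda>_. 1"] allI DERIV_ident trig_polynomials.const)
next
  case (sine a)
  show ?case
    by (intro bexI[of _ "\<lambda>t. a * cos (a * t)"] allI trig_polynomials_cmult trig_polynomials.cosine)
      (auto intro!: derivative_eq_intros)
next
  case (cosine a)
  show ?case
    by (intro bexI[of _ "\<lambda>t. (- a) * sin (a * t)"] allI trig_polynomials_cmult
        trig_polynomials.sine)
      (auto intro!: derivative_eq_intros)
next
  case (add f g)
  then obtain f' g' where "f' \<in> trig_polynomials" "g' \<in> trig_polynomials"
    "\<And>t. (f has_real_derivative f' t) (at t)" "\<And>t. (g has_real_derivative g' t) (at t)"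
    by blast
  then show ?case
    by (intro bexI[of _ "\<lambda>t. f' t + g' t"] allI DERIV_add trig_polynomials.add)
next
  case (mult f g)
  then obtain f' g' where "f' \<in> trig_polynomials" "g' \<in> trig_polynomials"
    "\<And>t. (f has_real_derivative f' t) (at t)" "\<And>t. (g has_real_derivative g' t) (at t)"
    by blast
  with mult.hyps show ?case
    by (intro bexI[of _ "\<lambda>t. f' t * g t + g' t * f t"] allI DERIV_mult trig_polynomials.add
        trig_polynomials.mult)
qed

lemma trig_polynomials_continuous: "f \<in> trig_polynomials \<Longrightarrow> continuous_on S f"
  using trig_polynomials_derivative
  by (meson DERIV_continuous continuous_at_imp_continuous_on)

inductive_set trig_paths :: "(real \<Rightarrow> 'c::real_normed_vector) set" where
  zero: "(\<lambda>_. 0) \<in> trig_paths"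
| add_term: "y \<in> trig_paths \<Longrightarrow> f \<in> trig_polynomials \<Longrightarrow> (\<lambda>t. y t + f t *\<^sub>R u) \<in> trig_paths"

lemma scaleR_const_derivative:
  "(g has_real_derivative g') F \<Longrightarrow> ((\<lambda>t. g t *\<^sub>R a) has_vector_derivative g' *\<^sub>R a) F"
  unfolding has_real_derivative_iff_has_vector_derivative
  by (rule bounded_linear.has_vector_derivative[OF bounded_linear_scaleR_left])

lemma trig_paths_derivative:
  assumes "y \<in> trig_paths"
  shows "\<exists>v\<in>trig_paths. \<forall>t. (y has_vector_derivative v t) (at t)"
  using assms
proof induction
  case zero
  show ?case
    by (intro bexI[of _ "\<lambda>_. 0"] allI has_vector_derivative_const trig_paths.zero)
next
  case (add_term y f u)
  then obtain v f' where "v \<in> trig_paths" "\<And>t. (y has_vector_derivative v t) (at t)"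
    "f' \<in> trig_polynomials" "\<And>t. (f has_real_derivative f' t) (at t)"
    using trig_polynomials_derivative by blast
  then show ?case
    by (intro bexI[of _ "\<lambda>t. v t + f' t *\<^sub>R u"] allI has_vector_derivative_add
        scaleR_const_derivative trig_paths.add_term)
qed

lemma trig_paths_continuous: "y \<in> trig_paths \<Longrightarrow> continuous_on S y"
  using trig_paths_derivative
  by (meson continuous_at_imp_continuous_on has_vector_derivative_continuous)

lemma trig_paths_smooth:
  assumes y: "y \<in> trig_paths"
  shows "smooth_path T y"
proof -
  obtain G where G: "\<And>y :: real \<Rightarrow> 'a. y \<in> trig_paths \<Longrightarrow>
      G y \<in> trig_paths \<and> (\<forall>t. (y has_vector_derivative G y t) (at t))"
    using trig_paths_derivative by metis
  have "(G ^^ n) y \<in> trig_paths" for n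
    by (induction n) (auto simp: y G)
  then have "((G ^^ n) y has_vector_derivative (G ^^ Suc n) y t) (at t within {0..T})" for n t
    using G by (simp add: has_vector_derivative_at_within)
  then show ?thesis
    unfolding smooth_path_def by (intro exI[of _ "\<lambda>n. (G ^^ n) y"]) auto
qed

lemma trig_paths_sum:
  assumes "\<And>k. k \<in> A \<Longrightarrow> f k \<in> trig_polynomials"
  shows "(\<lambda>t. \<Sum>k\<in>A. f k t *\<^sub>R u k) \<in> trig_paths"
  using assms
proof (induction A rule: infinite_finite_induct)
  case (insert a A)
  then have "(\<lambda>t. (\<Sum>k\<in>A. f k t *\<^sub>R u k) + f a t *\<^sub>R u a) \<in> trig_paths"
    by (intro trig_paths.add_term) auto
  with insert.hyps show ?case
    by (simp add: add.commute)
qed (auto intro: trig_paths.zero)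


section \<open>Creating area by oscillation\<close>

context tensor_group
begin

inductive_set area_drifts :: "(real \<Rightarrow> 'b) set" where
  zero: "(\<lambda>_. 0) \<in> area_drifts"
| add_bracket: "c \<in> area_drifts \<Longrightarrow> f \<in> trig_polynomials \<Longrightarrow>
    (\<lambda>t. c t + f t *\<^sub>R bracket u w) \<in> area_drifts"

lemma area_drifts_continuous: "c \<in> area_drifts \<Longrightarrow> continuous_on S c"
  by (induction rule: area_drifts.induct)
    (auto intro!: continuous_intros trig_polynomials_continuous)

lemma area_drifts_add:
  assumes c: "c \<in> area_drifts" and d: "d \<in> area_drifts"
  shows "(\<lambda>t. c t + d t) \<in> area_drifts"
  using d
proof induction
  case zero
  then show ?case using c by simp
next
  case (add_bracket d f u w)
  then show ?case
    using area_drifts.add_bracket[of "\<lambda>t. c t + d t" f u w] by (simp add: add.assoc)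
qed

lemma area_drifts_sum:
  assumes "\<And>k. k \<in> A \<Longrightarrow> c k \<in> area_drifts"
  shows "(\<lambda>t. \<Sum>k\<in>A. c k t) \<in> area_drifts"
  using assms
proof (induction A rule: infinite_finite_induct)
  case (insert a A)
  then have "(\<lambda>t. c a t + (\<Sum>k\<in>A. c k t)) \<in> area_drifts"
    by (intro area_drifts_add) auto
  with insert.hyps show ?case
    by simp
qed (auto intro: area_drifts.zero)

lemma area_drifts_bracket:
  "f \<in> trig_polynomials \<Longrightarrow> (\<lambda>t. f t *\<^sub>R bracket u w) \<in> area_drifts"
  using area_drifts.add_bracket[OF area_drifts.zero, of f u w] by simp

lemma area_drifts_antisymmetric:
  assumes "a \<in> antisymmetric" and f: "f \<in> trig_polynomials"
  shows "(\<lambda>t. f t *\<^sub>R a) \<in> area_drifts"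
  using assms(1)
proof (induction rule: span_induct_alt)
  case base
  then show ?case by (simp add: area_drifts.zero)
next
  case (step r b a)
  then obtain u w where b: "b = bracket u w" by blast
  have "(\<lambda>t. (r * f t) *\<^sub>R b + f t *\<^sub>R a) \<in> area_drifts"
    using area_drifts_add[OF area_drifts_bracket[OF trig_polynomials_cmult[OF f]] step.IH]
    by (simp add: b)
  then show ?case
    by (simp add: scaleR_right_distrib mult.commute)
qed

text \<open>
  Adding to the path a perturbation \<open>\<zeta>\<close> of size \<open>1/N\<close> and of speed \<open>N\<close> moves the first level
  very little, but \<open>\<zeta> \<otimes> d\<zeta>\<close> has order one. If it equals the drift \<open>e\<close> up to the derivative of a
  quantity of size \<open>1/N\<^sup>2\<close>, then the perturbed path simulates the drift. All other terms
  of the second level contain a factor \<open>\<zeta>\<close>, after an integration by parts if necessary.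
\<close>

lemma oscillation_gdist_le:
  assumes T: "0 < T" and N: "1 \<le> N" and M: "1 \<le> M" and st: "0 \<le> s" "s < t" "t \<le> T"
    and Z: "driven T Z v (\<lambda>r. c r + e r)" and W: "driven T W (\<lambda>r. v r + \<zeta>' r) c"
    and \<zeta>: "\<And>r. (\<zeta> has_vector_derivative \<zeta>' r) (at r)"
    and G: "\<And>r. (G has_vector_derivative G' r) (at r)"
    and eq: "\<And>r. tens (\<zeta> r) (\<zeta>' r) - e r = (1 / N\<^sup>2) *\<^sub>R (G' r - h r)"
    and bounds: "\<And>r. r \<in> {0..T} \<Longrightarrow> norm (v r) \<le> M" "\<And>r. r \<in> {0..T} \<Longrightarrow> norm (\<zeta> r) \<le> M / N"
      "\<And>r. r \<in> {0..T} \<Longrightarrow> norm (\<zeta>' r) \<le> M * N" "\<And>r. r \<in> {0..T} \<Longrightarrow> norm (e r) \<le> M"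
      "\<And>r. r \<in> {0..T} \<Longrightarrow> norm (G r) \<le> M" "\<And>r. r \<in> {0..T} \<Longrightarrow> norm (h r) \<le> M"
  defines "K \<equiv> (7 + 5 * T) * M\<^sup>2"
  shows "gdist tens (ginc tens Z s t) (ginc tens W s t) \<le> sqrt (K * (t - s))"
    and "gdist tens (ginc tens Z s t) (ginc tens W s t) \<le> sqrt (K / N)"
proof -
  have sub: "r \<in> {0..T}" if "r \<in> {s..t}" for r
    using that st by auto
  have st': "s \<in> {0..T}" "t \<in> {0..T}"
    using st by auto
  have MN: "M / N \<le> M" "M / N\<^sup>2 \<le> M\<^sup>2 / N" "M\<^sup>2 / N\<^sup>2 \<le> M\<^sup>2 / N" "M \<le> M\<^sup>2"
  proof -
    show "M / N \<le> M" "M \<le> M\<^sup>2"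
      using M N by (auto simp: divide_le_eq power2_eq_square)
    have "N \<le> N\<^sup>2" using N by (simp add: power2_eq_square)
    with \<open>M \<le> M\<^sup>2\<close> show "M / N\<^sup>2 \<le> M\<^sup>2 / N" "M\<^sup>2 / N\<^sup>2 \<le> M\<^sup>2 / N"
      using M N by (auto intro!: frac_le)
  qed
  have diff: "norm (\<zeta> r - \<zeta> s) \<le> 2 * (M / N)" if "r \<in> {s..t}" for r
    using norm_triangle_le_diff[OF add_mono[OF bounds(2)[OF sub[OF that]] bounds(2)[OF st'(1)]]]
    by simp
  \<comment> \<open>The second level of \<open>Z_sr\<^sup>-\<^sup>1 W_sr\<close>; the first level is \<open>\<zeta> r - \<zeta> s\<close>.\<close>
  define \<Delta> where "\<Delta> r = snd (ginc tens W s r) - snd (ginc tens Z s r)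
      - tens (fst (Z r) - fst (Z s)) (\<zeta> r - \<zeta> s)" for r
  have W_fst: "fst (W r) - fst (W s) = (fst (Z r) - fst (Z s)) + (\<zeta> r - \<zeta> s)"
    if r: "r \<in> {s..t}" for r
  proof -
    have "norm ((fst (W r) - (fst (Z r) + \<zeta> r)) - (fst (W s) - (fst (Z s) + \<zeta> s))) \<le> 0 * (r - s)"
    proof (rule increment_le_derivative_bound)
      fix q assume "q \<in> {s..r}"
      then show "((\<lambda>r. fst (W r) - (fst (Z r) + \<zeta> r)) has_vector_derivative
          (v q + \<zeta>' q) - (v q + \<zeta>' q)) (at q within {s..r})"
        using st r by (intro has_vector_derivative_diff has_vector_derivative_add
            driven_fst[OF Z] driven_fst[OF W] has_vector_derivative_at_within[OF \<zeta>]) auto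
    qed (use r in auto)
    then show ?thesis
      by (simp add: algebra_simps)
  qed
  let ?\<Delta>' = "\<lambda>r. tens (\<zeta> r - \<zeta> s) (v r) - tens (v r) (\<zeta> r - \<zeta> s)
      + (tens (\<zeta> r - \<zeta> s) (\<zeta>' r) - e r)"
  have \<Delta>: "(\<Delta> has_vector_derivative ?\<Delta>' r) (at r within {s..t})" if r: "r \<in> {s..t}" for r
  proof -
    have "(\<Delta> has_vector_derivative
        (tens (fst (W r) - fst (W s)) (v r + \<zeta>' r) + c r)
        - (tens (fst (Z r) - fst (Z s)) (v r) + (c r + e r))
        - (tens (fst (Z r) - fst (Z s)) (\<zeta>' r) + tens (v r) (\<zeta> r - \<zeta> s))) (at r within {s..t})"
      unfolding \<Delta>_def using st
      by (intro has_vector_derivative_diff has_vector_derivative driven_ginc_snd[OF Z]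
          driven_ginc_snd[OF W] has_vector_derivative_at_within[OF \<zeta>, THEN has_vector_derivative_diff_const[THEN iffD2]]
          driven_fst[OF Z, THEN has_vector_derivative_diff_const[THEN iffD2]] r) auto
    then show ?thesis
      by (rule has_vector_derivative_eq_rhs) (simp add: W_fst[OF r] tens_algebra)
  qed
  have \<Delta>s: "\<Delta> s = 0"
    by (simp add: \<Delta>_def ginc_apply zero_right)
  have gdist_eq: "gdist tens (ginc tens Z s t) (ginc tens W s t) = gnorm (\<zeta> t - \<zeta> s, \<Delta> t)"
  proof -
    have "fst (ginc tens W s t) - fst (ginc tens Z s t) = \<zeta> t - \<zeta> s"
      "fst (ginc tens Z s t) = fst (Z t) - fst (Z s)"
      using W_fst[of t] st by (simp_all add: ginc_apply)
    then show ?thesis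
      by (simp only: gdist_apply \<Delta>_def)
  qed

  \<comment> \<open>The bound of order 1/2 in time: the crude bound \<open>\<zeta> \<otimes> \<zeta>' = O(1)\<close> is enough here.\<close>
  have sq: "(norm (\<zeta> t - \<zeta> s))\<^sup>2 \<le> 2 * M\<^sup>2 * (t - s)"
  proof -
    have "norm (\<zeta> t - \<zeta> s) \<le> M * N * (t - s)"
      using st by (intro increment_le_derivative_bound[where F' = \<zeta>'])
        (auto intro!: bounds has_vector_derivative_at_within[OF \<zeta>])
    then have "norm (\<zeta> t - \<zeta> s) * norm (\<zeta> t - \<zeta> s) \<le> 2 * (M / N) * (M * N * (t - s))"
      using diff[of t] st M N by (intro mult_mono) auto
    moreover have "2 * (M / N) * (M * N * (t - s)) = 2 * M\<^sup>2 * (t - s)"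
      using N by (simp add: power2_eq_square)
    ultimately show ?thesis
      by (simp only: power2_eq_square)
  qed
  have "norm (\<Delta> t - \<Delta> s) \<le> 7 * M\<^sup>2 * (t - s)"
  proof (rule increment_le_derivative_bound[OF less_imp_le \<Delta>])
    fix r assume r: "r \<in> {s..t}"
    have "norm (?\<Delta>' r) \<le> (2 * (M / N) * M + M * (2 * (M / N))) + (2 * (M / N) * (M * N) + M)"
      using sub[OF r] diff[OF r]
      by (intro norm_triangle_mono norm_triangle_le_diff[OF add_mono] norm_tens_bound bounds)
    also have "\<dots> \<le> (2 * M * M + M * (2 * M)) + (2 * M\<^sup>2 + M\<^sup>2)"
      using MN(1,4) M N by (intro add_mono mult_left_mono mult_right_mono) (auto simp: power2_eq_square)
    finally show "norm (?\<Delta>' r) \<le> 7 * M\<^sup>2"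
      by (simp add: power2_eq_square)
  qed (use st in auto)
  then have \<Delta>1: "norm (\<Delta> t) \<le> 7 * M\<^sup>2 * (t - s)"
    by (simp add: \<Delta>s)
  have le_K: "x * M\<^sup>2 * (t - s) \<le> K * (t - s)" if "x \<le> 7" for x
    using that T st unfolding K_def by (intro mult_right_mono) auto
  show "gdist tens (ginc tens Z s t) (ginc tens W s t) \<le> sqrt (K * (t - s))"
    unfolding gdist_eq using sq \<Delta>1 le_K[of 2] le_K[of 7] by (intro gnorm_le_sqrt) auto

  \<comment> \<open>The uniform bound.\<close>
  have sq': "(norm (\<zeta> t - \<zeta> s))\<^sup>2 \<le> 4 * (M\<^sup>2 / N)"
  proof -
    have "(norm (\<zeta> t - \<zeta> s))\<^sup>2 \<le> (2 * (M / N))\<^sup>2"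
      using diff[of t] st by (intro power_mono) auto
    then show ?thesis
      using MN(3) by (simp add: power_mult_distrib power_divide)
  qed
  \<comment> \<open>The part of \<open>\<Delta>\<close> whose derivative is of order one although its values are small.\<close>
  define R where "R r = (1 / N\<^sup>2) *\<^sub>R G r - tens (\<zeta> s) (\<zeta> r)" for r
  have "norm ((\<Delta> t - R t) - (\<Delta> s - R s)) \<le> 5 * (M\<^sup>2 / N) * (t - s)"
  proof (rule increment_le_derivative_bound)
    fix r assume r: "r \<in> {s..t}"
    have "(R has_vector_derivative (1 / N\<^sup>2) *\<^sub>R G' r - tens (\<zeta> s) (\<zeta>' r)) (at r within {s..t})"
      unfolding R_def by (intro has_vector_derivative_diff tens_const_left_derivative
          has_vector_derivative_at_within[OF \<zeta>] has_vector_derivative_at_within[OF G]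
          bounded_linear.has_vector_derivative[OF bounded_linear_scaleR_right])
    from has_vector_derivative_diff[OF \<Delta>[OF r] this]
    show "((\<lambda>r. \<Delta> r - R r) has_vector_derivative
        tens (\<zeta> r - \<zeta> s) (v r) - tens (v r) (\<zeta> r - \<zeta> s) - (1 / N\<^sup>2) *\<^sub>R h r) (at r within {s..t})"
    proof (rule has_vector_derivative_eq_rhs)
      have "e r = tens (\<zeta> r) (\<zeta>' r) - (1 / N\<^sup>2) *\<^sub>R (G' r - h r)"
        using eq[of r] by (simp add: algebra_simps)
      then show "?\<Delta>' r - ((1 / N\<^sup>2) *\<^sub>R G' r - tens (\<zeta> s) (\<zeta>' r))
          = tens (\<zeta> r - \<zeta> s) (v r) - tens (v r) (\<zeta> r - \<zeta> s) - (1 / N\<^sup>2) *\<^sub>R h r"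
        by (simp add: tens_algebra scaleR_diff_right)
    qed
    have "norm (tens (\<zeta> r - \<zeta> s) (v r) - tens (v r) (\<zeta> r - \<zeta> s) - (1 / N\<^sup>2) *\<^sub>R h r)
        \<le> (2 * (M / N) * M + M * (2 * (M / N))) + M / N\<^sup>2"
      using sub[OF r] diff[OF r] N bounds(6)[OF sub[OF r]]
      by (intro norm_triangle_le_diff[OF add_mono] norm_tens_bound bounds)
        (auto simp: divide_right_mono)
    also have "\<dots> \<le> 5 * (M\<^sup>2 / N)"
      using MN(2) by (simp add: power2_eq_square)
    finally show "norm (tens (\<zeta> r - \<zeta> s) (v r) - tens (v r) (\<zeta> r - \<zeta> s) - (1 / N\<^sup>2) *\<^sub>R h r)
        \<le> 5 * (M\<^sup>2 / N)" .
  qed (use st in auto)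
  also have "\<dots> \<le> 5 * (M\<^sup>2 / N) * T"
    using st M N by (intro mult_left_mono) auto
  finally have R1: "norm (\<Delta> t - (R t - R s)) \<le> 5 * (M\<^sup>2 / N) * T"
    by (simp add: \<Delta>s algebra_simps)
  have "R t - R s = (1 / N\<^sup>2) *\<^sub>R (G t - G s) - tens (\<zeta> s) (\<zeta> t - \<zeta> s)"
    by (simp add: R_def tens_algebra scaleR_diff_right)
  also have "norm \<dots> \<le> (1 / N\<^sup>2) * (M + M) + M / N * (2 * (M / N))"
  proof (intro norm_triangle_le_diff[OF add_mono] norm_tens_bound bounds st' diff)
    have "norm (G t - G s) \<le> M + M"
      by (intro norm_triangle_le_diff[OF add_mono] bounds st')
    then show "norm ((1 / N\<^sup>2) *\<^sub>R (G t - G s)) \<le> (1 / N\<^sup>2) * (M + M)"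
      by (simp add: divide_right_mono)
  qed (use st in auto)
  also have "\<dots> = 2 * (M / N\<^sup>2) + 2 * (M\<^sup>2 / N\<^sup>2)"
    by (simp add: power2_eq_square)
  also have "\<dots> \<le> 4 * (M\<^sup>2 / N)"
    using MN(2,3) by simp
  finally have "norm (\<Delta> t) \<le> 5 * (M\<^sup>2 / N) * T + 4 * (M\<^sup>2 / N)"
    using norm_triangle_le[OF add_mono[OF R1], of "R t - R s"] by simp
  also have "\<dots> = (4 + 5 * T) * (M\<^sup>2 / N)"
    by (simp add: algebra_simps)
  finally have \<Delta>2: "norm (\<Delta> t) \<le> (4 + 5 * T) * (M\<^sup>2 / N)" .
  have le_K': "x * (M\<^sup>2 / N) \<le> K / N" if "x \<le> 7 + 5 * T" for x
  proof -
    have "x * (M\<^sup>2 / N) \<le> (7 + 5 * T) * (M\<^sup>2 / N)"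
      using that N by (intro mult_right_mono) auto
    then show ?thesis
      by (simp add: K_def)
  qed
  show "gdist tens (ginc tens Z s t) (ginc tens W s t) \<le> sqrt (K / N)"
    unfolding gdist_eq
    using sq' \<Delta>2 le_K'[of 4] le_K'[of "4 + 5 * T"] T by (intro gnorm_le_sqrt) auto
qed

text \<open>
  The planar ellipse-like motion below runs at frequency \<open>N\<^sup>2\<close> on the scale \<open>1/N\<close> and sweeps area
  at rate \<open>f\<close> in the plane of \<open>u\<close> and \<open>w\<close>; a negative \<open>f\<close> reverses its orientation.
\<close>

definition osc :: "real \<Rightarrow> (real \<Rightarrow> real) \<Rightarrow> 'a \<Rightarrow> 'a \<Rightarrow> real \<Rightarrow> 'a" where
  "osc N f u w r = (f r * cos (N\<^sup>2 * r) / N) *\<^sub>R u + (2 * sin (N\<^sup>2 * r) / N) *\<^sub>R w"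

definition osc_velocity ::
  "real \<Rightarrow> (real \<Rightarrow> real) \<Rightarrow> (real \<Rightarrow> real) \<Rightarrow> 'a \<Rightarrow> 'a \<Rightarrow> real \<Rightarrow> 'a" where
  "osc_velocity N f f' u w r =
     ((f' r * cos (N\<^sup>2 * r) - N\<^sup>2 * f r * sin (N\<^sup>2 * r)) / N) *\<^sub>R u + (2 * N * cos (N\<^sup>2 * r)) *\<^sub>R w"

lemma osc_derivative:
  assumes "N \<noteq> 0" "(f has_real_derivative f' r) (at r)"
  shows "(osc N f u w has_vector_derivative osc_velocity N f f' u w r) (at r)"
  unfolding osc_def osc_velocity_def
  using assms by (intro has_vector_derivative_add scaleR_const_derivative)
    (auto intro!: derivative_eq_intros simp: power2_eq_square field_simps)

lemma osc_trig_path: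
  assumes "y \<in> trig_paths" "f \<in> trig_polynomials" "f' \<in> trig_polynomials"
  shows "(\<lambda>r. y r + osc N f u w r) \<in> trig_paths"
    and "(\<lambda>r. y r + osc_velocity N f f' u w r) \<in> trig_paths"
proof -
  have "(\<lambda>r. (y r + (1 / N * (f r * cos (N\<^sup>2 * r))) *\<^sub>R u) + (2 / N * sin (N\<^sup>2 * r)) *\<^sub>R w) \<in> trig_paths"
    by (intro trig_paths.add_term assms trig_polynomials_cmult trig_polynomials.intros)
  then show "(\<lambda>r. y r + osc N f u w r) \<in> trig_paths"
    by (simp add: osc_def add.assoc)
  have "(\<lambda>r. (y r + (1 / N * (f' r * cos (N\<^sup>2 * r) + (- (N\<^sup>2)) * (f r * sin (N\<^sup>2 * r)))) *\<^sub>R u)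
      + (2 * N * cos (N\<^sup>2 * r)) *\<^sub>R w) \<in> trig_paths"
    by (intro trig_paths.add_term assms trig_polynomials_cmult trig_polynomials.intros)
  then show "(\<lambda>r. y r + osc_velocity N f f' u w r) \<in> trig_paths"
    by (simp add: osc_velocity_def add.assoc mult.assoc)
qed

text \<open>
  The iterated integral of \<open>osc\<close> consists of a drift and of terms of size \<open>1/N\<^sup>2\<close>. The following
  function collects the coefficients of the oscillating part, multiplied by \<open>N\<^sup>2\<close>.
\<close>

definition osc_primitive :: "real \<Rightarrow> (real \<Rightarrow> real) \<Rightarrow> 'a \<Rightarrow> 'a \<Rightarrow> real \<Rightarrow> 'b" where
  "osc_primitive N f u w r =
     ((f r * cos (N\<^sup>2 * r))\<^sup>2 / 2) *\<^sub>R tens u u + (2 * (sin (N\<^sup>2 * r))\<^sup>2) *\<^sub>R tens w w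
     + (f r * sin (N\<^sup>2 * r) * cos (N\<^sup>2 * r)) *\<^sub>R (tens u w + tens w u)"

lemma tens_combination:
  "tens (a *\<^sub>R u + b *\<^sub>R w) (c *\<^sub>R u + d *\<^sub>R w)
    = (a * c) *\<^sub>R tens u u + (a * d) *\<^sub>R tens u w + (b * c) *\<^sub>R tens w u + (b * d) *\<^sub>R tens w w"
  by (simp add: tens_algebra algebra_simps)

text \<open>
  The coefficients of \<open>u \<otimes> u\<close> and \<open>w \<otimes> w\<close> are exact derivatives. Those of the mixed terms are
  \<open>2 N\<^sup>2 f cos\<^sup>2\<close> and \<open>- 2 N\<^sup>2 f sin\<^sup>2\<close> up to a bounded function, that is \<open>N\<^sup>2 f (cos\<^sup>2 - sin\<^sup>2)\<close>, the
  main part of the derivative of \<open>f sin cos\<close>, plus the mean values \<open>N\<^sup>2 f\<close> and \<open>- N\<^sup>2 f\<close>. These mean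
  values form the bracket.
\<close>

lemma osc_area:
  assumes N: "N \<noteq> 0" and f: "\<And>r. (f has_real_derivative f' r) (at r)"
  shows "\<exists>G'. (\<forall>r. (osc_primitive N f u w has_vector_derivative G' r) (at r)) \<and>
    (\<forall>r. tens (osc N f u w r) (osc_velocity N f f' u w r) - f r *\<^sub>R bracket u w
       = (1 / N\<^sup>2) *\<^sub>R (G' r - (f' r * sin (N\<^sup>2 * r) * cos (N\<^sup>2 * r)) *\<^sub>R bracket u w))"
proof -
  define s where "s r = sin (N\<^sup>2 * r)" for r
  define c where "c r = cos (N\<^sup>2 * r)" for r
  have sc: "(s r)\<^sup>2 = 1 - (c r)\<^sup>2" for r
    by (simp add: s_def c_def sin_squared_eq)
  define g1 where "g1 r = f r * c r * (f' r * c r - N\<^sup>2 * f r * s r)" for r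
  define g2 where "g2 r = 4 * N\<^sup>2 * s r * c r" for r
  define g3 where "g3 r = f' r * s r * c r + N\<^sup>2 * f r * ((c r)\<^sup>2 - (s r)\<^sup>2)" for r
  define G' where "G' r = g1 r *\<^sub>R tens u u + g2 r *\<^sub>R tens w w + g3 r *\<^sub>R (tens u w + tens w u)" for r
  have "(osc_primitive N f u w has_vector_derivative G' r) (at r)" for r
    unfolding osc_primitive_def G'_def
    by (intro has_vector_derivative_add scaleR_const_derivative;
        (rule derivative_eq_intros f refl | simp)+)
      (simp_all add: g1_def g2_def g3_def s_def c_def power2_eq_square algebra_simps)
  moreover have "tens (osc N f u w r) (osc_velocity N f f' u w r) - f r *\<^sub>R bracket u w
      = (1 / N\<^sup>2) *\<^sub>R (G' r - (f' r * s r * c r) *\<^sub>R bracket u w)" for r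
  proof -
    define x1 where "x1 = (f r * c r / N) * ((f' r * c r - N\<^sup>2 * f r * s r) / N)"
    define x2 where "x2 = (f r * c r / N) * (2 * N * c r)"
    define x3 where "x3 = (2 * s r / N) * ((f' r * c r - N\<^sup>2 * f r * s r) / N)"
    define x4 where "x4 = (2 * s r / N) * (2 * N * c r)"
    have expand: "tens (osc N f u w r) (osc_velocity N f f' u w r)
        = x1 *\<^sub>R tens u u + x2 *\<^sub>R tens u w + x3 *\<^sub>R tens w u + x4 *\<^sub>R tens w w"
      unfolding osc_def osc_velocity_def s_def[symmetric] c_def[symmetric]
        x1_def x2_def x3_def x4_def by (rule tens_combination)
    have x1: "x1 = (1 / N\<^sup>2) * g1 r" and x4: "x4 = (1 / N\<^sup>2) * g2 r"
      using N by (simp_all add: x1_def x4_def g1_def g2_def power2_eq_square field_simps)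
    have x2: "x2 = (1 / N\<^sup>2) * (g3 r - f' r * s r * c r) + f r"
    proof -
      have "N\<^sup>2 * x2 = 2 * N\<^sup>2 * f r * (c r)\<^sup>2"
        using N by (simp add: x2_def field_simps power2_eq_square)
      also have "\<dots> = g3 r - f' r * s r * c r + N\<^sup>2 * f r"
        by (simp add: g3_def sc algebra_simps)
      finally show ?thesis
        using N by (simp add: field_simps)
    qed
    have x3: "x3 = (1 / N\<^sup>2) * (g3 r + f' r * s r * c r) - f r"
    proof -
      have "N\<^sup>2 * x3 = 2 * s r * c r * f' r - 2 * N\<^sup>2 * f r * (s r)\<^sup>2"
        using N by (simp add: x3_def field_simps power2_eq_square)
      also have "\<dots> = g3 r + f' r * s r * c r - N\<^sup>2 * f r"
        by (simp add: g3_def sc algebra_simps)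
      finally show ?thesis
        using N by (simp add: field_simps)
    qed
    show ?thesis
      unfolding expand x1 x2 x3 x4 G'_def by (simp add: algebra_simps)
  qed
  ultimately show ?thesis
    unfolding s_def c_def by blast
qed

lemma osc_bounds:
  assumes N: "1 \<le> N" and B: "1 \<le> B" "norm u \<le> B" "norm w \<le> B" "\<bar>f r\<bar> \<le> B" "\<bar>f' r\<bar> \<le> B"
  shows "norm (osc N f u w r) \<le> 5 * B ^ 4 / N"
    and "norm (osc_velocity N f f' u w r) \<le> 5 * B ^ 4 * N"
    and "norm (f r *\<^sub>R bracket u w) \<le> 5 * B ^ 4"
    and "norm (osc_primitive N f u w r) \<le> 5 * B ^ 4"
    and "norm ((f' r * sin (N\<^sup>2 * r) * cos (N\<^sup>2 * r)) *\<^sub>R bracket u w) \<le> 5 * B ^ 4"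
proof -
  let ?s = "sin (N\<^sup>2 * r)" and ?c = "cos (N\<^sup>2 * r)"
  have B4: "B ^ k \<le> B ^ 4" if "k \<le> 4" for k
    using B(1) that by (intro power_increasing) auto
  have scale: "norm (a *\<^sub>R x) \<le> b * d" if "\<bar>a\<bar> \<le> b" "norm x \<le> d" for a b d :: real and x :: "'c::real_normed_vector"
    using that by (auto intro!: mult_mono intro: order_trans[OF abs_ge_zero])
  have sc: "\<bar>x * ?c\<bar> \<le> b" "\<bar>x * ?s\<bar> \<le> b" "\<bar>x * ?s * ?c\<bar> \<le> b" if "\<bar>x\<bar> \<le> b" for x b
  proof -
    have 1: "\<bar>x * y\<bar> \<le> b" if "\<bar>x\<bar> \<le> b" "\<bar>y\<bar> \<le> 1" for x y
      using that mult_mono[of "\<bar>x\<bar>" b "\<bar>y\<bar>" 1] by (simp add: abs_mult)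
    show "\<bar>x * ?c\<bar> \<le> b" "\<bar>x * ?s\<bar> \<le> b" "\<bar>x * ?s * ?c\<bar> \<le> b"
      using that by (auto intro!: 1)
  qed
  have tensB: "norm (tens u u) \<le> B ^ 2" "norm (tens w w) \<le> B ^ 2"
    "norm (tens u w) \<le> B ^ 2" "norm (tens w u) \<le> B ^ 2"
    unfolding power2_eq_square by (intro norm_tens_bound B)+
  then have brB: "norm (bracket u w) \<le> 2 * B ^ 2" "norm (tens u w + tens w u) \<le> 2 * B ^ 2"
    using norm_triangle_le_diff[of "tens u w" "tens w u"] norm_triangle_le[of "tens u w" "tens w u"]
    by auto
  have "norm (osc N f u w r) \<le> B / N * B + 2 / N * B"
    unfolding osc_def using N B sc(1)[OF B(4)]
    by (intro norm_triangle_mono scale) (auto simp: divide_le_cancel abs_mult divide_simps)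
  also have "\<dots> = (B ^ 2 + 2 * B) / N"
    by (simp add: add_divide_distrib power2_eq_square)
  also have "\<dots> \<le> 5 * B ^ 4 / N"
    using B4[of 2] B4[of 1] N B(1) by (intro divide_right_mono) auto
  finally show "norm (osc N f u w r) \<le> 5 * B ^ 4 / N" .
  have "\<bar>f' r * ?c - N\<^sup>2 * f r * ?s\<bar> \<le> B + N\<^sup>2 * B"
  proof (intro order_trans[OF abs_triangle_ineq4 add_mono] sc(1) B)
    show "\<bar>N\<^sup>2 * f r * ?s\<bar> \<le> N\<^sup>2 * B"
      using mult_left_mono[OF sc(2)[OF B(4)], of "N\<^sup>2"] by (simp add: abs_mult mult.assoc)
  qed
  also have "\<dots> \<le> (2 * N * B) * N"
    using B(1) mult_right_mono[OF one_le_power[OF N, of 2], of B]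
    by (simp add: power2_eq_square algebra_simps)
  finally have "norm (osc_velocity N f f' u w r) \<le> (2 * N * B) * B + 2 * N * B"
    unfolding osc_velocity_def using N B
    by (intro norm_triangle_mono scale) (auto simp: divide_le_eq abs_mult)
  also have "\<dots> = N * (2 * B ^ 2 + 2 * B)"
    by (simp add: algebra_simps power2_eq_square)
  also have "\<dots> \<le> N * (5 * B ^ 4)"
    using B4[of 2] B4[of 1] N B(1) by (intro mult_left_mono) auto
  finally show "norm (osc_velocity N f f' u w r) \<le> 5 * B ^ 4 * N"
    by (simp add: mult.commute)
  have B3: "B * (2 * B ^ 2) \<le> 2 * B ^ 4"
    using B4[of 3] by (simp add: power3_eq_cube power2_eq_square)
  show "norm (f r *\<^sub>R bracket u w) \<le> 5 * B ^ 4"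
    using B3 B4[of 0] scale[OF B(4) brB(1)] by auto
  show "norm ((f' r * ?s * ?c) *\<^sub>R bracket u w) \<le> 5 * B ^ 4"
    using B3 B4[of 0] scale[OF sc(3)[OF B(5)] brB(1)] by auto
  have "(f r * ?c)\<^sup>2 / 2 \<le> B\<^sup>2"
    using power_mono[OF sc(1)[OF B(4)], of 2] zero_le_power2[of "f r * ?c"] by (simp; linarith)
  moreover have "?s\<^sup>2 \<le> 1"
    by (simp add: sin_squared_eq)
  ultimately have "norm (((f r * ?c)\<^sup>2 / 2) *\<^sub>R tens u u + (2 * ?s\<^sup>2) *\<^sub>R tens w w
      + (f r * ?s * ?c) *\<^sub>R (tens u w + tens w u)) \<le> B\<^sup>2 * B ^ 2 + 2 * B ^ 2 + B * (2 * B ^ 2)"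
    using sc(3)[OF B(4)] by (intro norm_triangle_mono scale tensB brB) auto
  also have "\<dots> \<le> 5 * B ^ 4"
    using B3 B4[of 2] by (simp flip: power_add)
  finally show "norm (osc_primitive N f u w r) \<le> 5 * B ^ 4"
    by (simp only: osc_primitive_def)
qed

lemma sqrt_interpolation_tendsto_0:
  assumes "0 < \<beta>" "\<beta> < 1 / 2" "0 \<le> K"
  shows "((\<lambda>N. sqrt K powr (\<beta> / (1 / 2)) * sqrt (K / N) powr (1 - \<beta> / (1 / 2))) \<longlongrightarrow> 0) at_top"
proof -
  have "((\<lambda>N. K / N) \<longlongrightarrow> 0) at_top"
    by (intro tendsto_divide_0[OF tendsto_const] filterlim_at_top_imp_at_infinity filterlim_ident)
  then have "((\<lambda>N. sqrt (K / N) powr (1 - \<beta> / (1 / 2))) \<longlongrightarrow> sqrt 0 powr (1 - \<beta> / (1 / 2))) at_top"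
    using assms eventually_mono[OF eventually_ge_at_top[of 0], of "\<lambda>N. 0 \<le> sqrt (K / N)"]
    by (intro tendsto_powr2 tendsto_real_sqrt) auto
  from tendsto_mult_left[OF this] show ?thesis
    by simp
qed

text \<open>
  A drift that is a finite combination of brackets is removed one bracket at a time. Each step
  trades one bracket for an oscillation of the underlying path. The next oscillation is added to a
  path that already contains the earlier ones, so cross terms between different oscillations
  never have to be estimated: the frequency is chosen after everything else is fixed.
\<close>

lemma area_drift_approximation:
  assumes T: "0 < T" and \<beta>: "0 < \<beta>" "\<beta> < 1 / 2"
    and c: "c \<in> area_drifts"
    and y: "y \<in> trig_paths" and v: "v \<in> trig_paths"
    and yv: "\<And>t. (y has_vector_derivative v t) (at t)"
    and Z: "driven T Z v c" and \<epsilon>: "0 < \<epsilon>"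
  shows "\<exists>x\<in>trig_paths. holder_dist tens T \<beta> Z (S2 tens x 0) \<le> ereal \<epsilon>"
  using c y v yv Z \<epsilon>
proof (induction arbitrary: y v Z \<epsilon>)
  case zero
  have lift: "driven T (S2 tens y 0) v (\<lambda>_. 0)"
    by (rule S2_driven(1)[OF less_imp_le[OF T]
          has_vector_derivative_at_within[OF zero.prems(3)] trig_paths_continuous[OF zero.prems(2)]])
  have "holder_dist tens T \<beta> Z (S2 tens y 0) \<le> ereal \<epsilon>"
  proof (rule holder_dist_le)
    fix s t assume st: "0 \<le> s" "s < t" "t \<le> T"
    then have "ginc tens Z s t = ginc tens (S2 tens y 0) s t"
      by (intro driven_ginc_unique[OF zero.prems(4) lift]) auto
    then show "gdist tens (ginc tens Z s t) (ginc tens (S2 tens y 0) s t) \<le> \<epsilon> * (t - s) powr \<beta>"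
      using zero.prems(5) by simp
  qed
  then show ?case
    using zero.prems(1) by blast
next
  case (add_bracket c f u w)
  obtain f' where f': "f' \<in> trig_polynomials" "\<And>r. (f has_real_derivative f' r) (at r)"
    using trig_polynomials_derivative[OF add_bracket.hyps(2)] by blast
  obtain b1 where b1: "\<And>r. r \<in> {0..T} \<Longrightarrow> norm (v r) \<le> b1"
    using continuous_on_interval_bounded[OF trig_paths_continuous[OF add_bracket.prems(2)]] by blast
  obtain b2 where b2: "\<And>r. r \<in> {0..T} \<Longrightarrow> norm (f r) \<le> b2"
    using continuous_on_interval_bounded[OF trig_polynomials_continuous[OF add_bracket.hyps(2)]] by blast
  obtain b3 where b3: "\<And>r. r \<in> {0..T} \<Longrightarrow> norm (f' r) \<le> b3"
    using continuous_on_interval_bounded[OF trig_polynomials_continuous[OF f'(1)]] by blast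
  \<comment> \<open>One bound for everything that does not depend on the frequency.\<close>
  define B where "B = Max {1, b1, b2, b3, norm u, norm w}"
  have B: "1 \<le> B" "norm u \<le> B" "norm w \<le> B" "b1 \<le> B" "b2 \<le> B" "b3 \<le> B"
    unfolding B_def by (intro Max_ge; simp)+
  define M where "M = 5 * B ^ 4"
  have "B \<le> B ^ 4"
    using B(1) power_increasing[of 1 4 B] by simp
  then have M: "1 \<le> M" "B \<le> M"
    using B(1) by (auto simp: M_def)
  define K where "K = (7 + 5 * T) * M\<^sup>2"
  have K: "0 \<le> K"
    using T by (simp add: K_def)
  have "\<forall>\<^sub>F N in at_top. sqrt K powr (\<beta> / (1 / 2)) * sqrt (K / N) powr (1 - \<beta> / (1 / 2)) < \<epsilon> / 2"
    by (rule order_tendstoD(2)[OF sqrt_interpolation_tendsto_0[OF \<beta> K]])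
      (use add_bracket.prems(5) in simp)
  then have "\<exists>N\<ge>1. sqrt K powr (\<beta> / (1 / 2)) * sqrt (K / N) powr (1 - \<beta> / (1 / 2)) < \<epsilon> / 2"
    unfolding eventually_at_top_linorder by (meson linorder_le_cases order_refl)
  then obtain N where N: "1 \<le> N"
    and small: "sqrt K powr (\<beta> / (1 / 2)) * sqrt (K / N) powr (1 - \<beta> / (1 / 2)) < \<epsilon> / 2"
    by blast
  let ?\<zeta> = "osc N f u w" and ?\<zeta>' = "osc_velocity N f f' u w"
  have \<zeta>: "(?\<zeta> has_vector_derivative ?\<zeta>' r) (at r)" for r
    using N f' by (intro osc_derivative) auto
  have paths: "(\<lambda>r. y r + ?\<zeta> r) \<in> trig_paths" "(\<lambda>r. v r + ?\<zeta>' r) \<in> trig_paths"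
    using add_bracket.prems add_bracket.hyps f' by (auto intro: osc_trig_path)
  have deriv: "((\<lambda>r. y r + ?\<zeta> r) has_vector_derivative v r + ?\<zeta>' r) (at r)" for r
    by (intro has_vector_derivative_add add_bracket.prems \<zeta>)
  obtain W where W: "driven T W (\<lambda>r. v r + ?\<zeta>' r) c"
    by (rule driven_exists[OF has_vector_derivative_at_within[OF deriv]
        trig_paths_continuous[OF paths(2)] area_drifts_continuous[OF add_bracket.hyps(1)]])
  let ?G = "osc_primitive N f u w"
  define h where "h r = (f' r * sin (N\<^sup>2 * r) * cos (N\<^sup>2 * r)) *\<^sub>R bracket u w" for r
  obtain G' where G': "\<And>r. (?G has_vector_derivative G' r) (at r)"
    "\<And>r. tens (?\<zeta> r) (?\<zeta>' r) - f r *\<^sub>R bracket u w = (1 / N\<^sup>2) *\<^sub>R (G' r - h r)"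
    using osc_area[of N f f' u w] N f'(2) unfolding h_def[symmetric] by auto
  have bounds: "norm (v r) \<le> M" "norm (?\<zeta> r) \<le> M / N" "norm (?\<zeta>' r) \<le> M * N"
    "norm (f r *\<^sub>R bracket u w) \<le> M" "norm (?G r) \<le> M" "norm (h r) \<le> M" if "r \<in> {0..T}" for r
  proof -
    have fB: "\<bar>f r\<bar> \<le> B" "\<bar>f' r\<bar> \<le> B"
      using b2[OF that] b3[OF that] B by auto
    show "norm (v r) \<le> M"
      using b1[OF that] B M by simp
    show "norm (?\<zeta> r) \<le> M / N" "norm (?\<zeta>' r) \<le> M * N" "norm (f r *\<^sub>R bracket u w) \<le> M"
      "norm (?G r) \<le> M" "norm (h r) \<le> M"
      unfolding M_def h_def by (rule osc_bounds[OF N B(1-3)]; rule fB)+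
  qed
  have "holder_dist tens T \<beta> Z W
      \<le> ereal (sqrt K powr (\<beta> / (1 / 2)) * sqrt (K / N) powr (1 - \<beta> / (1 / 2)))"
  proof (rule holder_dist_interpolate[OF \<beta>])
    fix s t assume st: "0 \<le> s" "s < t" "t \<le> T"
    have gdist: "gdist tens (ginc tens Z s t) (ginc tens W s t) \<le> sqrt (K * (t - s))"
      "gdist tens (ginc tens Z s t) (ginc tens W s t) \<le> sqrt (K / N)"
      unfolding K_def
      by (rule oscillation_gdist_le[OF T N M(1) st add_bracket.prems(4) W];
          (rule \<zeta> G' bounds; assumption?))+
    show "gdist tens (ginc tens Z s t) (ginc tens W s t) \<le> sqrt K * (t - s) powr (1 / 2)"
      using gdist(1) st by (simp add: real_sqrt_mult powr_half_sqrt)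
    show "gdist tens (ginc tens Z s t) (ginc tens W s t) \<le> sqrt (K / N)"
      by (rule gdist(2))
  qed (use K in simp)
  then have "holder_dist tens T \<beta> Z W \<le> ereal (\<epsilon> / 2)"
    using small by (auto intro: order_trans)
  moreover obtain x where "x \<in> trig_paths" "holder_dist tens T \<beta> W (S2 tens x 0) \<le> ereal (\<epsilon> / 2)"
    using add_bracket.IH[OF paths deriv W, of "\<epsilon> / 2"] add_bracket.prems(5) by auto
  ultimately show ?case
    using holder_dist_triangle[of T \<beta> Z W "\<epsilon> / 2" "S2 tens x 0" "\<epsilon> / 2"] by auto
qed

end

section \<open>Quasi-interpolation by Bernstein polynomials\<close>

text \<open>
  Smooth weights at the nodes \<open>\<tau> k\<close> which average on the scale \<open>h\<close>: the first absolute moment has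
  order \<open>h\<close>, and a derivative costs a factor \<open>1 / h\<close>.
\<close>

definition quasi_interpolation ::
  "real \<Rightarrow> real \<Rightarrow> real \<Rightarrow> nat \<Rightarrow> (nat \<Rightarrow> real) \<Rightarrow> (nat \<Rightarrow> real \<Rightarrow> real) \<Rightarrow> (nat \<Rightarrow> real \<Rightarrow> real) \<Rightarrow> bool"
where
  "quasi_interpolation T h C n \<tau> w w' \<longleftrightarrow>
     (\<forall>k. \<tau> k \<in> {0..T} \<and> w k \<in> trig_polynomials \<and> w' k \<in> trig_polynomials \<and>
        (\<forall>t. (w k has_real_derivative w' k t) (at t))) \<and>
     (\<forall>t\<in>{0..T}. (\<forall>k\<le>n. 0 \<le> w k t) \<and> (\<Sum>k\<le>n. w k t) = 1 \<and> (\<Sum>k\<le>n. w' k t) = 0 \<and>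
        (\<Sum>k\<le>n. w k t * \<bar>\<tau> k - t\<bar>) \<le> C * h \<and> (\<Sum>k\<le>n. \<bar>w' k t\<bar>) \<le> C / h \<and>
        (\<Sum>k\<le>n. \<bar>w' k t\<bar> * \<bar>\<tau> k - t\<bar>) \<le> C)"

lemma Bernstein_derivative:
  assumes "k \<le> n" "0 < u" "u < 1"
  shows "(Bernstein n k has_real_derivative
    Bernstein n k u * (real k - real n * u) / (u * (1 - u))) (at u)"
proof -
  have pow: "real m * z ^ (m - 1) = real m * z ^ m / z" if "z \<noteq> 0" for m and z :: real
    using that by (cases m) auto
  have "((\<lambda>u. real (n choose k) * u ^ k * (1 - u) ^ (n - k)) has_real_derivative
      real (n choose k) * (real k * u ^ (k - 1)) * (1 - u) ^ (n - k)
      - real (n choose k) * u ^ k * (real (n - k) * (1 - u) ^ (n - k - 1))) (at u)"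
    by (auto intro!: derivative_eq_intros)
  also have "real (n choose k) * (real k * u ^ (k - 1)) * (1 - u) ^ (n - k)
      - real (n choose k) * u ^ k * (real (n - k) * (1 - u) ^ (n - k - 1))
      = Bernstein n k u * (real k / u - real (n - k) / (1 - u))"
    using assms unfolding pow[of u k, OF less_imp_neq[OF assms(2), symmetric]]
    by (subst pow) (auto simp: Bernstein_def algebra_simps)
  also have "real k / u - real (n - k) / (1 - u) = (real k - real n * u) / (u * (1 - u))"
    using assms by (simp add: of_nat_diff field_simps)
  finally show ?thesis
    by (simp add: Bernstein_def[abs_def])
qed

lemma Bernstein_second_moment:
  assumes "0 < n"
  shows "(\<Sum>k\<le>n. Bernstein n k u * (real k / real n - u)\<^sup>2) = u * (1 - u) / real n"
proof -
  have eq: "Bernstein n k u * (real k / real n - u)\<^sup>2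
      = (real k * (real k - 1) * Bernstein n k u) / (real n)\<^sup>2
        + (1 / (real n)\<^sup>2 - 2 * u / real n) * (real k * Bernstein n k u)
        + u\<^sup>2 * Bernstein n k u" for k
    using assms by (simp add: power2_eq_square field_simps)
  show ?thesis
    unfolding eq sum.distrib sum_distrib_left[symmetric] sum_divide_distrib[symmetric]
      sum_kk_Bernstein sum_k_Bernstein sum_Bernstein
    using assms by (simp add: power2_eq_square field_simps)
qed

lemma Bernstein_first_moment_le:
  assumes "0 < n" "0 \<le> u" "u \<le> 1"
  shows "(\<Sum>k\<le>n. Bernstein n k u * \<bar>real k / real n - u\<bar>) \<le> 1 / sqrt (real n)"
proof -
  define h where "h = 1 / sqrt (real n)"
  have h: "0 < h" "1 / real n = h\<^sup>2"
    using assms by (simp_all add: h_def power_divide)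
  have "\<bar>x\<bar> \<le> h / 2 + x\<^sup>2 / (2 * h)" for x
    using zero_le_power2[of "h - \<bar>x\<bar>"] h by (simp add: power2_diff field_simps power2_eq_square)
  then have "(\<Sum>k\<le>n. Bernstein n k u * \<bar>real k / real n - u\<bar>)
      \<le> (\<Sum>k\<le>n. Bernstein n k u * (h / 2 + (real k / real n - u)\<^sup>2 / (2 * h)))"
    using assms by (intro sum_mono mult_left_mono Bernstein_nonneg)
  also have "\<dots> = h / 2 + (u * (1 - u) / real n) / (2 * h)"
    by (simp add: distrib_left sum.distrib sum_divide_distrib[symmetric] sum_distrib_right[symmetric]
        Bernstein_second_moment[OF assms(1)])
  also have "u * (1 - u) / real n \<le> h\<^sup>2"
    unfolding h(2)[symmetric] using assms by (intro divide_right_mono mult_le_one) auto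
  then have "(u * (1 - u) / real n) / (2 * h) \<le> h\<^sup>2 / (2 * h)"
    using h by (intro divide_right_mono) auto
  also have "h\<^sup>2 / (2 * h) = h / 2"
    using h by (simp add: power2_eq_square)
  finally show ?thesis
    by (simp add: h_def)
qed

text \<open>
  The Bernstein polynomials are stretched to \<open>[-T, 2T]\<close>. On the middle third the variance factor
  \<open>u (1 - u)\<close> is bounded below, so they average on the scale \<open>1 / sqrt n\<close> uniformly. Moving
  the nodes outside of \<open>[0, T]\<close> to the nearest end point brings them closer to every point of \<open>[0, T]\<close>.
\<close>

lemma quasi_interpolation_exists:
  assumes T: "0 < T" and n: "0 < n"
  shows "\<exists>\<tau> w w'. quasi_interpolation T (1 / sqrt (real n)) (3 * T + 3 / (2 * T) + 5) n \<tau> w w'"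
proof -
  define h where "h = 1 / sqrt (real n)"
  have h: "0 < h" "1 / real n = h\<^sup>2"
    using n by (simp_all add: h_def power_divide)
  define C where "C = 3 * T + 3 / (2 * T) + 5"
  define U where "U t = (t + T) / (3 * T)" for t
  define w where "w k t = Bernstein n k (U t)" for k t
  define \<tau> where "\<tau> k = max 0 (min T (3 * T * (real k / real n) - T))" for k
  have "(\<lambda>t. real (n choose k) * ((1 / (3 * T)) * (t + T)) ^ k
      * (1 - (1 / (3 * T)) * (t + T)) ^ (n - k)) \<in> trig_polynomials" for k
    by (intro trig_polynomials.mult trig_polynomials_power trig_polynomials.add
        trig_polynomials_diff trig_polynomials.const trig_polynomials.ident)
  then have w_poly: "w k \<in> trig_polynomials" for k
    by (simp add: w_def[abs_def] U_def Bernstein_def)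
  then have "\<forall>k. \<exists>f'\<in>trig_polynomials. \<forall>t. (w k has_real_derivative f' t) (at t)"
    using trig_polynomials_derivative by blast
  then obtain w' where w': "\<And>k. w' k \<in> trig_polynomials"
      "\<And>k t. (w k has_real_derivative w' k t) (at t)"
    by metis
  have "((\<lambda>t. \<Sum>k\<le>n. w k t) has_real_derivative (\<Sum>k\<le>n. w' k t)) (at t)" for t
    by (intro DERIV_sum w')
  then have sum_w': "(\<Sum>k\<le>n. w' k t) = 0" for t
    unfolding w_def by (auto intro: DERIV_unique[OF _ DERIV_const])
  have pointwise: "(\<forall>k\<le>n. 0 \<le> w k t) \<and> (\<Sum>k\<le>n. w k t) = 1 \<and> (\<Sum>k\<le>n. w' k t) = 0 \<and>
      (\<Sum>k\<le>n. w k t * \<bar>\<tau> k - t\<bar>) \<le> C * h \<and> (\<Sum>k\<le>n. \<bar>w' k t\<bar>) \<le> C / h \<and>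
      (\<Sum>k\<le>n. \<bar>w' k t\<bar> * \<bar>\<tau> k - t\<bar>) \<le> C" if t: "t \<in> {0..T}" for t
  proof -
    define u where "u = U t"
    have u: "1 / 3 \<le> u" "u \<le> 2 / 3" and tu: "t = 3 * T * u - T"
      using t T by (auto simp: u_def U_def field_simps)
    have var: "2 / 9 \<le> u * (1 - u)"
    proof -
      have "0 \<le> (u - 1 / 3) * (2 / 3 - u)"
        using u by (intro mult_nonneg_nonneg) auto
      then show ?thesis
        by (simp add: field_simps)
    qed
    have w_nonneg: "0 \<le> w k t" for k
      using u by (simp add: w_def Bernstein_nonneg flip: u_def)
    have w'_eq: "w' k t = w k t * (real k - real n * u) / (u * (1 - u)) * (1 / (3 * T))"
      if "k \<le> n" for k
    proof (rule DERIV_unique[OF w'(2)])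
      have "(Bernstein n k has_real_derivative
          Bernstein n k (U t) * (real k - real n * U t) / (U t * (1 - U t))) (at (U t))"
        using that u by (intro Bernstein_derivative) (auto simp: u_def)
      moreover have "(U has_real_derivative 1 / (3 * T)) (at t)"
        unfolding U_def[abs_def] using T by (auto intro!: derivative_eq_intros)
      ultimately show "(w k has_real_derivative
          w k t * (real k - real n * u) / (u * (1 - u)) * (1 / (3 * T))) (at t)"
        unfolding w_def[abs_def] u_def by (rule DERIV_chain2)
    qed
    let ?d = "\<lambda>k. \<bar>real k / real n - u\<bar>"
    \<comment> \<open>\<open>A = n / (2/9) / (3T)\<close>: variance bound \<open>2/9\<close> and inner derivative \<open>1 / (3T)\<close>.\<close>
    define A where "A = 3 * real n / (2 * T)"
    have A: "0 \<le> A"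
      using T by (simp add: A_def)
    have w'_le: "\<bar>w' k t\<bar> \<le> A * (w k t * ?d k)" if "k \<le> n" for k
    proof -
      have "real k - real n * u = real n * (real k / real n - u)"
        using n by (simp add: field_simps)
      then have "\<bar>w' k t\<bar> = (real n * (w k t * ?d k)) / (u * (1 - u)) * (1 / (3 * T))"
        using w'_eq[OF that] w_nonneg[of k] u T by (simp add: abs_mult)
      also have "\<dots> \<le> (real n * (w k t * ?d k)) / (2 / 9) * (1 / (3 * T))"
        using var w_nonneg[of k] T u by (intro mult_right_mono divide_left_mono mult_pos_pos) auto
      also have "\<dots> = A * (w k t * ?d k)"
        using T by (simp add: A_def field_simps)
      finally show ?thesis .
    qed
    have \<tau>_le: "\<bar>\<tau> k - t\<bar> \<le> 3 * T * ?d k" for k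
    proof -
      have "\<bar>\<tau> k - t\<bar> \<le> \<bar>(3 * T * (real k / real n) - T) - t\<bar>"
        using t by (auto simp: \<tau>_def)
      also have "(3 * T * (real k / real n) - T) - t = 3 * T * (real k / real n - u)"
        by (simp add: tu algebra_simps)
      finally show ?thesis
        using T by (simp add: abs_mult)
    qed
    have m1: "(\<Sum>k\<le>n. w k t * ?d k) \<le> h"
      unfolding w_def h_def u_def[symmetric] using n u by (intro Bernstein_first_moment_le) auto
    have m2: "(\<Sum>k\<le>n. w k t * (?d k)\<^sup>2) \<le> h\<^sup>2 / 4"
    proof -
      have "0 \<le> (u - 1 / 2)\<^sup>2" by simp
      then have "u * (1 - u) \<le> 1 / 4"
        by (simp add: power2_eq_square algebra_simps)
      then have "u * (1 - u) * (1 / real n) \<le> 1 / 4 * h\<^sup>2"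
        unfolding h(2) by (intro mult_right_mono) auto
      then show ?thesis
        using Bernstein_second_moment[OF n, of u] by (simp add: w_def u_def)
    qed
    have "(\<Sum>k\<le>n. w k t * \<bar>\<tau> k - t\<bar>) \<le> (\<Sum>k\<le>n. 3 * T * (w k t * ?d k))"
      using mult_left_mono[OF \<tau>_le w_nonneg] by (intro sum_mono) (simp add: mult_ac)
    also have "\<dots> \<le> 3 * T * h"
      unfolding sum_distrib_left[symmetric] using m1 T by (intro mult_left_mono) auto
    also have "\<dots> \<le> C * h"
      using T h by (intro mult_right_mono) (auto simp: C_def)
    finally have c1: "(\<Sum>k\<le>n. w k t * \<bar>\<tau> k - t\<bar>) \<le> C * h" .
    have "(\<Sum>k\<le>n. \<bar>w' k t\<bar>) \<le> (\<Sum>k\<le>n. A * (w k t * ?d k))"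
      by (intro sum_mono w'_le) auto
    also have "\<dots> \<le> A * h"
      unfolding sum_distrib_left[symmetric] using m1 A by (intro mult_left_mono) auto
    also have "A * h = 3 / (2 * T) / h"
    proof -
      have "real n = 1 / h\<^sup>2"
        using h n by (simp add: field_simps)
      then show ?thesis
        using h by (simp add: A_def power2_eq_square)
    qed
    also have "\<dots> \<le> C / h"
      using T h by (intro divide_right_mono) (auto simp: C_def)
    finally have c2: "(\<Sum>k\<le>n. \<bar>w' k t\<bar>) \<le> C / h" .
    have "(\<Sum>k\<le>n. \<bar>w' k t\<bar> * \<bar>\<tau> k - t\<bar>) \<le> (\<Sum>k\<le>n. (A * (w k t * ?d k)) * (3 * T * ?d k))"
      using A w_nonneg by (intro sum_mono mult_mono w'_le \<tau>_le) auto
    also have "\<dots> = 3 * T * A * (\<Sum>k\<le>n. w k t * (?d k)\<^sup>2)"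
      unfolding sum_distrib_left by (intro sum.cong refl) (simp only: power2_eq_square mult_ac)
    also have "\<dots> \<le> 3 * T * A * (h\<^sup>2 / 4)"
      using A T by (intro mult_left_mono m2) auto
    also have "\<dots> = 9 / 8"
      using T n unfolding h(2)[symmetric] by (simp add: A_def)
    also have "\<dots> \<le> C"
      using T by (simp add: C_def add_nonneg_nonneg)
    finally have c3: "(\<Sum>k\<le>n. \<bar>w' k t\<bar> * \<bar>\<tau> k - t\<bar>) \<le> C" .
    have "(\<Sum>k\<le>n. w k t) = 1"
      by (simp add: w_def)
    with w_nonneg sum_w' c1 c2 c3 show ?thesis
      by blast
  qed
  have "\<tau> k \<in> {0..T}" for k
    using T by (auto simp: \<tau>_def)
  then have "quasi_interpolation T h C n \<tau> w w'"
    using w_poly w' pointwise unfolding quasi_interpolation_def by blast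
  then show ?thesis
    unfolding h_def C_def by blast
qed

text \<open>Fractional moments of order at most one are controlled by the moments of order zero and one.\<close>

lemma powr_le_linear:
  fixes x h p :: real
  assumes "0 \<le> x" "0 < h" "0 \<le> p" "p \<le> 1"
  shows "x powr p \<le> h powr p + h powr (p - 1) * x"
proof (cases "x \<le> h")
  case True
  then have "x powr p \<le> h powr p"
    using assms by (intro powr_mono2) auto
  then show ?thesis
    using assms by (simp add: add_increasing2)
next
  case False
  then have "x powr p = x powr (p - 1) * x"
    using assms by (simp add: powr_diff)
  also have "\<dots> \<le> h powr (p - 1) * x"
    using assms False by (intro mult_right_mono powr_mono2') auto
  finally show ?thesis
    by (simp add: add_increasing)
qed

lemma quasi_interpolation_moments:
  assumes qi: "quasi_interpolation T h C n \<tau> w w'" and t: "t \<in> {0..T}"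
    and h: "0 < h" and p: "0 \<le> p" "p \<le> 1"
  shows "(\<Sum>k\<le>n. w k t * \<bar>\<tau> k - t\<bar> powr p) \<le> (1 + C) * h powr p"
    and "(\<Sum>k\<le>n. \<bar>w' k t\<bar> * \<bar>\<tau> k - t\<bar> powr p) \<le> 2 * C * h powr (p - 1)"
proof -
  have w: "\<And>k. k \<le> n \<Longrightarrow> 0 \<le> w k t" "(\<Sum>k\<le>n. w k t) = 1"
    "(\<Sum>k\<le>n. w k t * \<bar>\<tau> k - t\<bar>) \<le> C * h" "(\<Sum>k\<le>n. \<bar>w' k t\<bar>) \<le> C / h"
    "(\<Sum>k\<le>n. \<bar>w' k t\<bar> * \<bar>\<tau> k - t\<bar>) \<le> C"
    using qi t unfolding quasi_interpolation_def by auto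
  have hp: "h powr (p - 1) * h = h powr p" "h powr p / h = h powr (p - 1)"
    using h by (simp_all add: powr_diff)
  have "(\<Sum>k\<le>n. w k t * \<bar>\<tau> k - t\<bar> powr p)
      \<le> (\<Sum>k\<le>n. w k t * (h powr p + h powr (p - 1) * \<bar>\<tau> k - t\<bar>))"
    by (intro sum_mono mult_left_mono powr_le_linear w h p) auto
  also have "\<dots> = h powr p * (\<Sum>k\<le>n. w k t) + h powr (p - 1) * (\<Sum>k\<le>n. w k t * \<bar>\<tau> k - t\<bar>)"
    by (simp add: distrib_left sum.distrib sum_distrib_left mult_ac)
  also have "\<dots> \<le> h powr p * 1 + h powr (p - 1) * (C * h)"
    unfolding w(2) by (intro add_mono mult_left_mono w) auto
  also have "\<dots> = (1 + C) * h powr p"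
    by (simp add: hp(1)[symmetric] algebra_simps)
  finally show "(\<Sum>k\<le>n. w k t * \<bar>\<tau> k - t\<bar> powr p) \<le> (1 + C) * h powr p" .
  have "(\<Sum>k\<le>n. \<bar>w' k t\<bar> * \<bar>\<tau> k - t\<bar> powr p)
      \<le> (\<Sum>k\<le>n. \<bar>w' k t\<bar> * (h powr p + h powr (p - 1) * \<bar>\<tau> k - t\<bar>))"
    by (intro sum_mono mult_left_mono powr_le_linear h p) auto
  also have "\<dots> = h powr p * (\<Sum>k\<le>n. \<bar>w' k t\<bar>) + h powr (p - 1) * (\<Sum>k\<le>n. \<bar>w' k t\<bar> * \<bar>\<tau> k - t\<bar>)"
    by (simp add: distrib_left sum.distrib sum_distrib_left mult_ac)
  also have "\<dots> \<le> h powr p * (C / h) + h powr (p - 1) * C"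
    by (intro add_mono mult_left_mono w) auto
  also have "\<dots> = 2 * C * h powr (p - 1)"
    by (simp add: hp(2)[symmetric])
  finally show "(\<Sum>k\<le>n. \<bar>w' k t\<bar> * \<bar>\<tau> k - t\<bar> powr p) \<le> 2 * C * h powr (p - 1)" .
qed

section \<open>Smoothing a weakly geometric rough path\<close>

text \<open>
  Identities with factors \<open>1/2\<close> are checked by distributing all scalars and collecting equal halves;
  the second rule finds a pair inside of a longer sum.
\<close>

lemma half_plus_half:
  fixes y z :: "'c::real_vector"
  shows "(1 / 2) *\<^sub>R z + (1 / 2) *\<^sub>R z = z" "(1 / 2) *\<^sub>R z + ((1 / 2) *\<^sub>R z + y) = z + y"
proof -
  show z: "(1 / 2) *\<^sub>R z + (1 / 2) *\<^sub>R z = z"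
    by (simp flip: scaleR_left_distrib)
  show "(1 / 2) *\<^sub>R z + ((1 / 2) *\<^sub>R z + y) = z + y"
    by (simp only: add.assoc[symmetric] z)
qed

context tensor_group
begin

lemma bracket_algebra:
  "bracket (x + y) z = bracket x z + bracket y z" "bracket z (x + y) = bracket z x + bracket z y"
  "bracket (x - y) z = bracket x z - bracket y z" "bracket z (x - y) = bracket z x - bracket z y"
  "bracket x x = 0"
  by (simp_all add: tens_algebra)

lemma norm_bracket_bound: "norm x \<le> r \<Longrightarrow> norm y \<le> q \<Longrightarrow> norm (bracket x y) \<le> 2 * (r * q)"
  using norm_triangle_le_diff[OF add_mono[OF norm_tens_bound norm_tens_bound], of x r y q y q x r]
  by (simp add: mult.commute)

text \<open>
  The estimates for a driven path \<open>Y\<close> that shadows \<open>X\<close> at distance of order \<open>h powr \<alpha>\<close>. On time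
  intervals shorter than \<open>h\<close>, the bounds on velocity and drift have the right order. On longer
  ones, \<open>Y_st = g_s\<^sup>-\<^sup>1 X_st g_t\<close> with \<open>g = X\<^sup>-\<^sup>1 Y\<close> small, so \<open>Y\<close> inherits the regularity of \<open>X\<close>.
\<close>

lemma shadowing_path_estimates:
  assumes h: "0 < h" and \<alpha>: "0 < \<alpha>" "\<alpha> < 1 / 2" and Q: "1 \<le> Q"
    and X: "\<And>s t. s \<in> {0..T} \<Longrightarrow> t \<in> {0..T} \<Longrightarrow> gnorm (ginc tens X s t) \<le> Q * \<bar>t - s\<bar> powr \<alpha>"
    and Y: "driven T Y v c"
    and v: "\<And>t. t \<in> {0..T} \<Longrightarrow> norm (v t) \<le> Q * h powr (\<alpha> - 1)"
    and c: "\<And>t. t \<in> {0..T} \<Longrightarrow> norm (c t) \<le> Q * h powr (2 * \<alpha> - 1)"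
    and g: "\<And>t. t \<in> {0..T} \<Longrightarrow> gdist tens (X t) (Y t) \<le> 2 * Q * h powr \<alpha>"
    and st: "0 \<le> s" "s < t" "t \<le> T"
  shows "gdist tens (ginc tens X s t) (ginc tens Y s t) \<le> 9 * Q * (t - s) powr \<alpha>"
    and "gdist tens (ginc tens X s t) (ginc tens Y s t)
      \<le> sqrt ((4 * Q * h powr \<alpha>)\<^sup>2 + 2 * (Q * T powr \<alpha>) * (4 * Q * h powr \<alpha>)) + 2 * Q * h powr \<alpha>"
proof -
  have mem: "s \<in> {0..T}" "t \<in> {0..T}"
    using st by auto
  have Xst: "gnorm (ginc tens X s t) \<le> Q * (t - s) powr \<alpha>"
    using X[OF mem] st by simp
  define gs where "gs = gmult tens (ginv tens (X s)) (Y s)"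
  define gt where "gt = gmult tens (ginv tens (X t)) (Y t)"
  have gs: "gnorm gs \<le> 2 * Q * h powr \<alpha>" and gt: "gnorm gt \<le> 2 * Q * h powr \<alpha>"
    using g[OF mem(1)] g[OF mem(2)] by (simp_all add: gs_def gt_def gdist_def)
  have gs_inv: "gnorm (ginv tens gs) \<le> 4 * Q * h powr \<alpha>"
    using order_trans[OF gnorm_ginv_le mult_left_mono[OF gs, of 2]] by simp
  have Yst: "ginc tens Y s t = gmult tens (gmult tens (ginv tens gs) (ginc tens X s t)) gt"
    by (simp add: gs_def gt_def ginc_def ginv_gmult gmult_assoc[OF bilinear_tens])
  have "gnorm (ginc tens Y s t) \<le> 7 * Q * (t - s) powr \<alpha>"
  proof (cases "t - s \<le> h")
    case True
    let ?d = "t - s"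
    have "gnorm (ginc tens Y s t)
        \<le> sqrt ((Q * h powr (\<alpha> - 1) * ?d)\<^sup>2 + Q * h powr (2 * \<alpha> - 1) * ?d)"
      using st by (intro driven_gnorm_ginc_le[OF Y] v c) auto
    also have "\<dots> \<le> sqrt ((Q * ?d powr \<alpha>)\<^sup>2 + Q * ?d powr (2 * \<alpha>))"
    proof -
      have "h powr (\<alpha> - 1) * ?d \<le> ?d powr (\<alpha> - 1) * ?d"
        using st True \<alpha> by (intro mult_right_mono powr_mono2') auto
      moreover have "?d powr (\<alpha> - 1) * ?d = ?d powr \<alpha>"
        using st by (simp add: powr_diff)
      moreover have "h powr (2 * \<alpha> - 1) * ?d \<le> ?d powr (2 * \<alpha> - 1) * ?d"
        using st True \<alpha> by (intro mult_right_mono powr_mono2') auto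
      moreover have "?d powr (2 * \<alpha> - 1) * ?d = ?d powr (2 * \<alpha>)"
        using st by (simp add: powr_diff)
      ultimately have le: "h powr (\<alpha> - 1) * ?d \<le> ?d powr \<alpha>" "h powr (2 * \<alpha> - 1) * ?d \<le> ?d powr (2 * \<alpha>)"
        by simp_all
      show ?thesis
        unfolding mult.assoc using Q st le
        by (intro real_sqrt_le_mono add_mono power_mono mult_left_mono) auto
    qed
    also have "\<dots> \<le> sqrt ((7 * Q * ?d powr \<alpha>)\<^sup>2)"
    proof (rule real_sqrt_le_mono)
      have "Q \<le> Q\<^sup>2" using Q by (simp add: power2_eq_square)
      then have "Q\<^sup>2 + Q \<le> 49 * Q\<^sup>2"
        using zero_le_power2[of Q] by linarith
      then have "(Q\<^sup>2 + Q) * (?d powr \<alpha>)\<^sup>2 \<le> (49 * Q\<^sup>2) * (?d powr \<alpha>)\<^sup>2"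
        by (intro mult_right_mono) auto
      then show "(Q * ?d powr \<alpha>)\<^sup>2 + Q * ?d powr (2 * \<alpha>) \<le> (7 * Q * ?d powr \<alpha>)\<^sup>2"
        by (simp add: powr_double power_mult_distrib distrib_right)
    qed
    finally show ?thesis
      using Q by simp
  next
    case False
    then have "h powr \<alpha> \<le> (t - s) powr \<alpha>"
      using h \<alpha> by (intro powr_mono2) auto
    then have hQ: "Q * h powr \<alpha> \<le> Q * (t - s) powr \<alpha>"
      using Q by (intro mult_left_mono) auto
    have "gnorm (ginc tens Y s t) \<le> (4 * Q * h powr \<alpha> + Q * (t - s) powr \<alpha>) + 2 * Q * h powr \<alpha>"
      unfolding Yst
      by (intro order_trans[OF gnorm_gmult_le add_mono] order_refl gs_inv Xst gt)
    then show ?thesis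
      using hQ by simp
  qed
  then show "gdist tens (ginc tens X s t) (ginc tens Y s t) \<le> 9 * Q * (t - s) powr \<alpha>"
    using gdist_le_gnorm[of "ginc tens X s t" "ginc tens Y s t"] Xst by simp
  have "gnorm (ginc tens X s t) \<le> Q * T powr \<alpha>"
    using st \<alpha> Q by (intro order_trans[OF Xst] mult_left_mono powr_mono2) auto
  note conj = gnorm_conjugate_le[OF gs_inv this]
  have "gdist tens (ginc tens X s t) (ginc tens Y s t)
      = gnorm (gmult tens (gmult tens (ginv tens (ginc tens X s t))
          (gmult tens (ginv tens gs) (ginc tens X s t))) gt)"
    by (simp add: gdist_def Yst gmult_assoc[OF bilinear_tens])
  also have "\<dots> \<le> sqrt ((4 * Q * h powr \<alpha>)\<^sup>2 + 2 * (Q * T powr \<alpha>) * (4 * Q * h powr \<alpha>))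
      + 2 * Q * h powr \<alpha>"
    by (intro order_trans[OF gnorm_gmult_le add_mono] conj gt)
  finally show "gdist tens (ginc tens X s t) (ginc tens Y s t)
      \<le> sqrt ((4 * Q * h powr \<alpha>)\<^sup>2 + 2 * (Q * T powr \<alpha>) * (4 * Q * h powr \<alpha>)) + 2 * Q * h powr \<alpha>" .
qed

text \<open>
  In logarithmic coordinates \<open>(x, a)\<close> of \<open>X\<close>, both components are averaged with the same weights.
  The group increment between \<open>t\<close> and a node \<open>\<tau>\<close> has second coordinate \<open>a \<tau> - a t - 1/2 [x t, x \<tau>]\<close>,
  which is affine in the values at the node. Hence averaging over the nodes commutes with this
  increment and the error of the average is an average of increments of \<open>X\<close>. The values \<open>a \<tau>\<close> are
  replaced by nearby finite sums of brackets, so that the drift becomes a finite combination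
  of brackets as well.
\<close>

lemma smoothing:
  assumes h: "0 < h" and \<alpha>: "0 < \<alpha>" "\<alpha> < 1 / 2" and K: "0 \<le> K" and C: "0 \<le> C"
    and qi: "quasi_interpolation T h C n \<tau> w w'"
    and XG: "\<And>t. t \<in> {0..T} \<Longrightarrow> X t \<in> G2 tens"
    and X: "\<And>s t. s \<in> {0..T} \<Longrightarrow> t \<in> {0..T} \<Longrightarrow> gnorm (ginc tens X s t) \<le> K * \<bar>t - s\<bar> powr \<alpha>"
  defines "P \<equiv> K * (1 + C)" and "V \<equiv> 2 * K * C" and "S \<equiv> 2 * K\<^sup>2 * (1 + C) + 1"
    and "D \<equiv> 4 * K\<^sup>2 * C + C"
  obtains Y y v c where "y \<in> trig_paths" "v \<in> trig_paths"
    "\<And>t. (y has_vector_derivative v t) (at t)" "c \<in> area_drifts" "driven T Y v c"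
    "\<And>t. t \<in> {0..T} \<Longrightarrow> norm (v t) \<le> V * h powr (\<alpha> - 1)"
    "\<And>t. t \<in> {0..T} \<Longrightarrow> norm (c t) \<le> (D + P * V) * h powr (2 * \<alpha> - 1)"
    "\<And>t. t \<in> {0..T} \<Longrightarrow> gdist tens (X t) (Y t) \<le> (P + S + 1) * h powr \<alpha>"
proof -
  define x where "x t = fst (X t)" for t
  define a where "a t = snd (X t) - (1 / 2) *\<^sub>R tens (x t) (x t)" for t
  have \<tau>: "\<tau> k \<in> {0..T}" for k
    using qi unfolding quasi_interpolation_def by blast
  have w_poly: "w k \<in> trig_polynomials" "w' k \<in> trig_polynomials"
    and w': "(w k has_real_derivative w' k t) (at t)" for k t
    using qi unfolding quasi_interpolation_def by blast+
  have w_nonneg: "0 \<le> w k t" and sum_w: "(\<Sum>k\<le>n. w k t) = 1" and sum_w': "(\<Sum>k\<le>n. w' k t) = 0"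
    and sum_abs: "(\<Sum>k\<le>n. \<bar>w' k t\<bar>) \<le> C / h" if "t \<in> {0..T}" "k \<le> n" for t k
    using qi that unfolding quasi_interpolation_def by blast+
  have "\<exists>b. b \<in> antisymmetric \<and> norm (b - a (\<tau> k)) \<le> h powr (2 * \<alpha>)" for k
  proof -
    have "a (\<tau> k) \<in> closure antisymmetric"
      unfolding a_def x_def by (rule iffD1[OF G2_iff XG[OF \<tau>]])
    then have approach: "\<forall>e>0. \<exists>z\<in>antisymmetric. dist z (a (\<tau> k)) < e"
      by (rule iffD1[OF closure_approachable])
    have "0 < h powr (2 * \<alpha>)"
      using h by simp
    then obtain z where z: "z \<in> antisymmetric" "dist z (a (\<tau> k)) < h powr (2 * \<alpha>)"
      by (rule bexE[OF mp[OF spec[OF approach]]])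
    from z(2) have "norm (z - a (\<tau> k)) \<le> h powr (2 * \<alpha>)"
      by (simp add: dist_norm)
    with z(1) show ?thesis
      by (intro exI conjI)
  qed
  then have "\<exists>b. \<forall>k. b k \<in> antisymmetric \<and> norm (b k - a (\<tau> k)) \<le> h powr (2 * \<alpha>)"
    by (intro choice allI)
  then obtain b where b_spec: "\<forall>k. b k \<in> antisymmetric \<and> norm (b k - a (\<tau> k)) \<le> h powr (2 * \<alpha>)"
    by (elim exE)
  have b: "b k \<in> antisymmetric" and b_close: "norm (b k - a (\<tau> k)) \<le> h powr (2 * \<alpha>)" for k
    by (rule spec[OF b_spec, THEN conjunct1], rule spec[OF b_spec, THEN conjunct2])

  have x_inc: "norm (x (\<tau> k) - x t) \<le> K * \<bar>\<tau> k - t\<bar> powr \<alpha>" if "t \<in> {0..T}" for k t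
    using norm_fst_le_gnorm[of "ginc tens X t (\<tau> k)"] X[OF that \<tau>, of k]
    by (simp add: ginc_apply x_def)
  \<comment> \<open>The antisymmetric part of the increment of \<open>X\<close> from \<open>t\<close> to \<open>\<tau> k\<close>, up to the replacement of \<open>a\<close> by \<open>b\<close>.\<close>
  define E where "E k t = b k - a t - (1 / 2) *\<^sub>R bracket (x t) (x (\<tau> k))" for k t
  have E: "norm (E k t) \<le> 2 * K\<^sup>2 * \<bar>\<tau> k - t\<bar> powr (2 * \<alpha>) + h powr (2 * \<alpha>)" if t: "t \<in> {0..T}" for k t
  proof -
    let ?r = "\<bar>\<tau> k - t\<bar> powr \<alpha>" and ?g = "ginc tens X t (\<tau> k)" and ?d = "x (\<tau> k) - x t"
    have "a (\<tau> k) - a t - (1 / 2) *\<^sub>R bracket (x t) (x (\<tau> k))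
        = snd ?g - (1 / 2) *\<^sub>R tens ?d ?d"
      by (simp add: a_def x_def ginc_apply tens_algebra algebra_simps half_plus_half)
    then have "E k t = (snd ?g - (1 / 2) *\<^sub>R tens ?d ?d) + (b k - a (\<tau> k))"
      unfolding E_def by (simp add: algebra_simps)
    also have "norm \<dots> \<le> ((K * ?r)\<^sup>2 + (1 / 2) * (K * ?r * (K * ?r))) + h powr (2 * \<alpha>)"
    proof (intro norm_triangle_mono b_close norm_triangle_le_diff[OF add_mono])
      show "norm (snd ?g) \<le> (K * ?r)\<^sup>2"
        using norm_snd_le_gnorm power_mono[OF X[OF t \<tau>, of k] gnorm_nonneg, of 2]
        by (rule order_trans)
      show "norm ((1 / 2) *\<^sub>R tens ?d ?d) \<le> (1 / 2) * (K * ?r * (K * ?r))"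
        using norm_tens_bound[OF x_inc[OF t] x_inc[OF t], of k k] by simp
    qed
    also have "\<dots> \<le> 2 * K\<^sup>2 * \<bar>\<tau> k - t\<bar> powr (2 * \<alpha>) + h powr (2 * \<alpha>)"
    proof -
      have "K * ?r * (K * ?r) = (K * ?r)\<^sup>2"
        by (simp only: power2_eq_square)
      moreover have "2 * K\<^sup>2 * \<bar>\<tau> k - t\<bar> powr (2 * \<alpha>) = 2 * (K * ?r)\<^sup>2"
        by (simp only: powr_double power_mult_distrib mult.assoc)
      ultimately show ?thesis
        using zero_le_power2[of "K * ?r"] by linarith
    qed
    finally show ?thesis .
  qed

  define y where "y t = (\<Sum>k\<le>n. w k t *\<^sub>R x (\<tau> k))" for t
  define v where "v t = (\<Sum>k\<le>n. w' k t *\<^sub>R x (\<tau> k))" for t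
  define \<eta> where "\<eta> t = (\<Sum>k\<le>n. w k t *\<^sub>R b k)" for t
  define \<eta>' where "\<eta>' t = (\<Sum>k\<le>n. w' k t *\<^sub>R b k)" for t
  define c where "c t = \<eta>' t - (1 / 2) *\<^sub>R bracket (y t) (v t)" for t
  define Y where "Y t = (y t, (1 / 2) *\<^sub>R tens (y t) (y t) + \<eta> t)" for t

  have y_path: "y \<in> trig_paths" and v_path: "v \<in> trig_paths"
    unfolding y_def[abs_def] v_def[abs_def] by (intro trig_paths_sum w_poly)+
  have yv: "(y has_vector_derivative v t) (at t)" and \<eta>\<eta>': "(\<eta> has_vector_derivative \<eta>' t) (at t)" for t
    unfolding y_def[abs_def] v_def \<eta>_def[abs_def] \<eta>'_def
    by (intro has_vector_derivative_sum scaleR_const_derivative w')+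
  have c_area: "c \<in> area_drifts"
  proof -
    have "(\<lambda>t. (\<Sum>k\<le>n. w' k t *\<^sub>R b k)
        + (\<Sum>j\<le>n. \<Sum>k\<le>n. ((- 1 / 2) * (w j t * w' k t)) *\<^sub>R bracket (x (\<tau> j)) (x (\<tau> k)))) \<in> area_drifts"
      by (intro area_drifts_add area_drifts_sum area_drifts_antisymmetric area_drifts_bracket b
          trig_polynomials_cmult trig_polynomials.mult w_poly)
    also have "(\<lambda>t. (\<Sum>k\<le>n. w' k t *\<^sub>R b k)
        + (\<Sum>j\<le>n. \<Sum>k\<le>n. ((- 1 / 2) * (w j t * w' k t)) *\<^sub>R bracket (x (\<tau> j)) (x (\<tau> k)))) = c"
    proof
      fix t
      have "tens (y t) (v t) = (\<Sum>j\<le>n. \<Sum>k\<le>n. (w j t * w' k t) *\<^sub>R tens (x (\<tau> j)) (x (\<tau> k)))"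
        by (simp add: y_def v_def sum_left sum_right scaleR_left scaleR_right scaleR_sum_right)
          (subst sum.swap, simp add: mult.commute)
      moreover have "tens (v t) (y t) = (\<Sum>j\<le>n. \<Sum>k\<le>n. (w j t * w' k t) *\<^sub>R tens (x (\<tau> k)) (x (\<tau> j)))"
        unfolding y_def v_def sum_left sum_right scaleR_left scaleR_right scaleR_sum_right
        by (simp add: mult.commute)
      ultimately have "(1 / 2) *\<^sub>R bracket (y t) (v t)
          = (\<Sum>j\<le>n. \<Sum>k\<le>n. ((1 / 2) * (w j t * w' k t)) *\<^sub>R bracket (x (\<tau> j)) (x (\<tau> k)))"
        by (simp add: sum_subtractf[symmetric] scaleR_diff_right[symmetric] scaleR_sum_right)
      then show "(\<Sum>k\<le>n. w' k t *\<^sub>R b k)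
          + (\<Sum>j\<le>n. \<Sum>k\<le>n. ((- 1 / 2) * (w j t * w' k t)) *\<^sub>R bracket (x (\<tau> j)) (x (\<tau> k))) = c t"
        by (simp add: c_def \<eta>'_def sum_negf)
    qed
    finally show ?thesis .
  qed
  have Y_driven: "driven T Y v c"
    unfolding driven_def
  proof (intro ballI conjI)
    fix t assume "t \<in> {0..T}"
    show "((\<lambda>t. fst (Y t)) has_vector_derivative v t) (at t within {0..T})"
      using has_vector_derivative_at_within[OF yv] by (simp add: Y_def)
    have "((\<lambda>t. (1 / 2) *\<^sub>R tens (y t) (y t) + \<eta> t) has_vector_derivative
        (1 / 2) *\<^sub>R (tens (y t) (v t) + tens (v t) (y t)) + \<eta>' t) (at t within {0..T})"
      by (intro has_vector_derivative_add has_vector_derivative_at_within[OF \<eta>\<eta>']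
          bounded_linear.has_vector_derivative[OF bounded_linear_scaleR_right]
          has_vector_derivative has_vector_derivative_at_within[OF yv])
    then show "((\<lambda>t. snd (Y t)) has_vector_derivative tens (fst (Y t)) (v t) + c t) (at t within {0..T})"
      unfolding Y_def fst_conv snd_conv
      by (rule has_vector_derivative_eq_rhs) (simp add: c_def algebra_simps half_plus_half)
  qed

  \<comment> \<open>The weights sum to one and their derivatives to zero, so values at \<open>t\<close> can be subtracted freely.\<close>
  have e_eq: "y t - x t = (\<Sum>k\<le>n. w k t *\<^sub>R (x (\<tau> k) - x t))"
    and v_eq: "v t = (\<Sum>k\<le>n. w' k t *\<^sub>R (x (\<tau> k) - x t))" if "t \<in> {0..T}" for t
    using sum_w[OF that le0] sum_w'[OF that le0]
    by (simp_all add: y_def v_def scaleR_diff_right sum_subtractf flip: scaleR_sum_left)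
  have F_eq: "\<eta> t - a t - (1 / 2) *\<^sub>R bracket (x t) (y t) = (\<Sum>k\<le>n. w k t *\<^sub>R E k t)"
    and c_eq: "c t = (\<Sum>k\<le>n. w' k t *\<^sub>R E k t) - (1 / 2) *\<^sub>R bracket (y t - x t) (v t)"
    if t: "t \<in> {0..T}" for t
  proof -
    have sumE: "(\<Sum>k\<le>n. f k *\<^sub>R E k t) = (\<Sum>k\<le>n. f k *\<^sub>R b k) - (\<Sum>k\<le>n. f k) *\<^sub>R a t
        - (1 / 2) *\<^sub>R bracket (x t) (\<Sum>k\<le>n. f k *\<^sub>R x (\<tau> k))" for f
      by (simp add: E_def sum_left sum_right scaleR_left scaleR_right scaleR_sum_left
          scaleR_sum_right sum_subtractf scaleR_diff_right mult.commute)
    show "\<eta> t - a t - (1 / 2) *\<^sub>R bracket (x t) (y t) = (\<Sum>k\<le>n. w k t *\<^sub>R E k t)"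
      unfolding sumE sum_w[OF t le0] by (simp add: \<eta>_def y_def)
    have "(\<Sum>k\<le>n. w' k t *\<^sub>R E k t) = \<eta>' t - (1 / 2) *\<^sub>R bracket (x t) (v t)"
      unfolding sumE sum_w'[OF t le0] by (simp add: \<eta>'_def v_def)
    then show "c t = (\<Sum>k\<le>n. w' k t *\<^sub>R E k t) - (1 / 2) *\<^sub>R bracket (y t - x t) (v t)"
      by (simp add: c_def bracket_algebra scaleR_diff_right)
  qed

  have e_le: "norm (y t - x t) \<le> P * h powr \<alpha>" if t: "t \<in> {0..T}" for t
  proof -
    have "norm (y t - x t) \<le> (\<Sum>k\<le>n. K * (w k t * \<bar>\<tau> k - t\<bar> powr \<alpha>))"
      unfolding e_eq[OF t] using w_nonneg[OF t] mult_left_mono[OF x_inc[OF t] w_nonneg[OF t]]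
      by (intro sum_norm_le) (auto simp: mult_ac)
    also have "\<dots> \<le> K * ((1 + C) * h powr \<alpha>)"
      unfolding sum_distrib_left[symmetric]
      using \<alpha> K by (intro mult_left_mono quasi_interpolation_moments(1)[OF qi t h]) auto
    finally show ?thesis
      by (simp add: P_def mult.assoc)
  qed
  have v_le: "norm (v t) \<le> V * h powr (\<alpha> - 1)" if t: "t \<in> {0..T}" for t
  proof -
    have "norm (v t) \<le> (\<Sum>k\<le>n. K * (\<bar>w' k t\<bar> * \<bar>\<tau> k - t\<bar> powr \<alpha>))"
      unfolding v_eq[OF t] using mult_left_mono[OF x_inc[OF t] abs_ge_zero]
      by (intro sum_norm_le) (auto simp: mult_ac)
    also have "\<dots> \<le> K * (2 * C * h powr (\<alpha> - 1))"
      unfolding sum_distrib_left[symmetric]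
      using \<alpha> K by (intro mult_left_mono quasi_interpolation_moments(2)[OF qi t h]) auto
    finally show ?thesis
      by (simp add: V_def mult_ac)
  qed
  have F_le: "norm (\<Sum>k\<le>n. w k t *\<^sub>R E k t) \<le> S * h powr (2 * \<alpha>)" if t: "t \<in> {0..T}" for t
  proof -
    have "norm (\<Sum>k\<le>n. w k t *\<^sub>R E k t)
        \<le> (\<Sum>k\<le>n. 2 * K\<^sup>2 * (w k t * \<bar>\<tau> k - t\<bar> powr (2 * \<alpha>)) + h powr (2 * \<alpha>) * w k t)"
      using w_nonneg[OF t] mult_left_mono[OF E[OF t] w_nonneg[OF t]]
      by (intro sum_norm_le) (auto simp: algebra_simps)
    also have "\<dots> \<le> 2 * K\<^sup>2 * ((1 + C) * h powr (2 * \<alpha>)) + h powr (2 * \<alpha>)"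
      unfolding sum.distrib sum_distrib_left[symmetric] sum_w[OF t le0]
      using \<alpha> by (intro add_mono mult_left_mono quasi_interpolation_moments(1)[OF qi t h]) auto
    also have "\<dots> = S * h powr (2 * \<alpha>)"
      by (simp add: S_def algebra_simps)
    finally show ?thesis .
  qed
  have c_le: "norm (c t) \<le> (D + P * V) * h powr (2 * \<alpha> - 1)" if t: "t \<in> {0..T}" for t
  proof -
    have "norm (\<Sum>k\<le>n. w' k t *\<^sub>R E k t)
        \<le> (\<Sum>k\<le>n. 2 * K\<^sup>2 * (\<bar>w' k t\<bar> * \<bar>\<tau> k - t\<bar> powr (2 * \<alpha>)) + h powr (2 * \<alpha>) * \<bar>w' k t\<bar>)"
    proof (rule sum_norm_le)
      fix k
      show "norm (w' k t *\<^sub>R E k t)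
          \<le> 2 * K\<^sup>2 * (\<bar>w' k t\<bar> * \<bar>\<tau> k - t\<bar> powr (2 * \<alpha>)) + h powr (2 * \<alpha>) * \<bar>w' k t\<bar>"
        using mult_left_mono[OF E[OF t, of k] abs_ge_zero[of "w' k t"]]
        by (simp only: norm_scaleR distrib_left mult_ac)
    qed
    also have "\<dots> \<le> 2 * K\<^sup>2 * (2 * C * h powr (2 * \<alpha> - 1)) + h powr (2 * \<alpha>) * (C / h)"
      unfolding sum.distrib sum_distrib_left[symmetric]
      using \<alpha> by (intro add_mono mult_left_mono quasi_interpolation_moments(2)[OF qi t h]
          sum_abs[OF t le0]) auto
    also have "\<dots> = D * h powr (2 * \<alpha> - 1)"
      using h by (simp add: D_def powr_diff algebra_simps)
    finally have 1: "norm (\<Sum>k\<le>n. w' k t *\<^sub>R E k t) \<le> D * h powr (2 * \<alpha> - 1)" .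
    have "norm ((1 / 2) *\<^sub>R bracket (y t - x t) (v t)) \<le> P * h powr \<alpha> * (V * h powr (\<alpha> - 1))"
      using norm_bracket_bound[OF e_le[OF t] v_le[OF t]] by simp
    also have "\<dots> = P * V * h powr (2 * \<alpha> - 1)"
    proof -
      have "h powr \<alpha> * h powr (\<alpha> - 1) = h powr (2 * \<alpha> - 1)"
        unfolding powr_add[symmetric] by (simp add: algebra_simps)
      then show ?thesis
        by (metis (no_types, lifting) mult.assoc mult.left_commute)
    qed
    finally show ?thesis
      unfolding c_eq[OF t] using 1
      by (simp add: distrib_right norm_triangle_le_diff add_mono)
  qed
  have g_le: "gdist tens (X t) (Y t) \<le> (P + S + 1) * h powr \<alpha>" if t: "t \<in> {0..T}" for t
  proof -
    \<comment> \<open>In logarithmic coordinates, \<open>X_t\<^sup>-\<^sup>1 Y_t\<close> is the pair of \<open>?e\<close> and \<open>?F\<close>.\<close>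
    let ?e = "y t - x t" and ?F = "\<Sum>k\<le>n. w k t *\<^sub>R E k t"
    have P: "0 \<le> P" and S: "0 \<le> S"
      using K C by (simp_all add: P_def S_def)
    have "snd (Y t) - snd (X t) - tens (x t) ?e = (1 / 2) *\<^sub>R tens ?e ?e + ?F"
      unfolding F_eq[OF t, symmetric] a_def Y_def snd_conv
      by (simp add: tens_algebra algebra_simps half_plus_half)
    then have eq: "gdist tens (X t) (Y t) = gnorm (?e, (1 / 2) *\<^sub>R tens ?e ?e + ?F)"
      by (simp add: gdist_apply Y_def x_def)
    have "norm ((1 / 2) *\<^sub>R tens ?e ?e + ?F)
        \<le> (1 / 2) * (P * h powr \<alpha> * (P * h powr \<alpha>)) + S * h powr (2 * \<alpha>)"
      using norm_tens_bound[OF e_le[OF t] e_le[OF t]]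
      by (intro norm_triangle_mono F_le t) simp
    also have "\<dots> = (P\<^sup>2 / 2 + S) * (h powr \<alpha>)\<^sup>2"
      by (simp only: powr_double) (simp add: power2_eq_square algebra_simps)
    also have "\<dots> \<le> (P + S + 1)\<^sup>2 * (h powr \<alpha>)\<^sup>2"
    proof (intro mult_right_mono)
      have "P\<^sup>2 / 2 + S \<le> P\<^sup>2 + 2 * S * 1"
        using S by simp
      also have "\<dots> \<le> (P + S + 1)\<^sup>2"
        using P S by (simp add: power2_eq_square algebra_simps)
      finally show "P\<^sup>2 / 2 + S \<le> (P + S + 1)\<^sup>2" .
    qed simp
    finally have 2: "norm ((1 / 2) *\<^sub>R tens ?e ?e + ?F) \<le> ((P + S + 1) * h powr \<alpha>)\<^sup>2"
      by (simp add: power_mult_distrib)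
    have "norm ?e \<le> (P + S + 1) * h powr \<alpha>"
      using S by (intro order_trans[OF e_le[OF t]] mult_right_mono) auto
    then show ?thesis
      unfolding eq using 2 P S by (subst gnorm_le_iff) auto
  qed
  show thesis
    by (rule that[OF y_path v_path yv c_area Y_driven v_le c_le g_le])
qed

text \<open>
  Smoothing on the scale \<open>h = 1 / sqrt n\<close> gives a distance to \<open>X\<close> which is of order \<open>\<alpha>\<close> uniformly
  in \<open>n\<close> and which tends to zero uniformly in time. Interpolation makes it small in the order \<open>\<beta>\<close>,
  and then the drift of the smooth curve is removed.
\<close>

lemma smooth_lift_approximation:
  assumes T: "0 < T" and \<beta>: "0 < \<beta>" "\<beta> < \<alpha>" and \<alpha>: "\<alpha> < 1 / 2"
    and X: "X \<in> weakly_geometric tens T \<alpha>" and \<epsilon>: "0 < \<epsilon>"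
  shows "\<exists>x. smooth_path T x \<and> holder_dist tens T \<beta> X (S2 tens x 0) \<le> ereal \<epsilon>"
proof -
  have \<alpha>0: "0 < \<alpha>"
    using \<beta> by simp
  have XG: "X t \<in> G2 tens" if "t \<in> {0..T}" for t
    using X that by (simp add: weakly_geometric_def)
  have "X \<in> rough_paths tens T \<alpha>"
    using X by (simp add: weakly_geometric_def)
  then obtain K0 where K0: "\<And>s t. s \<in> {0..T} \<Longrightarrow> t \<in> {0..T} \<Longrightarrow>
      gnorm (ginc tens X s t) \<le> K0 * \<bar>t - s\<bar> powr \<alpha>"
    using rough_paths_iff[OF less_imp_le[OF T]] by blast
  define K where "K = \<bar>K0\<bar>"
  have XK: "gnorm (ginc tens X s t) \<le> K * \<bar>t - s\<bar> powr \<alpha>"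
    if "s \<in> {0..T}" "t \<in> {0..T}" for s t
    by (rule order_trans[OF K0[OF that] mult_right_mono]) (simp_all add: K_def)
  have K: "0 \<le> K"
    by (simp add: K_def)
  define C where "C = 3 * T + 3 / (2 * T) + 5"
  have C: "0 \<le> C"
    using T by (simp add: C_def)
  define P where "P = K * (1 + C)"
  define V where "V = 2 * K * C"
  define S where "S = 2 * K\<^sup>2 * (1 + C) + 1"
  define D where "D = 4 * K\<^sup>2 * C + C"
  define Q where "Q = K + P + V + S + 1 + D + P * V"
  have nn: "0 \<le> P" "0 \<le> V" "0 \<le> S" "0 \<le> D" "0 \<le> P * V"
    using K C by (simp_all add: P_def V_def S_def D_def)
  have Q: "1 \<le> Q" "K \<le> Q" "V \<le> Q" "D + P * V \<le> Q" "P + S + 1 \<le> 2 * Q"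
    using nn K by (simp_all add: Q_def)
  define \<eta> where "\<eta> h = sqrt ((4 * Q * h powr \<alpha>)\<^sup>2 + 2 * (Q * T powr \<alpha>) * (4 * Q * h powr \<alpha>))
      + 2 * Q * h powr \<alpha>" for h
  have "(\<lambda>n. 1 / sqrt (real n)) \<longlonglongrightarrow> 0"
    using tendsto_real_sqrt[OF lim_1_over_n] by (simp add: real_sqrt_divide)
  then have "(\<lambda>n. (1 / sqrt (real n)) powr \<alpha>) \<longlonglongrightarrow> 0 powr \<alpha>"
    using \<alpha>0 by (intro tendsto_powr2) auto
  then have hn: "(\<lambda>n. (1 / sqrt (real n)) powr \<alpha>) \<longlonglongrightarrow> 0"
    by simp
  have "(\<lambda>n. \<eta> (1 / sqrt (real n))) \<longlonglongrightarrow>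
      sqrt ((4 * Q * 0)\<^sup>2 + 2 * (Q * T powr \<alpha>) * (4 * Q * 0)) + 2 * Q * 0"
    unfolding \<eta>_def by (intro tendsto_intros hn)
  then have "(\<lambda>n. \<eta> (1 / sqrt (real n)) powr (1 - \<beta> / \<alpha>)) \<longlonglongrightarrow> 0 powr (1 - \<beta> / \<alpha>)"
    using \<beta> \<alpha>0 Q by (intro tendsto_powr2) (auto simp: \<eta>_def)
  from tendsto_mult_left[OF this, of "(9 * Q) powr (\<beta> / \<alpha>)"]
  have "(\<lambda>n. (9 * Q) powr (\<beta> / \<alpha>) * \<eta> (1 / sqrt (real n)) powr (1 - \<beta> / \<alpha>)) \<longlonglongrightarrow> 0"
    by simp
  from order_tendstoD(2)[OF this, of "\<epsilon> / 2"] \<epsilon>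
  have "\<forall>\<^sub>F n in sequentially. (9 * Q) powr (\<beta> / \<alpha>) * \<eta> (1 / sqrt (real n)) powr (1 - \<beta> / \<alpha>) < \<epsilon> / 2"
    by simp
  from eventually_happens[OF eventually_conj[OF this eventually_gt_at_top[of 0]]]
  obtain n :: nat where n: "0 < n"
    and small: "(9 * Q) powr (\<beta> / \<alpha>) * \<eta> (1 / sqrt (real n)) powr (1 - \<beta> / \<alpha>) < \<epsilon> / 2"
    by auto
  define h where "h = 1 / sqrt (real n)"
  have h: "0 < h"
    using n by (simp add: h_def)
  obtain \<tau> w w' where qi: "quasi_interpolation T h C n \<tau> w w'"
    using quasi_interpolation_exists[OF T n] unfolding h_def C_def by blast
  obtain Y y v c where y: "y \<in> trig_paths" "v \<in> trig_paths"
      "\<And>t. (y has_vector_derivative v t) (at t)" and c: "c \<in> area_drifts" and Y: "driven T Y v c"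
    and v_le: "\<And>t. t \<in> {0..T} \<Longrightarrow> norm (v t) \<le> V * h powr (\<alpha> - 1)"
    and c_le: "\<And>t. t \<in> {0..T} \<Longrightarrow> norm (c t) \<le> (D + P * V) * h powr (2 * \<alpha> - 1)"
    and g_le: "\<And>t. t \<in> {0..T} \<Longrightarrow> gdist tens (X t) (Y t) \<le> (P + S + 1) * h powr \<alpha>"
    by (rule smoothing[OF h \<alpha>0 \<alpha> K C qi, of X, folded P_def V_def S_def D_def])
      (rule XG XK that; assumption)+
  have "holder_dist tens T \<beta> X Y \<le> ereal ((9 * Q) powr (\<beta> / \<alpha>) * \<eta> h powr (1 - \<beta> / \<alpha>))"
  proof (rule holder_dist_interpolate[OF \<beta>])
    fix s t assume st: "0 \<le> s" "s < t" "t \<le> T"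
    have X': "gnorm (ginc tens X s t) \<le> Q * \<bar>t - s\<bar> powr \<alpha>" if "s \<in> {0..T}" "t \<in> {0..T}" for s t
      by (rule order_trans[OF XK[OF that] mult_right_mono[OF Q(2)]]) simp
    have v': "norm (v t) \<le> Q * h powr (\<alpha> - 1)" if "t \<in> {0..T}" for t
      by (rule order_trans[OF v_le[OF that] mult_right_mono[OF Q(3)]]) simp
    have c': "norm (c t) \<le> Q * h powr (2 * \<alpha> - 1)" if "t \<in> {0..T}" for t
      by (rule order_trans[OF c_le[OF that] mult_right_mono[OF Q(4)]]) simp
    have g': "gdist tens (X t) (Y t) \<le> 2 * Q * h powr \<alpha>" if "t \<in> {0..T}" for t
      by (rule order_trans[OF g_le[OF that] mult_right_mono[OF Q(5)]]) simp
    show "gdist tens (ginc tens X s t) (ginc tens Y s t) \<le> 9 * Q * (t - s) powr \<alpha>"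
      by (rule shadowing_path_estimates(1)[OF h \<alpha>0 \<alpha> Q(1) _ Y _ _ _ st]; (rule X' v' c' g'; assumption))
    show "gdist tens (ginc tens X s t) (ginc tens Y s t) \<le> \<eta> h"
      unfolding \<eta>_def
      by (rule shadowing_path_estimates(2)[OF h \<alpha>0 \<alpha> Q(1) _ Y _ _ _ st]; (rule X' v' c' g'; assumption))
  qed (use Q in simp)
  also have "\<dots> \<le> ereal (\<epsilon> / 2)"
    using small by (simp add: h_def)
  finally have XY: "holder_dist tens T \<beta> X Y \<le> ereal (\<epsilon> / 2)" .
  have "\<beta> < 1 / 2" "0 < \<epsilon> / 2"
    using \<beta> \<alpha> \<epsilon> by auto
  from area_drift_approximation[OF T \<beta>(1) this(1) c y Y this(2)]
  obtain x where x: "x \<in> trig_paths" "holder_dist tens T \<beta> Y (S2 tens x 0) \<le> ereal (\<epsilon> / 2)"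
    by blast
  have "holder_dist tens T \<beta> X (S2 tens x 0) \<le> ereal (\<epsilon> / 2 + \<epsilon> / 2)"
    by (rule holder_dist_triangle[OF XY x(2)])
  with trig_paths_smooth[OF x(1)] show ?thesis
    by auto
qed


section \<open>Geometric and weakly geometric rough paths\<close>

text \<open>
  The logarithm is continuous for the group distance, with a modulus of continuity that depends
  on the base point through a commutator only. So \<open>G2\<close> is closed for this distance.
\<close>

lemma G2_closed:
  assumes approx: "\<And>\<delta>. 0 < \<delta> \<Longrightarrow> \<exists>q\<in>G2 tens. gdist tens p q \<le> \<delta>"
  shows "p \<in> G2 tens"
proof -
  define a where "a q = snd q - (1 / 2) *\<^sub>R tens (fst q) (fst q)" for q :: "'a \<times> 'b"
  have "a p \<in> closure (closure antisymmetric)"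
  proof (subst closure_approachable, intro allI impI)
    fix e :: real assume e: "0 < e"
    define \<delta> where "\<delta> = min 1 (e / (norm (fst p) + 3))"
    have pos: "0 < norm (fst p) + 3"
      using norm_ge_zero[of "fst p"] by linarith
    then have \<delta>: "0 < \<delta>" "\<delta> \<le> 1" and "\<delta> \<le> e / (norm (fst p) + 3)"
      using e by (simp_all add: \<delta>_def)
    then have \<delta>_le: "\<delta> * (norm (fst p) + 3) \<le> e"
      using pos by (simp add: pos_le_divide_eq)
    obtain q where q: "q \<in> G2 tens" "gdist tens p q \<le> \<delta>"
      using approx[OF \<delta>(1)] by blast
    define d where "d = fst q - fst p"
    define r where "r = snd q - snd p - tens (fst p) d"
    have d: "norm d \<le> \<delta>" and r: "norm r \<le> \<delta>\<^sup>2"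
      using q(2) \<delta>(1) by (auto simp: gdist_apply gnorm_le_iff d_def r_def)
    have "a q - a p = (r + (1 / 2) *\<^sub>R bracket (fst p) d) - (1 / 2) *\<^sub>R tens d d"
      by (simp add: a_def r_def d_def tens_algebra algebra_simps half_plus_half)
    also have "norm \<dots> \<le> (\<delta>\<^sup>2 + norm (fst p) * \<delta>) + (1 / 2) * (\<delta> * \<delta>)"
      using norm_bracket_bound[OF order_refl d, of "fst p"] norm_tens_bound[OF d d]
      by (intro norm_triangle_le_diff add_mono norm_triangle_mono r) auto
    also have "\<dots> < \<delta> * (norm (fst p) + 3)"
    proof -
      have "\<delta> * \<delta> \<le> \<delta> * 1"
        using \<delta> by (intro mult_left_mono) auto
      then show ?thesis
        using \<delta>(1) by (simp add: power2_eq_square algebra_simps)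
    qed
    also note \<delta>_le
    finally have "dist (a q) (a p) < e"
      by (simp add: dist_norm)
    moreover have "a q \<in> closure antisymmetric"
      using q(1) unfolding G2_iff a_def .
    ultimately show "\<exists>z\<in>closure antisymmetric. dist z (a p) < e"
      by (intro bexI)
  qed
  then show ?thesis
    unfolding closure_closure G2_iff a_def .
qed

lemma geometric_subset_weakly_geometric:
  assumes T: "0 < T"
  shows "geometric tens T \<alpha> \<subseteq> weakly_geometric tens T \<alpha>"
proof
  fix X assume X: "X \<in> geometric tens T \<alpha>"
  then have rough: "X \<in> rough_paths tens T \<alpha>"
    by (simp add: geometric_def)
  then have X0: "X 0 = gone"
    using rough_paths_iff[OF less_imp_le[OF T]] by blast
  have "X t \<in> G2 tens" if t: "t \<in> {0..T}" for t
  proof (cases "t = 0")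
    case True
    then show ?thesis
      using X0 gone_in_G2 by simp
  next
    case False
    then have t': "0 < t" "t \<le> T"
      using t by auto
    show ?thesis
    proof (rule G2_closed)
      fix \<delta> :: real assume \<delta>: "0 < \<delta>"
      then have "0 < \<delta> / t powr \<alpha>"
        using t' by simp
      then obtain x where x: "smooth_path T x"
        "holder_dist tens T \<alpha> X (S2 tens x 0) < ereal (\<delta> / t powr \<alpha>)"
        using X unfolding geometric_def by blast
      have "gdist tens (ginc tens X 0 t) (ginc tens (S2 tens x 0) 0 t) \<le> \<delta> / t powr \<alpha> * (t - 0) powr \<alpha>"
        by (rule gdist_le_holder_dist[OF less_imp_le[OF x(2)] order_refl t'])
      moreover have "S2 tens x 0 \<in> rough_paths tens T 1"
        using smooth_path_lift(2)[OF less_imp_le[OF T] x(1)] by simp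
      then have "S2 tens x 0 0 = gone"
        using rough_paths_iff[OF less_imp_le[OF T]] by blast
      ultimately have "gdist tens (X t) (S2 tens x 0 t) \<le> \<delta>"
        using X0 t' by (simp add: ginc_gone)
      then show "\<exists>q\<in>G2 tens. gdist tens (X t) q \<le> \<delta>"
        using smooth_path_lift(1)[OF less_imp_le[OF T] x(1) t] by blast
    qed
  qed
  then show "X \<in> weakly_geometric tens T \<alpha>"
    using rough by (simp add: weakly_geometric_def)
qed

end

lemma tensor_square_tensor_group:
  fixes tens :: "'a::banach \<Rightarrow> 'a \<Rightarrow> 'b::banach"
  assumes "tensor_square tens"
  shows "tensor_group tens"
proof -
  have bil: "bilinear tens" and le: "\<And>x y. norm (tens x y) \<le> norm x * norm y"
    using assms by (auto simp: tensor_square_def algebraic_tensor_def)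
  show ?thesis
  proof
    show "\<exists>K. \<forall>a b. norm (tens a b) \<le> norm a * norm b * K"
      using le by (intro exI[of _ 1]) simp
  qed (use bil le in \<open>auto simp: bilinear_ladd bilinear_radd bilinear_lmul bilinear_rmul\<close>)
qed

theorem theorem3p3:
  fixes tens :: "'a::banach \<Rightarrow> 'a \<Rightarrow> 'b::banach" and T \<alpha> \<beta> :: real
  assumes tens: "tensor_square tens"
    and T: "T > 0"
    and \<alpha>: "1 / 3 < \<alpha>" "\<alpha> < 1 / 2"
    and \<beta>: "1 / 3 < \<beta>" "\<beta> < \<alpha>"
    and I: "\<exists>C>0. \<forall>z \<in> G2 tens. ereal (gdist tens gone z) \<le> ereal C * cc_dist tens T gone z"
    and II: "geodesic_space (Mcc tens T) (cc_rdist tens T)"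
            "Metric_space.mcomplete (Mcc tens T) (cc_rdist tens T)"
    and III: "\<forall>X \<in> weakly_geometric tens T \<alpha>. \<forall>\<epsilon>>0.
                \<exists>Y \<in> weakly_geometric tens T \<alpha> \<inter> cc_continuous tens T.
                  holder_dist tens T \<beta> X Y < ereal \<epsilon>"
  shows "(\<forall>X \<in> weakly_geometric tens T \<alpha>.
            \<exists>x :: nat \<Rightarrow> real \<Rightarrow> 'a.
              (\<forall>n. bv_path T (x n) \<and> S2 tens (x n) 0 \<in> rough_paths tens T \<beta>) \<and>
              X \<in> rough_paths tens T \<beta> \<and>
              (\<lambda>n. holder_dist tens T \<beta> (S2 tens (x n) 0) X) \<longlonglongrightarrow> 0) \<and>
         geometric tens T \<alpha> \<subseteq> weakly_geometric tens T \<alpha> \<and>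
         weakly_geometric tens T \<alpha> \<subseteq> geometric tens T \<beta>"
proof -
  interpret tensor_group tens
    by (rule tensor_square_tensor_group[OF tens])
  have \<beta>': "0 < \<beta>" "\<beta> \<le> 1" "\<beta> \<le> \<alpha>"
    using \<alpha> \<beta> by auto
  have T': "0 \<le> T"
    using T by simp
  have approx: "\<exists>x. smooth_path T x \<and> holder_dist tens T \<beta> X (S2 tens x 0) \<le> ereal \<epsilon>"
    if "X \<in> weakly_geometric tens T \<alpha>" "0 < \<epsilon>" for X \<epsilon>
    by (rule smooth_lift_approximation[OF T \<beta>'(1) \<beta>(2) \<alpha>(2) that])
  have rough: "X \<in> rough_paths tens T \<beta>" if "X \<in> weakly_geometric tens T \<alpha>" for X
    using rough_paths_mono[OF T' \<beta>'(3)] that by (simp add: weakly_geometric_def)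
  have "\<exists>x :: nat \<Rightarrow> real \<Rightarrow> 'a.
      (\<forall>n. bv_path T (x n) \<and> S2 tens (x n) 0 \<in> rough_paths tens T \<beta>) \<and>
      X \<in> rough_paths tens T \<beta> \<and>
      (\<lambda>n. holder_dist tens T \<beta> (S2 tens (x n) 0) X) \<longlonglongrightarrow> 0"
    if X: "X \<in> weakly_geometric tens T \<alpha>" for X
  proof -
    have "\<forall>n. \<exists>x. smooth_path T x \<and>
        holder_dist tens T \<beta> X (S2 tens x 0) \<le> ereal (inverse (real (Suc n)))"
      by (intro allI approx X) simp
    then obtain x where x: "\<And>n. smooth_path T (x n)"
      "\<And>n. holder_dist tens T \<beta> X (S2 tens (x n) 0) \<le> ereal (inverse (real (Suc n)))"
      by metis
    have "(\<lambda>n. holder_dist tens T \<beta> (S2 tens (x n) 0) X) \<longlonglongrightarrow> 0"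
    proof (rule tendsto_sandwich)
      show "\<forall>\<^sub>F n in sequentially. 0 \<le> holder_dist tens T \<beta> (S2 tens (x n) 0) X"
        by (intro always_eventually allI holder_dist_nonneg T)
      show "\<forall>\<^sub>F n in sequentially. holder_dist tens T \<beta> (S2 tens (x n) 0) X
          \<le> ereal (2 * inverse (real (Suc n)))"
        by (intro always_eventually allI holder_dist_commute_le x)
      have "(\<lambda>n. 2 * inverse (real (Suc n))) \<longlonglongrightarrow> 2 * 0"
        by (intro tendsto_mult_left LIMSEQ_inverse_real_of_nat)
      then show "(\<lambda>n. ereal (2 * inverse (real (Suc n)))) \<longlonglongrightarrow> 0"
        by (simp add: zero_ereal_def)
    qed simp
    then show ?thesis
      using smooth_path_lift(2,3)[OF T' x(1)] \<beta>'(2) rough[OF X] by blast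
  qed
  moreover have "weakly_geometric tens T \<alpha> \<subseteq> geometric tens T \<beta>"
  proof
    fix X assume X: "X \<in> weakly_geometric tens T \<alpha>"
    have "\<exists>x. smooth_path T x \<and> holder_dist tens T \<beta> X (S2 tens x 0) < ereal \<epsilon>" if "0 < \<epsilon>" for \<epsilon>
    proof -
      obtain x where x: "smooth_path T x" "holder_dist tens T \<beta> X (S2 tens x 0) \<le> ereal (\<epsilon> / 2)"
        using approx[OF X, of "\<epsilon> / 2"] \<open>0 < \<epsilon>\<close> by auto
      have "ereal (\<epsilon> / 2) < ereal \<epsilon>"
        using \<open>0 < \<epsilon>\<close> by simp
      with x show ?thesis
        by (intro exI conjI) (auto intro: order.strict_trans1)
    qed
    then show "X \<in> geometric tens T \<beta>"
      using rough[OF X] by (simp add: geometric_def)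
  qed
  ultimately show ?thesis
    using geometric_subset_weakly_geometric[OF T] by blast
qed

end
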